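(* Let $\tau\ge1$ be an integer, $c\in\mathbb{C}\setminus\{0\}$, let $a_0,\dots,a_\tau$ be complex constants with $a_\tau\neq 0$, and for an entire function $f$ let $L_c(z,f)=\sum_{j=0}^{\tau}a_jf(z+jc)$. Let $f(z)$ be a transcendental entire function with finite order, let $m$ and $n$ be two positive integers such that $m\ge n+2$, let $p(z)$ be a meromorphic function satisfying $\overline{N}\left(r,\frac{1}{p(z)}\right)=S(r,f)$, and let $q(z)$ be a non-zero meromorphic function satisfying $T(r,q(z))=S(r,f)$. Then $f(z)$ is not a solution of the equation $$f^m(z)+q(z)\bigl(L_c(z,f)\bigr)^n=p(z).$$
   Context: $T(r,f)$ denotes the Nevanlinna characteristic of a meromorphic function $f$ on $\mathbb{C}$, and $\overline{N}(r,f)$ the integrated counting function of the poles of $f$ counted without multiplicity (so $\overline{N}(r,1/p)$ counts the distinct zeros of $p$). $S(r,f)$ denotes any quantity satisfying $S(r,f)=o(T(r,f))$ as $r\to\infty$, possibly outside a set of $r$ of finite logarithmic measure. The order of $f$ is $\rho(f)=\limsup_{r\to\infty}\frac{\log T(r,f)}{\log r}$.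
   Formalization: The formal theorem additionally assumes that L_c(z,f) is not identically zero; without this the claim fails, e.g. f=e^z, c=2πi, L_c=f(z+c)−f(z)≡0, q=1, p=e^{mz}. *)

theory Defs
  imports "HOL-Complex_Analysis.Complex_Analysis" "HOL-Library.Landau_Symbols"
begin

text \<open>
  Meromorphic functions on the plane are functions \<open>f\<close> with \<open>f meromorphic_on UNIV\<close>. Their values
  at poles, and at a sparse set of further points, carry no information; equality of meromorphic
  functions is therefore \<open>\<forall>\<^sub>\<approx>z. f z = g z\<close>. The Nevanlinna quantities below are insensitive to
  changing \<open>f\<close> on a sparse set.
\<close>

definition pole_count :: "(complex \<Rightarrow> complex) \<Rightarrow> real \<Rightarrow> real" where
  "pole_count f t = (\<Sum>z | z \<in> cball 0 t \<and> is_pole f z. of_int (- zorder f z))"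

definition distinct_pole_count :: "(complex \<Rightarrow> complex) \<Rightarrow> real \<Rightarrow> real" where
  "distinct_pole_count f t = real (card {z \<in> cball 0 t. is_pole f z})"

definition integrated_counting :: "(real \<Rightarrow> real) \<Rightarrow> real \<Rightarrow> real" where
  "integrated_counting n r = integral {0..r} (\<lambda>t. (n t - n 0) / t) + n 0 * ln r"

definition nevanlinna_N :: "real \<Rightarrow> (complex \<Rightarrow> complex) \<Rightarrow> real" where
  "nevanlinna_N r f = integrated_counting (pole_count f) r"

definition nevanlinna_N_bar :: "real \<Rightarrow> (complex \<Rightarrow> complex) \<Rightarrow> real" where
  "nevanlinna_N_bar r f = integrated_counting (distinct_pole_count f) r"

text \<open>
  In the proximity function, \<open>ln 0 = 0\<close> gives the correct value \<open>0\<close> of \<open>log\<^sup>+\<close> at zeros of \<open>f\<close>.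
\<close>

definition nevanlinna_m :: "real \<Rightarrow> (complex \<Rightarrow> complex) \<Rightarrow> real" where
  "nevanlinna_m r f =
     integral {0..2 * pi} (\<lambda>\<theta>. max 0 (ln (norm (f (of_real r * cis \<theta>))))) / (2 * pi)"

definition nevanlinna_T :: "real \<Rightarrow> (complex \<Rightarrow> complex) \<Rightarrow> real" where
  "nevanlinna_T r f = nevanlinna_m r f + nevanlinna_N r f"

definition nevanlinna_order :: "(complex \<Rightarrow> complex) \<Rightarrow> ereal" where
  "nevanlinna_order f = Limsup at_top (\<lambda>r. ereal (ln (nevanlinna_T r f) / ln r))"

definition finite_log_measure :: "real set \<Rightarrow> bool" where
  "finite_log_measure E \<longleftrightarrow>
     E \<in> sets lebesgue \<and> (\<integral>\<^sup>+r\<in>E \<inter> {1..}. ennreal (1 / r) \<partial>lebesgue) < \<infinity>"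

text \<open>\<open>small_wrt g f\<close> is what is usually written \<open>g(r) = S(r, f)\<close>.\<close>

definition small_wrt :: "(real \<Rightarrow> real) \<Rightarrow> (complex \<Rightarrow> complex) \<Rightarrow> bool" where
  "small_wrt g f \<longleftrightarrow>
     (\<exists>E. finite_log_measure E \<and> g \<in> o[inf at_top (principal (- E))](\<lambda>r. nevanlinna_T r f))"

definition transcendental_entire :: "(complex \<Rightarrow> complex) \<Rightarrow> bool" where
  "transcendental_entire f \<longleftrightarrow> f holomorphic_on UNIV \<and> \<not> (\<exists>P. \<forall>z. f z = poly P z)"

text \<open>
  Even for transcendental \<open>f\<close> and a nonzero leading coefficient this may vanish identically:
  take \<open>f = exp\<close> and \<open>f (z + 2 * pi * \<i>) - f z\<close>.
\<close>

definition linear_difference ::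
    "(nat \<Rightarrow> complex) \<Rightarrow> nat \<Rightarrow> complex \<Rightarrow> (complex \<Rightarrow> complex) \<Rightarrow> complex \<Rightarrow> complex" where
  "linear_difference a \<tau> c f z = (\<Sum>j\<le>\<tau>. a j * f (z + of_nat j * c))"

end

theory Submission
  imports Defs
begin

text \<open>
  Suppose \<open>P = f\<^sup>m + q L\<^sup>n\<close> solves the equation and put \<open>\<phi> = m f' - (P'/P) f\<close>. Differentiating,
  \<open>f\<^sup>m\<^sup>-\<^sup>1 \<phi> = q L\<^sup>n (P'/P - q'/q - n L'/L)\<close>. As \<open>m - 2 \<ge> n\<close>, Clunie's argument together with the
  logarithmic derivative and logarithmic difference estimates gives \<open>m(r, \<phi>) = o(T(r, f))\<close> and
  \<open>m(r, f \<phi>) = o(T(r, f))\<close>; moreover the poles of \<open>\<phi>\<close> are at most simple and lie at zeros of \<open>P\<close>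
  or poles of \<open>q\<close>. Unless \<open>\<phi>\<close> vanishes identically, Jensen's formula applied to \<open>\<phi>\<close> bounds
  \<open>T(r, f) \<le> m(r, f \<phi>) + m(r, 1/\<phi>)\<close> by \<open>o(T(r, f))\<close>. If \<open>\<phi>\<close> or \<open>P\<close> vanishes identically, then \<open>f\<^sup>m\<close> is a
  constant multiple of \<open>q L\<^sup>n\<close>, whence \<open>(m - n) T(r, f) \<le> o(T(r, f))\<close>.

  It suffices to work with the radii \<open>s 2\<^sup>k\<close>: for almost every \<open>s\<close> they eventually avoid a set of
  finite logarithmic measure and all circles through zeros and poles, and finite order yields
  infinitely many \<open>k\<close> along which \<open>T\<close> grows by at most a fixed factor over the next few steps.
\<close>

section \<open>The positive part of the logarithm and circle means\<close>

text \<open>\<open>\<phi>\<close> is \<open>f\<close> times the logarithmic derivative of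
  \<open>f ^ m / P\<close>. Nothing is assumed about the growth of \<open>p\<close>; it enters only
  through its distinct zeros, and a logarithmic derivative sees a zero as a simple pole whatever its
  multiplicity. Hence counting without multiplicity suffices, while T(r, P) has to be estimated from
  the left-hand side of the equation. Of the m - 1 factors of \<open>f\<close> in the differentiated
  identity, n turn \<open>L ^ n\<close> into \<open>(L / f) ^ n\<close>, and at least one is left to
  form \<open>f * \<phi>\<close>. The estimates at radius r have the form const * (T(2r) + T(4r) +
  const) / sqrt r, in place of the classical O(log (r T)). Being linear in T, they help only where
  T(4r) = O(T(r)); this forces the choice of radii. Since T(r, L) is bounded through T(2r, f), also
  T(8r, f) occurs, so three doublings must be controlled. All estimates have one source: on a disc,
  F is a product of Blaschke factors times exp g, with Re g = ln |F| on the boundary. This takes the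
  place of the Poisson-Jensen formula.\<close>

definition log_plus :: "real \<Rightarrow> real" where
  "log_plus x = ln (max 1 x)"

lemma log_plus_nonneg [simp]: "log_plus x \<ge> 0"
  by (simp add: log_plus_def)

lemma log_plus_eq_max: "x \<ge> 0 \<Longrightarrow> log_plus x = max 0 (ln x)"
  by (cases "x = 0") (auto simp: log_plus_def max_def)

lemma log_plus_mono: "x \<le> y \<Longrightarrow> log_plus x \<le> log_plus y"
  by (simp add: log_plus_def)

lemma log_plus_eq_0: "x \<le> 1 \<Longrightarrow> log_plus x = 0"
  by (simp add: log_plus_def max_def)

lemma ln_le_log_plus: "x \<ge> 0 \<Longrightarrow> ln x \<le> log_plus x"
  by (simp add: log_plus_eq_max)

lemma log_plus_mult:
  assumes "x \<ge> 0" "y \<ge> 0"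
  shows "log_plus (x * y) \<le> log_plus x + log_plus y"
proof -
  have "x * y \<le> max 1 x * max 1 y"
    using assms by (intro mult_mono) auto
  moreover have "1 * 1 \<le> max 1 x * max 1 y"
    by (intro mult_mono) auto
  ultimately have "max 1 (x * y) \<le> max 1 x * max 1 y"
    by simp
  hence "log_plus (x * y) \<le> ln (max 1 x * max 1 y)"
    unfolding log_plus_def by (subst ln_le_cancel_iff) (auto simp: zero_less_mult_iff)
  also have "\<dots> = log_plus x + log_plus y"
    unfolding log_plus_def by (subst ln_mult) auto
  finally show ?thesis .
qed

lemma log_plus_add:
  assumes "x \<ge> 0" "y \<ge> 0"
  shows "log_plus (x + y) \<le> log_plus x + log_plus y + ln 2"
proof -
  have "log_plus (x + y) \<le> log_plus (2 * max x y)"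
    by (intro log_plus_mono) auto
  also have "\<dots> \<le> log_plus 2 + log_plus (max x y)"
    using assms by (intro log_plus_mult) auto
  also have "log_plus (max x y) \<le> log_plus x + log_plus y"
    by (simp add: max_def)
  finally show ?thesis by (simp add: log_plus_def)
qed

lemma log_plus_power:
  assumes "x \<ge> 0"
  shows "log_plus (x ^ n) = real n * log_plus x"
proof (cases "x \<le> 1")
  case True
  then show ?thesis using assms by (simp add: log_plus_eq_0 power_le_one)
next
  case False
  then show ?thesis by (simp add: log_plus_def max_def ln_realpow)
qed

lemma log_plus_sum:
  assumes "finite A" "\<And>i. i \<in> A \<Longrightarrow> x i \<ge> 0"
  shows "log_plus (\<Sum>i\<in>A. x i) \<le> (\<Sum>i\<in>A. log_plus (x i)) + real (card A) * ln 2"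
  using assms
proof (induction A rule: finite_induct)
  case empty
  then show ?case by (simp add: log_plus_def)
next
  case (insert a A)
  have "log_plus (\<Sum>i\<in>insert a A. x i) \<le> log_plus (x a) + log_plus (\<Sum>i\<in>A. x i) + ln 2"
    using insert by (simp add: log_plus_add sum_nonneg)
  also have "\<dots> \<le> log_plus (x a) + ((\<Sum>i\<in>A. log_plus (x i)) + real (card A) * ln 2) + ln 2"
    using insert by simp
  finally show ?case using insert by (simp add: algebra_simps)
qed

text \<open>Follows from 1 + x <= (1 + sqrt x)^2 and ln (1 + y) <= y.\<close>

lemma ln_one_plus_le_sqrt:
  fixes x :: real
  assumes "x \<ge> 0"
  shows "ln (1 + x) \<le> 2 * sqrt x"
proof -
  have "1 + x \<le> (1 + sqrt x)\<^sup>2"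
    using assms by (simp add: power2_sum)
  hence "ln (1 + x) \<le> ln ((1 + sqrt x)\<^sup>2)"
    using assms by (subst ln_le_cancel_iff) (auto intro!: zero_less_power add_pos_nonneg)
  also have "\<dots> = 2 * ln (1 + sqrt x)"
    using assms by (simp add: ln_realpow add_pos_nonneg)
  also have "ln (1 + sqrt x) \<le> sqrt x"
    using assms by (intro ln_add_one_self_le_self) auto
  finally show ?thesis by simp
qed

lemma log_plus_le_sqrt: "x \<ge> 0 \<Longrightarrow> log_plus x \<le> 2 * sqrt x"
  by (rule order_trans[OF _ ln_one_plus_le_sqrt]) (auto simp: log_plus_def)

lemma log_plus_minus_log_plus_inverse:
  assumes "x > 0"
  shows "log_plus x - log_plus (1 / x) = ln x"
  using assms by (cases "x \<ge> 1") (auto simp: log_plus_eq_max ln_div max_def)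

lemma abs_ln_eq_log_plus:
  assumes "x > 0"
  shows "\<bar>ln x\<bar> = 2 * log_plus x - ln x"
  using assms by (simp add: log_plus_eq_max max_def abs_if)

text \<open>With \<open>max 1\<close> inside the logarithm the argument stays at least 1, so zeros
  of \<open>h\<close> cause no discontinuity.\<close>

lemma continuous_on_log_plus [continuous_intros]:
  "continuous_on S h \<Longrightarrow> continuous_on S (\<lambda>x. log_plus (h x))"
  unfolding log_plus_def by (intro continuous_intros) auto

section \<open>Means over circles centred at the origin\<close>

definition circle_mean :: "real \<Rightarrow> (complex \<Rightarrow> real) \<Rightarrow> real" where
  "circle_mean r h = integral {0..2 * pi} (\<lambda>\<theta>. h (of_real r * cis \<theta>)) / (2 * pi)"

lemma continuous_on_circle:
  assumes "continuous_on (sphere 0 r) h" "r \<ge> 0"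
  shows "continuous_on A (\<lambda>\<theta>. h (of_real r * cis \<theta>))"
  using assms(2)
  by (intro continuous_on_compose2[OF assms(1)] continuous_intros) (auto simp: norm_mult)

lemma circle_integrable:
  fixes h :: "complex \<Rightarrow> 'a :: banach"
  assumes "continuous_on (sphere 0 r) h" "r \<ge> 0"
  shows "(\<lambda>\<theta>. h (of_real r * cis \<theta>)) integrable_on {0..2 * pi}"
  by (intro integrable_continuous_interval continuous_on_circle assms)

lemma circle_mean_cong:
  assumes "\<And>z. norm z = r \<Longrightarrow> h z = k z" "r \<ge> 0"
  shows "circle_mean r h = circle_mean r k"
  unfolding circle_mean_def using assms by (simp add: norm_mult)

lemma circle_mean_mono:
  assumes "continuous_on (sphere 0 r) h" "continuous_on (sphere 0 r) k" "r \<ge> 0"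
    and "\<And>z. norm z = r \<Longrightarrow> h z \<le> k z"
  shows "circle_mean r h \<le> circle_mean r k"
  unfolding circle_mean_def using assms
  by (intro divide_right_mono integral_le circle_integrable) (auto simp: norm_mult)

lemma circle_mean_const [simp]: "circle_mean r (\<lambda>_. c) = c"
  by (simp add: circle_mean_def)

lemma circle_mean_add:
  assumes "continuous_on (sphere 0 r) h" "continuous_on (sphere 0 r) k" "r \<ge> 0"
  shows "circle_mean r (\<lambda>z. h z + k z) = circle_mean r h + circle_mean r k"
  unfolding circle_mean_def using assms
  by (subst integral_add) (auto simp: add_divide_distrib intro: circle_integrable)

lemma circle_mean_diff:
  assumes "continuous_on (sphere 0 r) h" "continuous_on (sphere 0 r) k" "r \<ge> 0"
  shows "circle_mean r (\<lambda>z. h z - k z) = circle_mean r h - circle_mean r k"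
  unfolding circle_mean_def using assms
  by (subst integral_diff) (auto simp: diff_divide_distrib intro: circle_integrable)

lemma circle_mean_cmult: "circle_mean r (\<lambda>z. c * h z) = c * circle_mean r h"
  by (simp add: circle_mean_def)

lemma circle_mean_sum:
  assumes "finite A" "\<And>i. i \<in> A \<Longrightarrow> continuous_on (sphere 0 r) (h i)" "r \<ge> 0"
  shows "circle_mean r (\<lambda>z. \<Sum>i\<in>A. h i z) = (\<Sum>i\<in>A. circle_mean r (h i))"
  unfolding circle_mean_def using assms
  by (subst integral_sum) (auto simp: sum_divide_distrib intro: circle_integrable)

lemma circle_mean_nonneg:
  assumes "continuous_on (sphere 0 r) h" "r \<ge> 0" "\<And>z. norm z = r \<Longrightarrow> h z \<ge> 0"
  shows "circle_mean r h \<ge> 0"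
  using circle_mean_mono[of r "\<lambda>_. 0" h] assms by simp

lemma nevanlinna_m_eq: "nevanlinna_m r f = circle_mean r (\<lambda>z. log_plus (norm (f z)))"
  by (simp add: nevanlinna_m_def circle_mean_def log_plus_eq_max)

text \<open>\<open>sqrt\<close> is an odd function in HOL, so \<open>2 * sqrt (t - \<beta>)\<close>
  is continuous and an antiderivative on both sides of the singularity; the single point \<beta> may
  be excluded in the fundamental theorem. The bound is uniform in \<beta>, which may lie outside the
  interval.\<close>

lemma integral_inverse_sqrt_le:
  fixes \<beta> :: real
  shows "(\<lambda>t. 1 / sqrt \<bar>t - \<beta>\<bar>) integrable_on {0..2 * pi}"
    and "integral {0..2 * pi} (\<lambda>t. 1 / sqrt \<bar>t - \<beta>\<bar>) \<le> 4 * sqrt (2 * pi)"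
proof -
  let ?G = "\<lambda>t. 2 * sqrt (t - \<beta>)"
  have "((\<lambda>t. 1 / sqrt \<bar>t - \<beta>\<bar>) has_integral (?G (2 * pi) - ?G 0)) {0..2 * pi}"
  proof (rule fundamental_theorem_of_calculus_strong[of "{\<beta>}"])
    fix x assume "x \<in> {0..2 * pi} - {\<beta>}"
    hence x: "x \<noteq> \<beta>" by auto
    have "(?G has_real_derivative 1 / sqrt \<bar>x - \<beta>\<bar>) (at x)"
    proof (cases "x > \<beta>")
      case True
      then show ?thesis by (auto intro!: derivative_eq_intros simp: field_simps)
    next
      case False
      hence "x - \<beta> < 0" using x by simp
      have "(sqrt has_real_derivative - inverse (sqrt (x - \<beta>)) / 2) (at (x - \<beta>))"
        by (rule DERIV_real_sqrt_generic) (use \<open>x - \<beta> < 0\<close> in auto)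
      moreover have "((\<lambda>t. t - \<beta>) has_real_derivative 1) (at x)"
        by (auto intro!: derivative_eq_intros)
      ultimately have "((\<lambda>t. sqrt (t - \<beta>)) has_real_derivative - inverse (sqrt (x - \<beta>)) / 2) (at x)"
        using DERIV_chain'[where f = "\<lambda>t. t - \<beta>" and g = sqrt and x = x and s = UNIV] by fastforce
      from DERIV_cmult[OF this, of 2] show ?thesis
        using \<open>x - \<beta> < 0\<close> real_sqrt_minus[of "\<beta> - x"] by (simp add: inverse_eq_divide)
    qed
    then show "(?G has_vector_derivative 1 / sqrt \<bar>x - \<beta>\<bar>) (at x)"
      by (simp add: has_real_derivative_iff_has_vector_derivative)
  qed (auto intro!: continuous_intros)
  \<comment> \<open>Since \<open>sqrt\<close> is odd, three cases arise from the signs of x and x +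
    y; the inequality is applied with y = 2 pi and x = -\<beta>.\<close>
  moreover have "?G (2 * pi) - ?G 0 \<le> 4 * sqrt (2 * pi)"
  proof -
    have "sqrt (x + y) \<le> 2 * sqrt y + sqrt x" if "y \<ge> 0" for x y :: real
    proof (cases "x \<ge> 0")
      case True
      then show ?thesis using that sqrt_add_le_add_sqrt[of x y] real_sqrt_ge_zero[of y] by linarith
    next
      case False
      show ?thesis
      proof (cases "x \<ge> -y")
        case True
        have "sqrt (x + y) \<le> sqrt y" using False by simp
        moreover have "- sqrt x \<le> sqrt y"
          using True by (simp flip: real_sqrt_minus)
        ultimately show ?thesis by linarith
      next
        case F2: False
        have "sqrt (-x) \<le> sqrt (-(x+y)) + sqrt y"
          using sqrt_add_le_add_sqrt[of "-(x+y)" y] F2 that by simp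
        thus ?thesis using real_sqrt_ge_zero[OF that] unfolding real_sqrt_minus by linarith
      qed
    qed
    from this[of "2 * pi" "-\<beta>"] show ?thesis by simp
  qed
  ultimately show "(\<lambda>t. 1 / sqrt \<bar>t - \<beta>\<bar>) integrable_on {0..2 * pi}"
    and "integral {0..2 * pi} (\<lambda>t. 1 / sqrt \<bar>t - \<beta>\<bar>) \<le> 4 * sqrt (2 * pi)"
    by (auto simp: integrable_on_def integral_unique)
qed

text \<open>Up to pi / 3 the cosine is at least 1 / 2, so sin t - t / 2 increases; beyond that point
  sin x >= sqrt 3 / 2 >= 0.8 >= x / 2.\<close>

lemma sin_ge_half:
  fixes x :: real
  assumes "0 \<le> x" "x \<le> pi / 2"
  shows "x / 2 \<le> sin x"
proof (cases "x \<le> pi / 3")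
  case True
  have "(\<lambda>t. sin t - t / 2) 0 \<le> (\<lambda>t. sin t - t / 2) x"
  proof (rule DERIV_nonneg_imp_nondecreasing[OF assms(1)])
    fix t assume t: "0 \<le> t" "t \<le> x"
    have "cos (pi / 3) \<le> cos t"
      using t True pi_gt_zero by (subst cos_mono_le_eq) auto
    hence "cos t - 1 / 2 \<ge> 0" by (simp add: cos_60)
    moreover have "((\<lambda>t. sin t - t / 2) has_real_derivative cos t - 1 / 2) (at t)"
      by (auto intro!: derivative_eq_intros)
    ultimately show "\<exists>y. ((\<lambda>t. sin t - t / 2) has_real_derivative y) (at t) \<and> 0 \<le> y" by blast
  qed
  thus ?thesis by simp
next
  case False
  have "sin (pi / 3) \<le> sin x"
    using False assms pi_gt_zero by (subst sin_mono_le_eq) auto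
  moreover have "x / 2 \<le> 0.8" using assms pi_less_4 pi_approx by simp
  moreover have "sqrt 3 \<ge> 1.6" by (rule real_le_rsqrt) (simp add: power2_eq_square)
  ultimately show ?thesis by (simp add: sin_60)
qed

text \<open>|cis t - 1| = 2 |sin (t / 2)|, and \<open>sin_ge_half\<close> compares chord and arc
  after the reflection s -> 2 pi - s. The range of \<open>t\<close> is that of a difference of two
  angles in [0, 2 pi], hence the three candidates 0, 2 pi and -2 pi for the nearest period.\<close>

lemma dist_circle_ge:
  assumes "\<bar>t\<bar> \<le> 2 * pi"
  shows "min \<bar>t\<bar> (min \<bar>t - 2 * pi\<bar> \<bar>t + 2 * pi\<bar>) \<le> 2 * norm (cis t - 1)"
proof -
  have eq: "norm (cis t - 1) = 2 * \<bar>sin (t / 2)\<bar>"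
    using dist_exp_i_1[of t] by (simp add: cis_conv_exp)
  have *: "min s (2 * pi - s) \<le> 4 * sin (s / 2)" if "0 \<le> s" "s \<le> 2 * pi" for s :: real
  proof (cases "s \<le> pi")
    case True
    thus ?thesis using sin_ge_half[of "s/2"] that by simp
  next
    case False
    have "sin ((2 * pi - s) / 2) = sin (s / 2)"
      using sin_pi_minus[of "s/2"] by (simp add: diff_divide_distrib)
    thus ?thesis using sin_ge_half[of "(2 * pi - s)/2"] that False by simp
  qed
  show ?thesis
  proof (cases "t \<ge> 0")
    case True
    have "sin (t / 2) \<ge> 0" using True assms by (intro sin_ge_zero) auto
    with *[of t] True assms eq show ?thesis by auto
  next
    case False
    have "sin (- t / 2) \<ge> 0" using False assms by (intro sin_ge_zero) auto
    with *[of "-t"] False assms eq show ?thesis by auto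
  qed
qed

text \<open>The point is uniformity in \<open>a\<close>, which may lie arbitrarily close to the
  circle: |z - a| is at least r / 4 times the angular distance of z from the direction of
  \<open>a\<close>, and the inverse square root of that distance is integrable. The condition on
  \<open>a\<close> makes the integrand continuous.\<close>

lemma circle_mean_inverse_sqrt_le:
  assumes r: "r > 0" and a: "norm a \<noteq> r"
  shows "circle_mean r (\<lambda>z. 1 / sqrt (norm (z - a))) \<le> 12 / sqrt r"
proof -
  define \<alpha> where "\<alpha> = (if a = 0 then 0 else Arg2pi a)"
  have \<alpha>: "0 \<le> \<alpha>" "\<alpha> \<le> 2 * pi"
    using Arg2pi_ge_0[of a] Arg2pi_lt_2pi[of a] by (auto simp: \<alpha>_def)
  have a_eq: "a = of_real (norm a) * cis \<alpha>"
    using Arg2pi_eq[of a] by (auto simp: \<alpha>_def cis_conv_exp)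
  \<comment> \<open>At these angles a summand of \<open>u\<close> is 1 / 0 = 0, so the pointwise
    bound may fail; the finite set is discarded before integrating.\<close>
  define S where "S = {\<alpha>, \<alpha> + 2 * pi, \<alpha> - 2 * pi}"
  define h where "h = (\<lambda>\<theta>. 1 / sqrt (norm (of_real r * cis \<theta> - a)))"
  define u where "u = (\<lambda>\<theta>. 2 / sqrt r * (1 / sqrt \<bar>\<theta> - \<alpha>\<bar> + 1 / sqrt \<bar>\<theta> - (\<alpha> + 2 * pi)\<bar>
     + 1 / sqrt \<bar>\<theta> - (\<alpha> - 2 * pi)\<bar>))"
  have hint: "h integrable_on {0..2*pi}"
    unfolding h_def by (rule circle_integrable) (use r a in \<open>auto intro!: continuous_intros\<close>)
  have uint: "u integrable_on {0..2*pi}"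
    unfolding u_def by (intro integrable_on_mult_right integrable_add integral_inverse_sqrt_le(1))
  have le: "(if \<theta> \<in> S then 0 else h \<theta>) \<le> u \<theta>" if \<theta>: "\<theta> \<in> {0..2*pi}" for \<theta>
  proof (cases "\<theta> \<in> S")
    case True
    thus ?thesis using r by (auto simp: u_def intro!: mult_nonneg_nonneg add_nonneg_nonneg)
  next
    case False
    define z where "z = of_real r * cis \<theta>"
    define z0 where "z0 = of_real r * cis \<alpha>"
    have nz: "norm z = r" using r by (simp add: z_def norm_mult)
    \<comment> \<open>\<open>z0\<close> is a point of the circle nearest to \<open>a\<close>, so \<open>\<bar>z - z0\<bar> \<le> 2 \<bar>z - a\<bar>\<close>.\<close>
    have "norm (z0 - a) = norm (of_real (r - norm a) * cis \<alpha>)"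
      by (subst a_eq) (simp add: z0_def algebra_simps)
    also have "\<dots> = \<bar>r - norm a\<bar>" by (simp only: norm_mult norm_of_real norm_cis mult_1_right)
    also have "\<dots> \<le> norm (z - a)" using norm_triangle_ineq3[of z a] nz by simp
    finally have "norm (z - z0) \<le> 2 * norm (z - a)"
      using norm_triangle_ineq4[of "z - a" "z0 - a"] by simp
    moreover have "z - z0 = z0 * (cis (\<theta> - \<alpha>) - 1)"
      by (simp add: z_def z0_def algebra_simps cis_mult)
    hence "norm (z - z0) = r * norm (cis (\<theta> - \<alpha>) - 1)"
      using r by (simp add: norm_mult z0_def)
    moreover define d where "d = min \<bar>\<theta> - \<alpha>\<bar> (min \<bar>\<theta> - \<alpha> - 2 * pi\<bar> \<bar>\<theta> - \<alpha> + 2 * pi\<bar>)"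
    have "d \<le> 2 * norm (cis (\<theta> - \<alpha>) - 1)"
      unfolding d_def by (rule dist_circle_ge) (use \<theta> \<alpha> in auto)
    hence "r * d \<le> r * (2 * norm (cis (\<theta> - \<alpha>) - 1))"
      using r by (intro mult_left_mono) auto
    ultimately have *: "r * d \<le> 4 * norm (z - a)" by simp
    have d: "d > 0" using False by (auto simp: d_def S_def)
    have "h \<theta> = 2 / sqrt (4 * norm (z - a))"
      by (simp add: h_def z_def real_sqrt_mult)
    also have "\<dots> \<le> 2 / sqrt (r * d)"
    proof (intro divide_left_mono)
      show "0 < sqrt (4 * norm (z - a)) * sqrt (r * d)"
        using order.strict_trans2[OF mult_pos_pos[OF r d] *] mult_pos_pos[OF r d]
        by (intro mult_pos_pos[OF real_sqrt_gt_zero real_sqrt_gt_zero])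
    qed (use * d r in auto)
    also have "\<dots> = 2 / sqrt r * (1 / sqrt d)" by (simp add: real_sqrt_mult)
    also have "\<dots> \<le> u \<theta>"
      unfolding u_def
    proof (intro mult_left_mono)
      have "d = \<bar>\<theta> - \<alpha>\<bar> \<or> d = \<bar>\<theta> - (\<alpha> + 2 * pi)\<bar> \<or> d = \<bar>\<theta> - (\<alpha> - 2 * pi)\<bar>"
        by (auto simp: d_def min_def algebra_simps)
      thus "1 / sqrt d \<le> 1 / sqrt \<bar>\<theta> - \<alpha>\<bar> + 1 / sqrt \<bar>\<theta> - (\<alpha> + 2 * pi)\<bar>
         + 1 / sqrt \<bar>\<theta> - (\<alpha> - 2 * pi)\<bar>"
        by (elim disjE; simp only:) auto
    qed (use r in auto)
    finally show ?thesis using False by simp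
  qed
  have "integral {0..2*pi} h = integral {0..2*pi} (\<lambda>\<theta>. if \<theta> \<in> S then 0 else h \<theta>)"
    by (rule integral_spike[of S]) (auto simp: S_def)
  also have "\<dots> \<le> integral {0..2*pi} u"
  proof (rule integral_le[OF _ uint le])
    show "(\<lambda>\<theta>. if \<theta> \<in> S then 0 else h \<theta>) integrable_on {0..2*pi}"
      by (rule integrable_spike_finite[OF _ _ hint, of S]) (auto simp: S_def)
  qed
  also have "\<dots> \<le> 2 / sqrt r * (4 * sqrt (2 * pi) + 4 * sqrt (2 * pi) + 4 * sqrt (2 * pi))"
  proof -
    let ?I = "\<lambda>\<beta>. integral {0..2*pi} (\<lambda>\<theta>. 1 / sqrt \<bar>\<theta> - \<beta>\<bar>)"
    have "integral {0..2*pi} u = 2 / sqrt r * (?I \<alpha> + ?I (\<alpha> + 2 * pi) + ?I (\<alpha> - 2 * pi))"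
      unfolding u_def
      by (simp only: integral_mult_right integral_add integrable_add integral_inverse_sqrt_le(1))
    also have "\<dots> \<le> 2 / sqrt r * (4 * sqrt (2 * pi) + 4 * sqrt (2 * pi) + 4 * sqrt (2 * pi))"
      using r by (intro mult_left_mono add_mono integral_inverse_sqrt_le(2)) auto
    finally show ?thesis .
  qed
  finally have "circle_mean r (\<lambda>z. 1 / sqrt (norm (z - a))) \<le> (2 / sqrt r * (12 * sqrt (2 * pi))) / (2 * pi)"
    unfolding circle_mean_def h_def by (intro divide_right_mono) auto
  also have "\<dots> = 24 / sqrt r * (sqrt (2 * pi) / (2 * pi))" by simp
  \<comment> \<open>Because sqrt (2 pi) >= 2, the factor 24 / sqrt (2 pi) is at most 12.\<close>
  also have "\<dots> \<le> 24 / sqrt r * (1 / 2)"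
  proof (intro mult_left_mono)
    have "2 \<le> sqrt (2 * pi)" by (rule real_le_rsqrt) (use pi_gt3 in auto)
    hence "1 / sqrt (2 * pi) \<le> 1 / 2" by (intro divide_left_mono) auto
    moreover have "sqrt (2 * pi) / (2 * pi) = 1 / sqrt (2 * pi)"
      using real_div_sqrt[of "2 * pi"] real_sqrt_ge_zero[of "2 * pi"] pi_gt_zero
      by (simp add: divide_simps)
    ultimately show "sqrt (2 * pi) / (2 * pi) \<le> 1 / 2" by simp
  qed (use r in auto)
  finally show ?thesis by simp
qed

section \<open>Schwarz's formula and Blaschke factors\<close>

lemma circle_has_integral:
  assumes "(h has_contour_integral J) (circlepath 0 R)" "R > 0" "J = \<i> * I"
  shows "((\<lambda>\<theta>. h (of_real R * cis \<theta>) * (of_real R * cis \<theta>)) has_integral I) {0..2 * pi}"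
proof -
  have "(h has_contour_integral J) (part_circlepath 0 R 0 (2 * pi))"
    using assms(1) by (simp add: circlepath_def)
  hence "((\<lambda>t. h (0 + of_real R * cis t) * of_real R * \<i> * cis t) has_integral J) {0..2 * pi}"
    by (subst (asm) has_contour_integral_part_circlepath_iff) auto
  from has_integral_mult_left[OF this, of "1 / \<i>"] show ?thesis
    by (simp add: field_simps assms(3))
qed

lemma circle_mean_Re_holomorphic:
  assumes "g holomorphic_on ball 0 R'" "0 < R" "R < R'"
  shows "circle_mean R (\<lambda>z. Re (g z)) = Re (g 0)"
proof -
  have "((\<lambda>u. g u / (u - 0)) has_contour_integral (2 * of_real pi * \<i> * g 0)) (circlepath 0 R)"
    by (rule Cauchy_integral_circlepath_simple)
       (use assms in \<open>auto intro: holomorphic_on_subset\<close>)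
  from circle_has_integral[OF this assms(2), of "2 * of_real pi * g 0"]
  have "((\<lambda>\<theta>. g (of_real R * cis \<theta>)) has_integral (2 * of_real pi * g 0)) {0..2 * pi}"
    using assms(2) by simp
  hence "((\<lambda>\<theta>. Re (g (of_real R * cis \<theta>))) has_integral Re (2 * of_real pi * g 0)) {0..2 * pi}"
    by (rule has_integral_Re)
  thus ?thesis
    by (simp add: circle_mean_def integral_unique)
qed

text \<open>
  In Cauchy's formula for \<open>g'(w)\<close> one may replace \<open>g\<close> by \<open>2 Re g\<close>, since the corresponding integral
  of the conjugate of \<open>g\<close> is the conjugate of \<open>\<integral> g(\<zeta>) / (R\<^sup>2 - cnj w \<zeta>)\<^sup>2 d\<zeta> = 0\<close>, up to a factor.
\<close>

lemma norm_deriv_le_circle_mean: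
  assumes g: "g holomorphic_on ball 0 R'" and R: "0 < R" "R < R'" and w: "norm w \<le> 3 / 4 * R"
  shows "norm (deriv g w) \<le> 32 / R * circle_mean R (\<lambda>z. \<bar>Re (g z)\<bar>)"
proof -
  define \<zeta> where "\<zeta> = (\<lambda>\<theta>. of_real R * cis \<theta> :: complex)"
  have n\<zeta>: "norm (\<zeta> t) = R" for t using R by (simp add: \<zeta>_def norm_mult)
  have hol: "g holomorphic_on cball 0 R"
    using g by (rule holomorphic_on_subset) (use R in auto)
  have cont: "continuous_on (cball 0 R) g"
    using hol by (rule holomorphic_on_imp_continuous_on)
  have w_in: "w \<in> ball 0 R" using w R by simp
  have "((\<lambda>u. g u / (u - w) ^ Suc 1) has_contour_integral ((2 * pi * \<i>) / (fact 1) * (deriv ^^ 1) g w)) (circlepath 0 R)"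
    by (rule Cauchy_has_contour_integral_higher_derivative_circlepath[OF cont _ w_in])
       (use hol in \<open>auto intro: holomorphic_on_subset\<close>)
  from circle_has_integral[OF this R(1), of "2 * of_real pi * deriv g w"]
  have 1: "((\<lambda>t. g (\<zeta> t) * \<zeta> t / (\<zeta> t - w)\<^sup>2) has_integral (2 * pi * deriv g w)) {0..2 * pi}"
    by (simp add: \<zeta>_def power2_eq_square)
  have nz: "of_real R ^ 2 - cnj w * u \<noteq> 0" if "norm u \<le> R" for u
  proof
    assume "of_real R ^ 2 - cnj w * u = 0"
    hence "norm (of_real R ^ 2 :: complex) = norm (cnj w * u)" by simp
    hence "R * R = norm w * norm u" using R by (simp add: norm_mult norm_power power2_eq_square)
    also have "\<dots> \<le> (3/4 * R) * R" using w that R by (intro mult_mono) auto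
    finally show False using R by (simp add: field_simps)
  qed
  have "((\<lambda>u. g u / (of_real R ^ 2 - cnj w * u)\<^sup>2) has_contour_integral 0) (circlepath 0 R)"
  proof (rule Cauchy_theorem_disc_simple)
    \<comment> \<open>For w nonzero the denominator vanishes at modulus R^2 / |w| >= 4 / 3 * R,
      which leaves room beyond the circle for Cauchy's theorem.\<close>
    have "norm (cnj w * u) < R\<^sup>2" if "norm u < 4 / 3 * R" for u
    proof (cases "w = 0")
      case True thus ?thesis using R by simp
    next
      case False
      have "norm (cnj w * u) = norm w * norm u" by (simp add: norm_mult)
      also have "\<dots> < norm w * (4 / 3 * R)" using that False by (intro mult_strict_left_mono) auto
      also have "\<dots> \<le> 3 / 4 * R * (4 / 3 * R)" using w R by (intro mult_right_mono) auto
      finally show ?thesis by (simp add: power2_eq_square)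
    qed
    moreover have "norm (of_real R ^ 2 :: complex) = R\<^sup>2"
      using R by (simp add: norm_power)
    ultimately have "of_real R ^ 2 - cnj w * u \<noteq> 0" if "norm u < 4 / 3 * R" for u
      using that by fastforce
    thus "(\<lambda>u. g u / (of_real R ^ 2 - cnj w * u)\<^sup>2) holomorphic_on ball 0 (min R' (4 / 3 * R))"
      by (intro holomorphic_intros holomorphic_on_subset[OF g]) auto
  qed (use R in \<open>auto simp: path_image_circlepath_minus\<close>)
  from circle_has_integral[OF this R(1), of 0]
  have "((\<lambda>t. g (\<zeta> t) * \<zeta> t / (of_real R ^ 2 - cnj w * \<zeta> t)\<^sup>2) has_integral 0) {0..2 * pi}"
    by (simp add: \<zeta>_def)
  from has_integral_linear[OF this bounded_linear_cnj]
  have "((\<lambda>t. cnj (g (\<zeta> t)) * cnj (\<zeta> t) / (of_real R ^ 2 - w * cnj (\<zeta> t))\<^sup>2) has_integral 0) {0..2 * pi}"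
    by (simp add: o_def)
  \<comment> \<open>On the circle R^2 = \<zeta> * cnj \<zeta>; this factor turns the conjugated
    kernel into \<zeta> / (\<zeta> - w)^2.\<close>
  from has_integral_mult_left[OF this, of "of_real (R ^ 2)"]
  have "((\<lambda>t. cnj (g (\<zeta> t)) * cnj (\<zeta> t) / (of_real R ^ 2 - w * cnj (\<zeta> t))\<^sup>2 * of_real (R ^ 2))
     has_integral 0) {0..2 * pi}" by simp
  moreover have "cnj (g (\<zeta> t)) * cnj (\<zeta> t) / (of_real R ^ 2 - w * cnj (\<zeta> t))\<^sup>2 * of_real (R ^ 2)
      = cnj (g (\<zeta> t)) * \<zeta> t / (\<zeta> t - w)\<^sup>2" for t
  proof -
    have RR: "of_real R ^ 2 = \<zeta> t * cnj (\<zeta> t)"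
      using complex_norm_square[of "\<zeta> t"] n\<zeta>[of t] by simp
    have "\<zeta> t \<noteq> 0" "\<zeta> t - w \<noteq> 0" using n\<zeta>[of t] R w_in by auto
    have "(of_real R ^ 2 - w * cnj (\<zeta> t)) = cnj (\<zeta> t) * (\<zeta> t - w)"
      unfolding RR by (simp add: algebra_simps)
    moreover have "G * v / (v * U)\<^sup>2 * (u * v) = G * u / U\<^sup>2" if "v \<noteq> 0" for G U u v :: complex
      using that by (simp add: power2_eq_square)
    ultimately show ?thesis using RR \<open>\<zeta> t \<noteq> 0\<close> by simp
  qed
  ultimately have 2: "((\<lambda>t. cnj (g (\<zeta> t)) * \<zeta> t / (\<zeta> t - w)\<^sup>2) has_integral 0) {0..2 * pi}"
    by simp
  have "((\<lambda>t. g (\<zeta> t) * \<zeta> t / (\<zeta> t - w)\<^sup>2 + cnj (g (\<zeta> t)) * \<zeta> t / (\<zeta> t - w)\<^sup>2)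
      has_integral (2 * pi * deriv g w + 0)) {0..2 * pi}"
    by (intro has_integral_add 1 2)
  moreover have "g (\<zeta> t) * \<zeta> t / (\<zeta> t - w)\<^sup>2 + cnj (g (\<zeta> t)) * \<zeta> t / (\<zeta> t - w)\<^sup>2 =
      of_real (2 * Re (g (\<zeta> t))) * \<zeta> t / (\<zeta> t - w)\<^sup>2" for t
    by (simp add: add_divide_distrib[symmetric] distrib_right[symmetric] complex_add_cnj)
  ultimately have 3: "((\<lambda>t. of_real (2 * Re (g (\<zeta> t))) * \<zeta> t / (\<zeta> t - w)\<^sup>2)
      has_integral (2 * pi * deriv g w)) {0..2 * pi}" by simp
  have cont': "continuous_on (sphere 0 R) (\<lambda>z. \<bar>Re (g z)\<bar>)"
    by (intro continuous_intros continuous_on_subset[OF cont]) auto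
  have "norm (integral {0..2 * pi} (\<lambda>t. of_real (2 * Re (g (\<zeta> t))) * \<zeta> t / (\<zeta> t - w)\<^sup>2)) \<le>
     integral {0..2 * pi} (\<lambda>t. 32 / R * \<bar>Re (g (\<zeta> t))\<bar>)"
  proof (rule integral_norm_bound_integral)
    show "(\<lambda>t. of_real (2 * Re (g (\<zeta> t))) * \<zeta> t / (\<zeta> t - w)\<^sup>2) integrable_on {0..2 * pi}"
      using 3 by (auto simp: integrable_on_def)
    show "(\<lambda>t. 32 / R * \<bar>Re (g (\<zeta> t))\<bar>) integrable_on {0..2 * pi}"
      unfolding \<zeta>_def by (intro integrable_on_mult_right circle_integrable cont') (use R in auto)
    fix t
    \<comment> \<open>With this lower bound the kernel, doubled, is at most 2 R / (R / 4)^2 = 32 /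
      R.\<close>
    have "R / 4 \<le> norm (\<zeta> t - w)"
      using norm_triangle_ineq2[of "\<zeta> t" w] n\<zeta>[of t] w by simp
    hence "(R / 4)\<^sup>2 \<le> (norm (\<zeta> t - w))\<^sup>2" using R by (intro power_mono) auto
    moreover have "0 < (R / 4)\<^sup>2" using R by simp
    ultimately have "2 * \<bar>Re (g (\<zeta> t))\<bar> * R / (norm (\<zeta> t - w))\<^sup>2 \<le> 2 * \<bar>Re (g (\<zeta> t))\<bar> * R / (R / 4)\<^sup>2"
      using R by (intro divide_left_mono mult_pos_pos) auto
    also have "\<dots> = 32 / R * \<bar>Re (g (\<zeta> t))\<bar>"
      using R by (simp add: power2_eq_square field_simps)
    finally show "norm (of_real (2 * Re (g (\<zeta> t))) * \<zeta> t / (\<zeta> t - w)\<^sup>2) \<le> 32 / R * \<bar>Re (g (\<zeta> t))\<bar>"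
      by (simp add: norm_mult norm_divide norm_power n\<zeta>)
  qed
  also have "integral {0..2 * pi} (\<lambda>t. of_real (2 * Re (g (\<zeta> t))) * \<zeta> t / (\<zeta> t - w)\<^sup>2) = 2 * pi * deriv g w"
    using 3 by (rule integral_unique)
  finally have "2 * pi * norm (deriv g w) \<le> integral {0..2 * pi} (\<lambda>t. 32 / R * \<bar>Re (g (\<zeta> t))\<bar>)"
    by (simp add: norm_mult)
  hence "norm (deriv g w) \<le> integral {0..2 * pi} (\<lambda>t. 32 / R * \<bar>Re (g (\<zeta> t))\<bar>) / (2 * pi)"
    by (subst pos_le_divide_eq) (simp_all only: mult.commute pi_gt_zero zero_less_mult_iff, auto)
  also have "\<dots> = circle_mean R (\<lambda>z. 32 / R * \<bar>Re (g z)\<bar>)"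
    by (simp add: circle_mean_def \<zeta>_def)
  finally show ?thesis by (simp only: circle_mean_cmult)
qed

section \<open>Blaschke factors of the disc of radius R\<close>

definition blaschke :: "real \<Rightarrow> complex \<Rightarrow> complex \<Rightarrow> complex" where
  "blaschke R a z = of_real R * (z - a) / (of_real R ^ 2 - cnj a * z)"

lemma blaschke_denom:
  assumes "norm a < R" "norm z \<le> R"
  shows "of_real R ^ 2 - cnj a * z \<noteq> 0"
    and "norm (of_real R ^ 2 - cnj a * z) \<ge> R * (R - norm z)"
proof -
  have R: "R > 0" using assms by (metis norm_ge_zero order.strict_trans1)
  have *: "norm (cnj a * z) \<le> R * norm z"
    using assms by (simp add: norm_mult mult_right_mono)
  have "norm (of_real R ^ 2 - cnj a * z) \<ge> norm (of_real R ^ 2 :: complex) - norm (cnj a * z)"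
    by (rule norm_triangle_ineq2)
  also have "norm (of_real R ^ 2 :: complex) = R * R" using R by (simp add: norm_mult power2_eq_square)
  finally show "norm (of_real R ^ 2 - cnj a * z) \<ge> R * (R - norm z)"
    using * by (simp add: algebra_simps)
  have "norm (cnj a * z) < R * R"
  proof -
    have "norm a * norm z \<le> norm a * R" using assms by (intro mult_left_mono) auto
    also have "\<dots> < R * R" using assms R by (intro mult_strict_right_mono) auto
    finally show ?thesis by (simp add: norm_mult)
  qed
  moreover have "norm (of_real R ^ 2 :: complex) = R * R"
    using R by (simp add: norm_mult power2_eq_square)
  ultimately show "of_real R ^ 2 - cnj a * z \<noteq> 0" by auto
qed

lemma norm_blaschke_circle:
  assumes "norm a < R" "norm z = R"
  shows "norm (blaschke R a z) = 1"
proof -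
  have R: "R > 0" using assms by (metis norm_ge_zero order.strict_trans1)
  have "of_real R ^ 2 - cnj a * z = z * cnj (z - a)"
    using complex_norm_square[of z] assms by (simp add: algebra_simps)
  hence "norm (of_real R ^ 2 - cnj a * z) = R * norm (z - a)"
    using assms by (simp add: norm_mult del: complex_cnj_diff)
  moreover have "z \<noteq> a" using assms by auto
  ultimately show ?thesis using R by (simp add: blaschke_def norm_divide norm_mult)
qed

lemma norm_blaschke_le_1:
  assumes "norm a < R" "norm z \<le> R"
  shows "norm (blaschke R a z) \<le> 1"
proof -
  have R: "R > 0" using assms by (metis norm_ge_zero order.strict_trans1)
  have hol: "blaschke R a holomorphic_on cball 0 R"
    unfolding blaschke_def using blaschke_denom(1)[OF assms(1)] by (intro holomorphic_intros) auto
  show ?thesis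
  proof (rule maximum_modulus_frontier[of "blaschke R a" "cball 0 R" 1])
    show "blaschke R a holomorphic_on interior (cball 0 R)"
      using hol by (rule holomorphic_on_subset) (auto simp: interior_subset)
    show "continuous_on (closure (cball 0 R)) (blaschke R a)"
      using hol by (simp add: holomorphic_on_imp_continuous_on)
    show "norm (blaschke R a w) \<le> 1" if "w \<in> frontier (cball 0 R)" for w
      using that R norm_blaschke_circle[OF assms(1)] by (auto simp: frontier_cball)
  qed (use assms in auto)
qed

lemma blaschke_eq_0_iff:
  assumes "norm a < R" "norm z \<le> R"
  shows "blaschke R a z = 0 \<longleftrightarrow> z = a"
  using blaschke_denom(1)[OF assms] assms norm_ge_zero[of a]
  by (auto simp: blaschke_def simp del: norm_ge_zero)

text \<open>The ratio equals 1 / (z - a) + cnj a / (R^2 - cnj a * z). For |z| <= R / 2 the second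
  denominator is at least R * R / 2 in modulus, while |a| < R.\<close>

lemma deriv_blaschke_ratio:
  assumes "norm a < R" "norm z \<le> R / 2" "z \<noteq> a"
  shows "norm (deriv (blaschke R a) z / blaschke R a z) \<le> 1 / norm (z - a) + 2 / R"
proof -
  have R: "R > 0" using assms by (metis norm_ge_zero order.strict_trans1)
  have z: "norm z \<le> R" using assms R by simp
  note d = blaschke_denom[OF assms(1) z]
  have "(blaschke R a has_field_derivative
      (of_real R * (of_real R ^ 2 - cnj a * z) - of_real R * (z - a) * (- cnj a)) / (of_real R ^ 2 - cnj a * z)\<^sup>2) (at z)"
    unfolding blaschke_def using d(1) by (auto intro!: derivative_eq_intros simp: power2_eq_square)
  hence "deriv (blaschke R a) z = 
      (of_real R * (of_real R ^ 2 - cnj a * z) + of_real R * (z - a) * cnj a) / (of_real R ^ 2 - cnj a * z)\<^sup>2"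
    by (simp add: DERIV_imp_deriv)
  moreover have "(r * D + r * u * c) / D\<^sup>2 / (r * u / D) = 1 / u + c / D"
    if "D \<noteq> 0" "u \<noteq> 0" "r \<noteq> 0" for r D u c :: complex
    using that by (simp add: divide_simps power2_eq_square) (simp add: algebra_simps)
  ultimately have eq: "deriv (blaschke R a) z / blaschke R a z = 1 / (z - a) + cnj a / (of_real R ^ 2 - cnj a * z)"
    using d(1) R assms(3) by (simp add: blaschke_def)
  have "norm (1 / (z - a) + cnj a / (of_real R ^ 2 - cnj a * z)) \<le>
     norm (1 / (z - a)) + norm (cnj a / (of_real R ^ 2 - cnj a * z))"
    by (rule norm_triangle_ineq)
  also have "norm (cnj a / (of_real R ^ 2 - cnj a * z)) = norm a / norm (of_real R ^ 2 - cnj a * z)"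
    by (simp add: norm_divide)
  also have "\<dots> \<le> R / (R * (R - norm z))"
    using assms R d by (intro frac_le) auto
  also have "\<dots> = 1 / (R - norm z)" using R by simp
  also have "\<dots> \<le> 1 / (R / 2)" using assms R by (intro divide_left_mono) auto
  finally show ?thesis unfolding eq by (simp add: norm_divide)
qed

text \<open>The quotient of the two values is (1 + d / (z - a)) * (1 + cnj a * d / D), with D the
  denominator at z + d and |D| >= R * R / 4; \<open>ln_one_plus_le_sqrt\<close> handles the first
  factor. An upper bound suffices, since it will be multiplied by the orders of an entire function,
  which are nonnegative.\<close>

lemma ln_blaschke_shift_le:
  assumes "norm a < R" "norm z = R / 2" "z \<noteq> a" "norm d \<le> R / 4" "z + d \<noteq> a"
  shows "ln (norm (blaschke R a (z + d))) - ln (norm (blaschke R a z)) \<le>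
     2 * sqrt (norm d) * (1 / sqrt (norm (z - a))) + 4 * norm d / R"
proof -
  have R: "R > 0" using assms by (metis norm_ge_zero order.strict_trans1)
  have z: "norm z \<le> R" using assms R by simp
  have zd: "norm (z + d) \<le> 3 / 4 * R" using norm_triangle_ineq[of z d] assms by simp
  have zd': "norm (z + d) \<le> R" using zd R by simp
  note D1 = blaschke_denom[OF assms(1) z] and D2 = blaschke_denom[OF assms(1) zd']
  let ?D = "of_real R ^ 2 - cnj a * (z + d)"
  have za: "z - a \<noteq> 0" using assms by simp
  have ne: "blaschke R a z \<noteq> 0" "blaschke R a (z + d) \<noteq> 0"
    using blaschke_eq_0_iff[OF assms(1) z] blaschke_eq_0_iff[OF assms(1) zd'] assms by auto
  have "blaschke R a (z + d) / blaschke R a z = (1 + d / (z - a)) * (1 + cnj a * d / ?D)"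
  proof -
    have "1 + d / (z - a) = (z + d - a) / (z - a)" using za by (simp add: field_simps)
    moreover have "1 + cnj a * d / ?D = (of_real R ^ 2 - cnj a * z) / ?D"
      using D2(1) by (simp add: field_simps)
    ultimately show ?thesis using D1(1) D2(1) za R by (simp add: blaschke_def)
  qed
  hence "norm (blaschke R a (z + d)) / norm (blaschke R a z) = norm (1 + d / (z - a)) * norm (1 + cnj a * d / ?D)"
    by (metis norm_divide norm_mult)
  also have "\<dots> \<le> (1 + norm d / norm (z - a)) * (1 + 4 * norm d / R)"
  proof (intro mult_mono)
    show "norm (1 + d / (z - a)) \<le> 1 + norm d / norm (z - a)"
      using norm_triangle_ineq[of 1 "d / (z - a)"] by (simp add: norm_divide)
    have "norm (1 + cnj a * d / ?D) \<le> 1 + norm (cnj a * d / ?D)"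
      using norm_triangle_ineq[of 1 "cnj a * d / ?D"] by simp
    also have "norm (cnj a * d / ?D) = norm a * norm d / norm ?D" by (simp add: norm_divide norm_mult)
    also have "\<dots> \<le> R * norm d / (R * (R - norm (z + d)))"
      using assms R D2 zd by (intro frac_le mult_right_mono mult_pos_pos) auto
    also have "\<dots> = norm d / (R - norm (z + d))" using R by simp
    also have "\<dots> \<le> norm d / (R / 4)" using zd R by (intro divide_left_mono) auto
    finally show "norm (1 + cnj a * d / ?D) \<le> 1 + 4 * norm d / R" by (simp add: mult.commute)
  qed auto
  finally have "ln (norm (blaschke R a (z + d)) / norm (blaschke R a z)) \<le>
      ln ((1 + norm d / norm (z - a)) * (1 + 4 * norm d / R))"
    using ne R by (subst ln_le_cancel_iff) (auto intro!: mult_pos_pos add_pos_nonneg)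
  also have "\<dots> = ln (1 + norm d / norm (z - a)) + ln (1 + 4 * norm d / R)"
    using R by (intro ln_mult_pos add_pos_nonneg) auto
  also have "\<dots> \<le> 2 * sqrt (norm d / norm (z - a)) + 4 * norm d / R"
    using R by (intro add_mono ln_one_plus_le_sqrt ln_add_one_self_le_self) auto
  finally show ?thesis using ne by (simp add: ln_div real_sqrt_divide)
qed

section \<open>Factorisation of a meromorphic function on a disc\<close>

definition nonzero_meromorphic :: "(complex \<Rightarrow> complex) \<Rightarrow> bool" where
  "nonzero_meromorphic F \<longleftrightarrow> F meromorphic_on UNIV \<and> \<not> (\<forall>\<^sub>\<approx>z. F z = 0)"

definition regular_at :: "(complex \<Rightarrow> complex) \<Rightarrow> complex \<Rightarrow> bool" where
  "regular_at F z \<longleftrightarrow> F analytic_on {z} \<and> F z \<noteq> 0"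

text \<open>Besides zeros and poles this may contain points where \<open>F\<close> merely has a
  wrong value. If the order there is 0, they drop out of all sums weighted by
  \<open>zorder F\<close>, so they may stay in the set.\<close>

definition irregular_points :: "(complex \<Rightarrow> complex) \<Rightarrow> real \<Rightarrow> complex set" where
  "irregular_points F R = {z \<in> ball 0 R. \<not> regular_at F z}"

definition regular_circle :: "(complex \<Rightarrow> complex) \<Rightarrow> real \<Rightarrow> bool" where
  "regular_circle F R \<longleftrightarrow> R > 0 \<and> (\<forall>z. norm z = R \<longrightarrow> regular_at F z)"

lemma nonzero_meromorphic_regular_cosparse:
  assumes "nonzero_meromorphic F"
  shows "\<forall>\<^sub>\<approx>z. regular_at F z"
proof -
  have m: "F meromorphic_on UNIV" using assms by (simp add: nonzero_meromorphic_def)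
  have "\<forall>\<^sub>\<approx>z. F z \<noteq> 0"
    using meromorphic_imp_constant_or_avoid[OF m, of 0] assms by (auto simp: nonzero_meromorphic_def)
  with meromorphic_on_imp_analytic_cosparse[OF m] show ?thesis
    by eventually_elim (simp add: regular_at_def)
qed

lemma finite_cosparse_exceptions:
  fixes P :: "complex \<Rightarrow> bool"
  assumes "\<forall>\<^sub>\<approx>z. P z" "bounded B"
  shows "finite {z \<in> B. \<not> P z}"
proof -
  obtain r where r: "B \<subseteq> cball 0 r" using bounded_subset_ballD[OF assms(2), of 0] ball_subset_cball by (meson subset_trans)
  have "finite ({z. \<not> P z} \<inter> cball 0 r)"
    using assms(1) unfolding eventually_cosparse
    by (metis compact_cball inf_commute sparse_in_compact_finite sparse_in_subset subset_UNIV)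
  thus ?thesis by (rule finite_subset[rotated]) (use r in auto)
qed

lemma countable_cosparse_exceptions:
  fixes P :: "complex \<Rightarrow> bool"
  assumes "\<forall>\<^sub>\<approx>z. P z"
  shows "countable {z. \<not> P z}"
  using sparse_imp_countable[of UNIV "{z. \<not> P z}"] assms by (simp add: eventually_cosparse)

lemma finite_irregular_points: "nonzero_meromorphic F \<Longrightarrow> finite (irregular_points F R)"
  unfolding irregular_points_def
  by (rule finite_cosparse_exceptions[OF nonzero_meromorphic_regular_cosparse]) auto

lemma nonzero_meromorphic_at:
  assumes "nonzero_meromorphic F"
  shows "F meromorphic_on {z}" "isolated_singularity_at F z" "not_essential F z"
    "\<forall>\<^sub>F w in at z. F w \<noteq> 0" "\<exists>\<^sub>F w in at z. F w \<noteq> 0"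
proof -
  show m: "F meromorphic_on {z}"
    using assms by (auto simp: nonzero_meromorphic_def intro: meromorphic_on_subset)
  show "isolated_singularity_at F z" "not_essential F z"
    using m by (auto simp: meromorphic_at_iff)
  have "\<forall>\<^sub>\<approx>z. F z \<noteq> 0"
    using nonzero_meromorphic_regular_cosparse[OF assms]
    by eventually_elim (simp add: regular_at_def)
  thus ev: "\<forall>\<^sub>F w in at z. F w \<noteq> 0"
    by (rule eventually_cosparse_imp_eventually_at) auto
  thus "\<exists>\<^sub>F w in at z. F w \<noteq> 0" by (rule eventually_frequently[rotated]) simp
qed

lemma regular_at_imp_zorder_eq_0: "regular_at F z \<Longrightarrow> zorder F z = 0"
  by (simp add: regular_at_def zorder_eq_0I)

lemma is_pole_iff_zorder_neg:
  assumes "nonzero_meromorphic F"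
  shows "is_pole F z \<longleftrightarrow> zorder F z < 0"
  using nonzero_meromorphic_at[OF assms, of z] isolated_pole_imp_neg_zorder neg_zorder_imp_is_pole
  by blast

text \<open>Only finitely many irregular points lie in the closed disc of radius R + 1 and none on
  the circle, so a slightly larger disc acquires no new ones. Cauchy's formula on the circle needs
  this margin.\<close>

lemma regular_ball_extend:
  assumes F: "nonzero_meromorphic F" and R: "regular_circle F R"
  shows "\<forall>\<^sub>F x in at_right R. \<forall>z\<in>ball 0 x - irregular_points F R. regular_at F z"
proof -
  define B where "B = {z \<in> cball 0 (R + 1). \<not> regular_at F z}"
  have fin: "finite B" unfolding B_def
    by (rule finite_cosparse_exceptions[OF nonzero_meromorphic_regular_cosparse[OF F]]) auto
  have "\<forall>\<^sub>F x in at_right R. x < R + 1"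
    using eventually_at_right_less by (intro eventually_at_rightI[of R "R + 1"]) auto
  moreover have "\<forall>\<^sub>F x in at_right R. \<forall>b\<in>B. R < norm b \<longrightarrow> x < norm b"
  proof (intro eventually_ball_finite fin ballI)
    fix b
    show "\<forall>\<^sub>F x in at_right R. R < norm b \<longrightarrow> x < norm b"
    proof (cases "R < norm b")
      case True
      thus ?thesis by (intro eventually_at_rightI[of R "norm b"]) auto
    qed auto
  qed
  ultimately show ?thesis
  proof eventually_elim
    case (elim x)
    show ?case
    proof (intro ballI)
      fix z assume z: "z \<in> ball 0 x - irregular_points F R"
      show "regular_at F z"
      proof (rule ccontr)
        assume nr: "\<not> regular_at F z"
        hence "norm z \<noteq> R" "\<not> norm z < R"
          using R z by (auto simp: regular_circle_def irregular_points_def)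
        moreover have "z \<in> B" using nr z elim by (auto simp: B_def)
        ultimately show False using elim z by force
      qed
    qed
  qed
qed

lemma zorder_blaschke_self:
  assumes "norm a < R"
  shows "zorder (blaschke R a) a = 1"
proof (rule zorder_eqI[of "ball 0 R" a "\<lambda>z. of_real R / (of_real R ^ 2 - cnj a * z)"])
  show "(\<lambda>z. of_real R / ((of_real R)\<^sup>2 - cnj a * z)) holomorphic_on ball 0 R"
    using blaschke_denom(1)[OF assms] by (intro holomorphic_intros) auto
  show "of_real R / ((of_real R)\<^sup>2 - cnj a * a) \<noteq> 0"
    using blaschke_denom(1)[OF assms, of a] assms norm_ge_zero[of a] by (auto simp del: norm_ge_zero)
qed (use assms in \<open>auto simp: blaschke_def\<close>)

text \<open>Dividing \<open>F\<close> by the product leaves order 0 everywhere in the disc. Once its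
  removable singularities are filled in, the quotient is holomorphic and zero-free there, hence an
  exponential. As the product has modulus 1 on the circle, Re g = ln |F| there.\<close>

theorem blaschke_factorization:
  assumes F: "nonzero_meromorphic F" and R: "regular_circle F R"
  obtains R' g where "R' > R" "g holomorphic_on ball 0 R'"
    "\<And>z. z \<in> ball 0 R' - irregular_points F R \<Longrightarrow> regular_at F z"
    "\<And>z. z \<in> ball 0 R' - irregular_points F R \<Longrightarrow>
       F z = (\<Prod>a\<in>irregular_points F R. blaschke R a z powi zorder F a) * exp (g z)"
proof -
  define Z where "Z = irregular_points F R"
  have fin: "finite Z" unfolding Z_def by (rule finite_irregular_points[OF F])
  have R0: "R > 0" using R by (simp add: regular_circle_def)
  have Z: "norm a < R" if "a \<in> Z" for a using that by (auto simp: Z_def irregular_points_def)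
  \<comment> \<open>For a nonzero, the Blaschke factor of \<open>a\<close> has its pole at modulus
    R^2 / |a| > R; the larger disc has to stay below it.\<close>
  have "\<forall>\<^sub>F x in at_right R. \<forall>a\<in>Z. norm a * x < R\<^sup>2"
  proof (intro eventually_ball_finite fin ballI)
    fix a assume "a \<in> Z"
    have "norm a * R < R * R" using Z[OF \<open>a \<in> Z\<close>] R0 by (intro mult_strict_right_mono) auto
    hence "norm a * R < R\<^sup>2" by (simp add: power2_eq_square)
    moreover have "((\<lambda>x. norm a * x) \<longlongrightarrow> norm a * R) (at_right R)" by (intro tendsto_intros)
    ultimately show "\<forall>\<^sub>F x in at_right R. norm a * x < R\<^sup>2" by (simp add: order_tendstoD(2))
  qed
  with regular_ball_extend[OF F R] eventually_at_right_less[of R]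
  have "\<forall>\<^sub>F x in at_right R. R < x \<and> (\<forall>a\<in>Z. norm a * x < R\<^sup>2) \<and>
      (\<forall>z\<in>ball 0 x - Z. regular_at F z)"
    unfolding Z_def by eventually_elim auto
  then obtain R' where R': "R < R'" "\<forall>a\<in>Z. norm a * R' < R\<^sup>2" "\<forall>z\<in>ball 0 R' - Z. regular_at F z"
    using eventually_happens' trivial_limit_at_right_real by (metis (no_types, lifting) eventually_happens)
  define S where "S = ball (0::complex) R'"
  have denom: "of_real R ^ 2 - cnj a * z \<noteq> 0" if "a \<in> Z" "z \<in> S" for a z
  proof
    assume "of_real R ^ 2 - cnj a * z = 0"
    hence "norm (of_real R ^ 2 :: complex) = norm (cnj a * z)" by simp
    hence "R\<^sup>2 = norm a * norm z" using R0 by (simp add: norm_mult norm_power)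
    also have "\<dots> \<le> norm a * R'" using that by (intro mult_left_mono) (auto simp: S_def)
    also have "\<dots> < R\<^sup>2" using R' that by auto
    finally show False by simp
  qed
  have an: "blaschke R a analytic_on {z}" if "a \<in> Z" "z \<in> S" for a z
    unfolding blaschke_def using denom[OF that] by (intro analytic_intros) auto
  have b0: "blaschke R a z = 0 \<longleftrightarrow> z = a" if "a \<in> Z" "z \<in> S" for a z
    using denom[OF that] R0 by (auto simp: blaschke_def)
  define h where "h = (\<lambda>z. F z / (\<Prod>a\<in>Z. blaschke R a z powi zorder F a))"
  define H where "H = remove_sings h"
  have out: "h analytic_on {z} \<and> h z \<noteq> 0" if "z \<in> S - Z" for z
  proof
    have "regular_at F z" using that R' by (auto simp: S_def)
    hence Fz: "F analytic_on {z}" "F z \<noteq> 0" by (auto simp: regular_at_def)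
    have bz: "blaschke R a z \<noteq> 0" if "a \<in> Z" for a using b0[of a z] that \<open>z \<in> S - Z\<close> by auto
    show "h z \<noteq> 0" using Fz bz fin by (auto simp: h_def power_int_eq_0_iff)
    show "h analytic_on {z}" unfolding h_def
      using Fz bz that an fin by (intro analytic_intros) (auto simp: power_int_eq_0_iff)
  qed
  have inn: "H analytic_on {z} \<and> H z \<noteq> 0" if "z \<in> Z" for z
  proof -
    have zS: "z \<in> S" using Z[OF that] R' by (auto simp: S_def)
    have bm: "blaschke R a meromorphic_on {z}" if "a \<in> Z" for a
      using an[OF that zS] by (rule analytic_on_imp_meromorphic_on)
    have bf: "\<forall>\<^sub>F w in at z. blaschke R a w \<noteq> 0" if "a \<in> Z" for a
    proof -
      have "\<forall>\<^sub>F w in at z. w \<in> S - {a} - {z}" if "z \<noteq> a"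
        using zS that by (intro eventually_at_in_open) (auto simp: S_def)
      hence "\<forall>\<^sub>F w in at z. w \<in> S - {a}" if "z \<noteq> a"
        using that by (auto elim: eventually_mono)
      moreover have "\<forall>\<^sub>F w in at z. w \<in> S - {z}"
        using zS by (intro eventually_at_in_open) (auto simp: S_def)
      ultimately have "\<forall>\<^sub>F w in at z. w \<in> S - {a}" by (cases "z = a") auto
      thus ?thesis by eventually_elim (use b0 that in auto)
    qed
    \<comment> \<open>Only the factor belonging to \<open>z\<close> itself has nonzero order at
      \<open>z\<close>, so the product and \<open>F\<close> have equal order there.\<close>
    have zo: "zorder (\<lambda>w. blaschke R a w powi zorder F a) z = (if a = z then zorder F z else 0)"
      if "a \<in> Z" for a
    proof -
      have "zorder (\<lambda>w. blaschke R a w powi zorder F a) z = zorder F a * zorder (blaschke R a) z"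
        using bm bf that by (intro zorder_power_int) (auto intro: eventually_frequently)
      moreover have "zorder (blaschke R a) z = 0" if "a \<noteq> z"
        using an[OF \<open>a \<in> Z\<close> zS] b0[OF \<open>a \<in> Z\<close> zS] that by (intro zorder_eq_0I) auto
      moreover have "zorder (blaschke R z) z = 1" using Z[OF \<open>z \<in> Z\<close>] by (rule zorder_blaschke_self)
      ultimately show ?thesis by auto
    qed
    have evp: "\<forall>\<^sub>F w in at z. (\<Prod>a\<in>Z. blaschke R a w powi zorder F a) \<noteq> 0"
    proof -
      have "\<forall>\<^sub>F w in at z. \<forall>a\<in>Z. blaschke R a w \<noteq> 0"
        by (intro eventually_ball_finite fin ballI bf)
      thus ?thesis by eventually_elim (use fin in \<open>auto simp: power_int_eq_0_iff\<close>)
    qed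
    have "zorder (\<lambda>w. \<Prod>a\<in>Z. blaschke R a w powi zorder F a) z = (\<Sum>a\<in>Z. if a = z then zorder F z else 0)"
      by (subst zorder_prod[OF _ evp]) (auto intro!: meromorphic_intros bm sum.cong zo)
    also have "\<dots> = zorder F z" using fin that by simp
    finally have zp: "zorder (\<lambda>w. \<Prod>a\<in>Z. blaschke R a w powi zorder F a) z = zorder F z" .
    have pm: "(\<lambda>w. \<Prod>a\<in>Z. blaschke R a w powi zorder F a) meromorphic_on {z}"
      by (intro meromorphic_intros bm)
    note Fz = nonzero_meromorphic_at[OF F, of z]
    have "zorder h z = zorder F z - zorder F z"
      unfolding h_def by (subst zorder_divide) (use Fz pm evp zp in \<open>auto intro: eventually_frequently\<close>)
    hence zh: "zorder h z = 0" by simp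
    have hm: "h meromorphic_on {z}" unfolding h_def by (intro meromorphic_intros pm Fz)
    have "\<forall>\<^sub>F w in at z. h w \<noteq> 0"
      using evp Fz(4) by eventually_elim (simp add: h_def)
    hence hf: "\<exists>\<^sub>F w in at z. h w \<noteq> 0" by (intro eventually_frequently) auto
    define P where "P = zor_poly h z"
    obtain r where r: "P z \<noteq> 0" "r > 0" "P holomorphic_on cball z r"
       "\<And>w. w \<in> cball z r - {z} \<Longrightarrow> h w = P w"
      using zorder_exist[of h z] hm hf zh by (auto simp: meromorphic_at_iff P_def)
    have "P \<midarrow>z\<rightarrow> P z"
    proof -
      have "continuous_on (ball z r) P"
        using r(3) by (intro holomorphic_on_imp_continuous_on) (rule holomorphic_on_subset, auto)
      hence "isCont P z" using r(2) by (simp add: continuous_on_eq_continuous_at)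
      thus ?thesis by (simp add: isCont_def)
    qed
    moreover have "\<forall>\<^sub>F w in at z. P w = h w"
      unfolding eventually_at using r by (intro exI[of _ r]) (auto simp: dist_commute)
    ultimately have lim: "h \<midarrow>z\<rightarrow> P z" by (rule Lim_transform_eventually)
    hence "H z = P z" unfolding H_def by (rule remove_sings_eqI)
    moreover have "H analytic_on {z}"
      unfolding H_def using hm lim by (intro remove_sings_analytic_at) (auto simp: meromorphic_at_iff)
    ultimately show ?thesis using r by simp
  qed
  have Hh: "H z = h z" if "z \<in> S - Z" for z
    using out[OF that] by (simp add: H_def)
  have "H analytic_on {z} \<and> H z \<noteq> 0" if "z \<in> S" for z
  proof (cases "z \<in> Z")
    case False
    have "H analytic_on {z}"
      using out[of z] that False unfolding H_def
      by (intro remove_sings_analytic_on) auto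
    thus ?thesis using Hh[of z] out[of z] that False by simp
  qed (use inn in auto)
  hence H: "H holomorphic_on S" "\<And>z. z \<in> S \<Longrightarrow> H z \<noteq> 0"
    using analytic_imp_holomorphic analytic_on_analytic_at[of H S] by auto
  obtain g where g: "g holomorphic_on S" "\<And>z. z \<in> S \<Longrightarrow> H z = exp (g z)"
    using contractible_imp_holomorphic_log[OF H(1) _ H(2)] convex_imp_contractible[of S]
    by (auto simp: S_def)
  show ?thesis
  proof (rule that[OF R'(1)])
    show "g holomorphic_on ball 0 R'" using g by (simp add: S_def)
    fix z assume z: "z \<in> ball 0 R' - irregular_points F R"
    show "regular_at F z" using z R' by (auto simp: Z_def)
    have z': "z \<in> S - Z" using z by (simp add: S_def Z_def)
    hence "(\<Prod>a\<in>Z. blaschke R a z powi zorder F a) \<noteq> 0" using fin b0 by (auto simp: power_int_eq_0_iff)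
    moreover have "h z = exp (g z)" using Hh[OF z'] g(2)[of z] z' by simp
    ultimately show "F z = (\<Prod>a\<in>irregular_points F R. blaschke R a z powi zorder F a) * exp (g z)"
      by (simp add: h_def Z_def divide_eq_eq)
  qed
qed

section \<open>Jensen's formula\<close>

lemma ln_power_int:
  fixes x :: real
  assumes "x > 0"
  shows "ln (x powi k) = of_int k * ln x"
proof (cases "k \<ge> 0")
  case True
  then obtain n where "k = int n" using nonneg_int_cases by blast
  thus ?thesis using assms by (simp add: ln_realpow)
next
  case False
  then obtain n where "k = - int n" by (metis le_cases minus_minus neg_0_le_iff_le nonneg_int_cases)
  thus ?thesis using assms by (simp add: power_int_minus ln_inverse ln_realpow)
qed

text \<open>
  The contribution of a point to \<open>N(R, \<cdot>)\<close>; the value at the origin is the term \<open>n(0) ln R\<close> of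
  the integrated counting function.
\<close>

definition log_weight :: "real \<Rightarrow> complex \<Rightarrow> real" where
  "log_weight R a = (if a = 0 then ln R else ln (R / norm a))"

lemma log_weight_nonneg: "R \<ge> 1 \<Longrightarrow> norm a \<le> R \<Longrightarrow> log_weight R a \<ge> 0"
  by (auto simp: log_weight_def divide_simps intro!: ln_ge_zero)

lemma regular_circle_continuous:
  assumes "regular_circle F R"
  shows "continuous_on (sphere 0 R) F"
  using assms by (intro continuous_at_imp_continuous_on ballI analytic_at_imp_isCont)
    (auto simp: regular_circle_def regular_at_def)

lemma regular_circle_continuous_ln:
  assumes "regular_circle F R"
  shows "continuous_on (sphere 0 R) (\<lambda>z. ln (norm (F z)))"
  using assms regular_circle_continuous[OF assms]
  by (intro continuous_intros) (auto simp: regular_circle_def regular_at_def)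

lemma norm_prod_blaschke_circle:
  assumes "norm z = R" "\<And>a. a \<in> Z \<Longrightarrow> norm a < R"
  shows "norm (\<Prod>a\<in>Z. blaschke R a z powi k a) = 1"
  using assms norm_blaschke_circle[of _ R z] by (simp add: norm_power_int flip: prod_norm)

text \<open>\<open>zor_poly F 0 0\<close> is the leading Laurent coefficient of \<open>F\<close> at \<open>0\<close>.\<close>

theorem jensen:
  assumes F: "nonzero_meromorphic F" and R: "regular_circle F R"
  shows "circle_mean R (\<lambda>z. ln (norm (F z))) =
     ln (norm (zor_poly F 0 0)) + (\<Sum>a\<in>irregular_points F R. zorder F a * log_weight R a)"
proof -
  define Z where "Z = irregular_points F R"
  have fin: "finite Z" unfolding Z_def by (rule finite_irregular_points[OF F])
  have R0: "R > 0" using R by (simp add: regular_circle_def)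
  have Z: "norm a < R" if "a \<in> Z" for a using that by (auto simp: Z_def irregular_points_def)
  obtain R' g where g: "R' > R" "g holomorphic_on ball 0 R'"
    "\<And>z. z \<in> ball 0 R' - Z \<Longrightarrow> regular_at F z"
    "\<And>z. z \<in> ball 0 R' - Z \<Longrightarrow> F z = (\<Prod>a\<in>Z. blaschke R a z powi zorder F a) * exp (g z)"
    by (rule blaschke_factorization[OF F R, folded Z_def]) (rule that)
  have "ln (norm (F z)) = Re (g z)" if "norm z = R" for z
  proof -
    have "z \<in> ball 0 R' - Z" using that g(1) Z by fastforce
    from g(4)[OF this] show ?thesis
      using norm_prod_blaschke_circle[OF that, of Z "zorder F"] Z
      by (simp add: norm_mult)
  qed
  hence "circle_mean R (\<lambda>z. ln (norm (F z))) = circle_mean R (\<lambda>z. Re (g z))"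
    using R0 by (intro circle_mean_cong) auto
  also have "\<dots> = Re (g 0)" by (rule circle_mean_Re_holomorphic[OF g(2) R0 g(1)])
  finally have mean: "circle_mean R (\<lambda>z. ln (norm (F z))) = Re (g 0)" .
  define k0 where "k0 = zorder F 0"
  have k0: "k0 = 0" if "0 \<notin> Z"
    using that g(3)[of 0] g(1) R0 by (simp add: k0_def regular_at_imp_zorder_eq_0)
  \<comment> \<open>The factorisation with z ^ k0 cancelled: the Blaschke factor of the origin is z
    / R. \<open>Q\<close> is continuous at 0, and its value there is the leading Laurent coefficient
    of \<open>F\<close>.\<close>
  define Q where "Q = (\<lambda>z. (1 / of_real R) powi k0 * (\<Prod>a\<in>Z - {0}. blaschke R a z powi zorder F a) * exp (g z))"
  have FQ: "F z * z powi - k0 = Q z" if "z \<in> ball 0 R' - Z" "z \<noteq> 0" for z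
  proof (cases "0 \<in> Z")
    case True
    have "F z = blaschke R 0 z powi k0 * (\<Prod>a\<in>Z - {0}. blaschke R a z powi zorder F a) * exp (g z)"
      using g(4)[OF that(1)] fin True by (simp add: prod.remove k0_def)
    moreover have "blaschke R 0 z = z * (1 / of_real R)"
      using R0 by (simp add: blaschke_def power2_eq_square)
    ultimately show ?thesis using that(2)
      by (simp add: Q_def power_int_divide_distrib power_int_minus)
  next
    case False
    thus ?thesis using g(4)[OF that(1)] k0 by (simp add: Q_def)
  qed
  have Qc: "isCont Q 0"
  proof -
    have "isCont g 0" using holomorphic_on_imp_continuous_on[OF g(2)] g(1) R0
      by (simp add: continuous_on_eq_continuous_at)
    moreover have "isCont (blaschke R a) 0" for a
      unfolding blaschke_def using R0 by (intro continuous_intros) auto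
    moreover have "blaschke R a 0 \<noteq> 0" if "a \<in> Z - {0}" for a
      using that R0 by (auto simp: blaschke_def)
    ultimately show ?thesis unfolding Q_def by (intro continuous_intros) auto
  qed
  have "\<forall>\<^sub>F z in at 0. z \<in> ball 0 R' - (Z - {0}) - {0}"
    using fin g(1) R0 by (intro eventually_at_in_open) (auto intro: open_Diff finite_imp_closed)
  hence "\<forall>\<^sub>F z in at 0. Q z = F (0 + z) * (0 + z - 0) powi - k0"
    by eventually_elim (use FQ in auto)
  moreover have "Q \<midarrow>0\<rightarrow> Q 0" using Qc by (simp add: isCont_def)
  ultimately have "((\<lambda>z. F z * (z - 0) powi - k0) \<longlongrightarrow> Q 0) (at 0)"
    using Lim_transform_eventually by fastforce
  hence lc: "zor_poly F 0 0 = Q 0"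
    unfolding k0_def using nonzero_meromorphic_at[OF F, of 0]
    by (intro zor_poly_eqI[where F = "at 0" and g = "\<lambda>z. z"]) (auto simp: filterlim_ident)
  \<comment> \<open>This value is the origin of the weights ln (R / |a|).\<close>
  have bne: "norm (blaschke R a 0) = norm a / R" for a
    using R0 by (simp add: blaschke_def norm_divide norm_mult power2_eq_square)
  have "ln (norm (Q 0)) = ln (norm ((1 / of_real R :: complex) powi k0)) +
      ln (norm (\<Prod>a\<in>Z - {0}. blaschke R a 0 powi zorder F a)) + Re (g 0)"
  proof -
    have "(\<Prod>a\<in>Z - {0}. norm (blaschke R a 0) powi zorder F a) \<noteq> 0"
      using fin R0 by (auto simp: bne power_int_eq_0_iff)
    thus ?thesis
      unfolding Q_def using R0
      by (simp add: norm_mult norm_power_int ln_mult norm_divide power_int_eq_0_iff flip: prod_norm)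
  qed
  also have "ln (norm (\<Prod>a\<in>Z - {0}. blaschke R a 0 powi zorder F a)) =
      (\<Sum>a\<in>Z - {0}. ln (norm (blaschke R a 0) powi zorder F a))"
    unfolding prod_norm[symmetric] norm_power_int
    using fin R0 by (intro ln_prod) (auto simp: bne power_int_eq_0_iff)
  also have "\<dots> = (\<Sum>a\<in>Z - {0}. - (zorder F a * log_weight R a))"
    using R0 by (intro sum.cong) (auto simp: bne log_weight_def ln_div ln_power_int algebra_simps)
  also have "ln (norm ((1 / of_real R :: complex) powi k0)) = - k0 * ln R"
    using R0 by (simp add: norm_power_int norm_divide ln_power_int ln_div)
  finally have "Re (g 0) = ln (norm (Q 0)) + (k0 * ln R + (\<Sum>a\<in>Z - {0}. zorder F a * log_weight R a))"
    by (simp add: sum_negf)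
  also have "k0 * ln R + (\<Sum>a\<in>Z - {0}. zorder F a * log_weight R a) = (\<Sum>a\<in>Z. zorder F a * log_weight R a)"
    using fin k0 by (cases "0 \<in> Z") (auto simp: sum.remove k0_def log_weight_def)
  finally show ?thesis using mean lc by (simp add: Z_def)
qed

text \<open>By linearity: a point a other than 0 contributes the integral of \<mu> a / t over
  [|a|, r], that is \<mu> a * ln (r / |a|), and the origin contributes through
  \<open>n 0 * ln r\<close>. At t = 0 the integrand has the harmless value 0.\<close>

lemma integrated_counting_eq:
  assumes A: "finite A" "A \<subseteq> cball 0 r" and r: "r > 0"
    and n: "\<And>t. 0 \<le> t \<Longrightarrow> t \<le> r \<Longrightarrow> n t = (\<Sum>a | a \<in> A \<and> norm a \<le> t. \<mu> a)"
  shows "integrated_counting n r = (\<Sum>a\<in>A. \<mu> a * log_weight r a)"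
proof -
  have n': "n t = (\<Sum>a\<in>A. if norm a \<le> t then \<mu> a else 0)" if "0 \<le> t" "t \<le> r" for t
    using n[OF that] A by (simp add: sum.inter_filter)
  have n0: "n 0 = (\<Sum>a\<in>A. if a = 0 then \<mu> a else 0)"
    using n'[of 0] r by simp
  have one: "((\<lambda>t. if t \<in> {norm a..r} then \<mu> a * (1 / t) else 0) has_integral \<mu> a * log_weight r a) {0..r}"
    if "a \<in> A" "a \<noteq> 0" for a
  proof (subst has_integral_restrict)
    have pos: "0 < t" if "norm a \<le> t" for t
      using that \<open>a \<noteq> 0\<close> by (metis less_le_trans zero_less_norm_iff)
    have "((\<lambda>t. 1 / t) has_integral (ln r - ln (norm a))) {norm a..r}"
      using that A by (intro fundamental_theorem_of_calculus)
        (auto intro!: derivative_eq_intros pos simp flip: has_real_derivative_iff_has_vector_derivative)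
    from has_integral_mult_right[OF this, of "\<mu> a"]
    show "((\<lambda>t. \<mu> a * (1 / t)) has_integral \<mu> a * log_weight r a) {norm a..r}"
      using that r by (simp add: log_weight_def ln_div)
  qed (use that in auto)
  have "((\<lambda>t. \<Sum>a\<in>A - {0}. if t \<in> {norm a..r} then \<mu> a * (1 / t) else 0) has_integral
      (\<Sum>a\<in>A - {0}. \<mu> a * log_weight r a)) {0..r}"
    using A one by (intro has_integral_sum) auto
  moreover have "(\<Sum>a\<in>A - {0}. if t \<in> {norm a..r} then \<mu> a * (1 / t) else 0) = (n t - n 0) / t"
    if "t \<in> {0..r}" for t
  proof -
    have "(n t - n 0) = (\<Sum>a\<in>A. if norm a \<le> t \<and> a \<noteq> 0 then \<mu> a else 0)"
      using that by (subst n', simp, simp, subst n0) (auto simp flip: sum_subtractf intro!: sum.cong)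
    also have "\<dots> = (\<Sum>a\<in>A - {0}. if norm a \<le> t then \<mu> a else 0)"
      using A by (intro sum.mono_neutral_cong_right) auto
    finally have e: "n t - n 0 = (\<Sum>a\<in>A - {0}. if norm a \<le> t then \<mu> a else 0)" .
    show ?thesis unfolding e sum_divide_distrib by (intro sum.cong) (use that in auto)
  qed
  ultimately have "((\<lambda>t. (n t - n 0) / t) has_integral (\<Sum>a\<in>A - {0}. \<mu> a * log_weight r a)) {0..r}"
    by (rule has_integral_eq[rotated]) auto
  hence "integral {0..r} (\<lambda>t. (n t - n 0) / t) = (\<Sum>a\<in>A - {0}. \<mu> a * log_weight r a)"
    by (rule integral_unique)
  thus ?thesis
    unfolding integrated_counting_def n0 using A
    by (cases "0 \<in> A") (auto simp: sum.remove log_weight_def)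
qed

lemma finite_poles:
  assumes "F meromorphic_on UNIV"
  shows "finite {z \<in> cball 0 r. is_pole F z}"
  using finite_cosparse_exceptions[OF meromorphic_on_imp_not_pole_cosparse[OF assms], of "cball 0 r"]
  by simp

text \<open>Summing over all irregular points gives the same index set as in Jensen's formula;
  \<open>max 0\<close> removes the points that are not poles.\<close>

lemma nevanlinna_N_eq:
  assumes F: "nonzero_meromorphic F" and R: "regular_circle F R"
  shows "nevanlinna_N R F = (\<Sum>a\<in>irregular_points F R. max 0 (- of_int (zorder F a)) * log_weight R a)"
proof -
  have R0: "R > 0" using R by (simp add: regular_circle_def)
  define A where "A = {z \<in> cball 0 R. is_pole F z}"
  have fin: "finite A" unfolding A_def by (rule finite_poles) (use F in \<open>simp add: nonzero_meromorphic_def\<close>)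
  have "pole_count F t = (\<Sum>a | a \<in> A \<and> norm a \<le> t. of_int (- zorder F a))" if "t \<le> R" for t
    unfolding pole_count_def using that by (intro sum.cong) (auto simp: A_def)
  hence "nevanlinna_N R F = (\<Sum>a\<in>A. of_int (- zorder F a) * log_weight R a)"
    unfolding nevanlinna_N_def using fin R0 by (intro integrated_counting_eq) (auto simp: A_def)
  also have "\<dots> = (\<Sum>a\<in>irregular_points F R. max 0 (- of_int (zorder F a)) * log_weight R a)"
  proof (rule sum.mono_neutral_cong_left)
    show "A \<subseteq> irregular_points F R"
    proof
      fix a assume a: "a \<in> A"
      hence "\<not> regular_at F a" by (auto simp: A_def regular_at_def dest: analytic_at_imp_no_pole)
      moreover from this have "norm a \<noteq> R" using R by (auto simp: regular_circle_def)
      ultimately show "a \<in> irregular_points F R" using a by (auto simp: A_def irregular_points_def)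
    qed
    show "finite (irregular_points F R)" by (rule finite_irregular_points[OF F])
  qed (use F in \<open>auto simp: A_def is_pole_iff_zorder_neg irregular_points_def max_def\<close>)
  finally show ?thesis .
qed

lemma irregular_points_norm: "a \<in> irregular_points F R \<Longrightarrow> norm a < R"
  by (simp add: irregular_points_def)

lemma nevanlinna_N_nonneg:
  assumes F: "nonzero_meromorphic F" and R: "regular_circle F R" "R \<ge> 1"
  shows "nevanlinna_N R F \<ge> 0"
  unfolding nevanlinna_N_eq[OF F R(1)] using R
  by (intro sum_nonneg mult_nonneg_nonneg log_weight_nonneg) (auto dest: irregular_points_norm)

lemma nevanlinna_m_nonneg: "regular_circle F R \<Longrightarrow> nevanlinna_m R F \<ge> 0"
  unfolding nevanlinna_m_eq
  by (intro circle_mean_nonneg continuous_intros regular_circle_continuous) (auto simp: regular_circle_def)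

lemma sum_zorder_ge:
  assumes F: "nonzero_meromorphic F" and R: "regular_circle F R" "R \<ge> 1"
  shows "(\<Sum>a\<in>irregular_points F R. zorder F a * log_weight R a) \<ge> - nevanlinna_N R F"
proof -
  have "- nevanlinna_N R F = (\<Sum>a\<in>irregular_points F R. - max 0 (- of_int (zorder F a)) * log_weight R a)"
    by (simp add: nevanlinna_N_eq[OF F R(1)] sum_negf)
  also have "\<dots> \<le> (\<Sum>a\<in>irregular_points F R. zorder F a * log_weight R a)"
    using R by (intro sum_mono mult_right_mono log_weight_nonneg) (auto dest: irregular_points_norm)
  finally show ?thesis .
qed

lemma circle_mean_ln_le:
  assumes R: "regular_circle F R"
  shows "circle_mean R (\<lambda>z. ln (norm (F z))) \<le> nevanlinna_m R F"
  unfolding nevanlinna_m_eq using R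
  by (intro circle_mean_mono regular_circle_continuous_ln continuous_intros regular_circle_continuous ln_le_log_plus)
     (auto simp: regular_circle_def)

text \<open>One half of the first fundamental theorem:
  \<open>log_plus_minus_log_plus_inverse\<close> reduces it to Jensen's formula, in which the
  nonnegative contribution of the zeros is dropped.\<close>

lemma nevanlinna_m_inverse_le:
  assumes F: "nonzero_meromorphic F" and R: "regular_circle F R" "R \<ge> 1"
  shows "nevanlinna_m R (\<lambda>z. 1 / F z) \<le> nevanlinna_T R F - ln (norm (zor_poly F 0 0))"
proof -
  have R0: "R \<ge> 0" using R by simp
  note cont = regular_circle_continuous[OF R(1)] regular_circle_continuous_ln[OF R(1)]
  have "nevanlinna_m R (\<lambda>z. 1 / F z) = circle_mean R (\<lambda>z. log_plus (norm (F z)) - ln (norm (F z)))"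
    unfolding nevanlinna_m_eq
  proof (rule circle_mean_cong[OF _ R0])
    fix z :: complex assume "norm z = R"
    hence "F z \<noteq> 0" using R by (auto simp: regular_circle_def regular_at_def)
    thus "log_plus (norm (1 / F z)) = log_plus (norm (F z)) - ln (norm (F z))"
      using log_plus_minus_log_plus_inverse[of "norm (F z)"] by (simp add: norm_divide)
  qed
  also have "\<dots> = nevanlinna_m R F - circle_mean R (\<lambda>z. ln (norm (F z)))"
    unfolding nevanlinna_m_eq by (intro circle_mean_diff continuous_intros cont R0)
  finally show ?thesis
    using jensen[OF F R(1)] sum_zorder_ge[OF F R] by (simp add: nevanlinna_T_def)
qed

lemma circle_mean_abs_ln_le:
  assumes F: "nonzero_meromorphic F" and R: "regular_circle F R" "R \<ge> 1"
  shows "circle_mean R (\<lambda>z. \<bar>ln (norm (F z))\<bar>) \<le> 2 * nevanlinna_T R F + \<bar>ln (norm (zor_poly F 0 0))\<bar>"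
proof -
  have R0: "R \<ge> 0" using R by simp
  note cont = regular_circle_continuous[OF R(1)] regular_circle_continuous_ln[OF R(1)]
  have "circle_mean R (\<lambda>z. \<bar>ln (norm (F z))\<bar>) = circle_mean R (\<lambda>z. 2 * log_plus (norm (F z)) - ln (norm (F z)))"
    using R by (intro circle_mean_cong abs_ln_eq_log_plus) (auto simp: regular_circle_def regular_at_def)
  also have "\<dots> = 2 * nevanlinna_m R F - circle_mean R (\<lambda>z. ln (norm (F z)))"
    unfolding nevanlinna_m_eq by (subst circle_mean_diff) (intro continuous_intros cont R0 | simp add: circle_mean_cmult)+
  finally show ?thesis
    using jensen[OF F R(1)] sum_zorder_ge[OF F R] nevanlinna_N_nonneg[OF F R]
    by (simp add: nevanlinna_T_def)
qed

text \<open>With respect to the doubled radius every point of the smaller disc has weight at least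
  ln 2 >= 1 / 2; for the origin this uses R >= 1. Writing |k| = k + 2 max 0 (-k), the weighted sum
  is read off from Jensen's formula.\<close>

lemma sum_abs_zorder_le:
  assumes F: "nonzero_meromorphic F" and R: "regular_circle F (2 * R)" "R \<ge> 1"
  shows "(\<Sum>a\<in>irregular_points F R. \<bar>zorder F a\<bar>) \<le> 4 * nevanlinna_T (2 * R) F + 2 * \<bar>ln (norm (zor_poly F 0 0))\<bar>"
proof -
  let ?S = "irregular_points F (2 * R)" and ?w = "log_weight (2 * R)" and ?l = "ln (norm (zor_poly F 0 0))"
  have R1: "2 * R \<ge> 1" using R by simp
  have w: "?w a \<ge> 0" if "a \<in> ?S" for a using that R by (intro log_weight_nonneg) (auto dest: irregular_points_norm)
  have ln2: "ln 2 \<ge> (1/2 :: real)" using ln2_ge_two_thirds by simp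
  have "1 / 2 * (\<Sum>a\<in>irregular_points F R. real_of_int \<bar>zorder F a\<bar>) = (\<Sum>a\<in>irregular_points F R. \<bar>zorder F a\<bar> * (1 / 2))"
    by (simp add: sum_distrib_left mult.commute)
  also have "\<dots> \<le> (\<Sum>a\<in>irregular_points F R. \<bar>zorder F a\<bar> * ?w a)"
  proof (intro sum_mono mult_left_mono)
    fix a assume "a \<in> irregular_points F R"
    hence a: "norm a < R" by (rule irregular_points_norm)
    have "ln 2 \<le> ?w a"
    proof (cases "a = 0")
      case True thus ?thesis using R by (simp add: log_weight_def)
    next
      case False
      hence "2 \<le> 2 * R / norm a" using a by (simp add: field_simps)
      thus ?thesis using False by (simp add: log_weight_def)
    qed
    thus "1 / 2 \<le> ?w a" using ln2 by simp
  qed auto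
  also have "\<dots> \<le> (\<Sum>a\<in>?S. \<bar>zorder F a\<bar> * ?w a)"
    using R by (intro sum_mono2 finite_irregular_points F mult_nonneg_nonneg)
       (auto simp: irregular_points_def intro!: log_weight_nonneg)
  also have "\<dots> = (\<Sum>a\<in>?S. zorder F a * ?w a + 2 * (max 0 (- of_int (zorder F a)) * ?w a))"
    by (intro sum.cong) (auto simp: max_def abs_if)
  also have "\<dots> = (\<Sum>a\<in>?S. zorder F a * ?w a) + 2 * nevanlinna_N (2 * R) F"
    by (simp add: nevanlinna_N_eq[OF F R(1)] sum.distrib sum_distrib_left)
  also have "(\<Sum>a\<in>?S. zorder F a * ?w a) \<le> nevanlinna_m (2 * R) F + \<bar>?l\<bar>"
    using jensen[OF F R(1)] circle_mean_ln_le[OF R(1)] by simp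
  finally show ?thesis
    using nevanlinna_m_nonneg[OF R(1)] by (simp add: nevanlinna_T_def)
qed

section \<open>Logarithmic derivatives and difference quotients\<close>

lemma has_field_derivative_prod_power_int:
  fixes b :: "'i \<Rightarrow> complex \<Rightarrow> complex"
  assumes "finite A" "\<And>a. a \<in> A \<Longrightarrow> (b a has_field_derivative b' a) (at z)"
    "\<And>a. a \<in> A \<Longrightarrow> b a z \<noteq> 0"
  shows "((\<lambda>w. \<Prod>a\<in>A. b a w powi k a) has_field_derivative
     (\<Prod>a\<in>A. b a z powi k a) * (\<Sum>a\<in>A. of_int (k a) * (b' a / b a z))) (at z)"
  using assms
proof (induction A rule: finite_induct)
  case (insert x A)
  have nz: "b x z \<noteq> 0" using insert by auto
  have "((\<lambda>w. b x w powi k x) has_derivative (\<lambda>h. (h * b' x) * (of_int (k x) * b x z powi (k x - 1)))) (at z)"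
    using insert.prems(1)[of x] nz
    by (intro has_derivative_power_int) (auto simp: has_field_derivative_def mult_commute_abs)
  hence "((\<lambda>w. b x w powi k x) has_field_derivative b x z powi k x * (of_int (k x) * (b' x / b x z))) (at z)"
    unfolding has_field_derivative_def
    by (rule has_derivative_eq_rhs) (use nz in \<open>auto simp: fun_eq_iff power_int_diff\<close>)
  from DERIV_mult[OF this insert.IH] insert show ?case
    by (simp add: algebra_simps)
qed simp

text \<open>\<open>g\<close> is governed by ln |F| on the circle alone: its real part agrees with it
  there, and \<open>norm_deriv_le_circle_mean\<close> recovers the derivative inside.\<close>

lemma blaschke_factorization_bounds:
  assumes F: "nonzero_meromorphic F" and R: "regular_circle F R"
  obtains g where
    "\<And>z. norm z < R \<Longrightarrow> g field_differentiable at z"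
    "\<And>z. norm z < R \<Longrightarrow> z \<notin> irregular_points F R \<Longrightarrow>
       F z = (\<Prod>a\<in>irregular_points F R. blaschke R a z powi zorder F a) * exp (g z)"
    "Re (g 0) = circle_mean R (\<lambda>z. ln (norm (F z)))"
    "\<And>z. norm z \<le> 3 / 4 * R \<Longrightarrow> norm (deriv g z) \<le> 32 / R * circle_mean R (\<lambda>z. \<bar>ln (norm (F z))\<bar>)"
proof -
  define Z where "Z = irregular_points F R"
  have R0: "R > 0" using R by (simp add: regular_circle_def)
  have Z: "norm a < R" if "a \<in> Z" for a using that by (auto simp: Z_def irregular_points_def)
  obtain R' g where g: "R' > R" "g holomorphic_on ball 0 R'"
    "\<And>z. z \<in> ball 0 R' - Z \<Longrightarrow> regular_at F z"
    "\<And>z. z \<in> ball 0 R' - Z \<Longrightarrow> F z = (\<Prod>a\<in>Z. blaschke R a z powi zorder F a) * exp (g z)"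
    by (rule blaschke_factorization[OF F R, folded Z_def]) (rule that)
  have circ: "Re (g z) = ln (norm (F z))" if "norm z = R" for z
  proof -
    have "z \<in> ball 0 R' - Z" using that g(1) Z by fastforce
    from g(4)[OF this] show ?thesis
      using norm_prod_blaschke_circle[OF that, of Z "zorder F"] Z
      by (simp add: norm_mult)
  qed
  have m1: "circle_mean R (\<lambda>z. Re (g z)) = circle_mean R (\<lambda>z. ln (norm (F z)))"
    and m2: "circle_mean R (\<lambda>z. \<bar>Re (g z)\<bar>) = circle_mean R (\<lambda>z. \<bar>ln (norm (F z))\<bar>)"
    using R0 circ by (auto intro!: circle_mean_cong)
  show ?thesis
  proof (rule that)
    show "g field_differentiable at z" if "norm z < R" for z
      using g(1,2) that by (intro holomorphic_on_imp_differentiable_at[of g "ball 0 R'"]) auto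
    show "F z = (\<Prod>a\<in>irregular_points F R. blaschke R a z powi zorder F a) * exp (g z)"
      if "norm z < R" "z \<notin> irregular_points F R" for z
      using g(4)[of z] that g(1) by (simp add: Z_def)
    show "Re (g 0) = circle_mean R (\<lambda>z. ln (norm (F z)))"
      using circle_mean_Re_holomorphic[OF g(2) R0 g(1)] m1 by simp
    show "norm (deriv g z) \<le> 32 / R * circle_mean R (\<lambda>z. \<bar>ln (norm (F z))\<bar>)" if "norm z \<le> 3 / 4 * R" for z
      using norm_deriv_le_circle_mean[OF g(2) R0 g(1) that] m2 by simp
  qed
qed

text \<open>The radius 2 R is the price for counting zeros and poles in the disc of radius R. On
  regular circles with R >= 1 the summand 1 makes the quantity at least 1, so that it also dominates
  square roots.\<close>

definition nevanlinna_bound :: "(complex \<Rightarrow> complex) \<Rightarrow> real \<Rightarrow> real" where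
  "nevanlinna_bound F R = nevanlinna_T R F + nevanlinna_T (2 * R) F + \<bar>ln (norm (zor_poly F 0 0))\<bar> + 1"

lemma nevanlinna_T_nonneg:
  assumes "nonzero_meromorphic F" "regular_circle F R" "R \<ge> 1"
  shows "nevanlinna_T R F \<ge> 0"
  using nevanlinna_N_nonneg[OF assms] nevanlinna_m_nonneg[OF assms(2)] by (simp add: nevanlinna_T_def)

lemma mean_and_count_le:
  assumes F: "nonzero_meromorphic F" and R: "regular_circle F R" "regular_circle F (2 * R)" "R \<ge> 1"
  shows "circle_mean R (\<lambda>z. \<bar>ln (norm (F z))\<bar>) \<le> 2 * nevanlinna_bound F R - 1"
    "(\<Sum>a\<in>irregular_points F R. \<bar>zorder F a\<bar>) \<le> 4 * nevanlinna_bound F R"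
    "circle_mean R (\<lambda>z. \<bar>ln (norm (F z))\<bar>) \<ge> 0" "nevanlinna_bound F R \<ge> 1"
proof -
  note T = nevanlinna_T_nonneg[OF F R(1,3)] nevanlinna_T_nonneg[OF F R(2)]
  show "circle_mean R (\<lambda>z. \<bar>ln (norm (F z))\<bar>) \<le> 2 * nevanlinna_bound F R - 1"
    "(\<Sum>a\<in>irregular_points F R. \<bar>zorder F a\<bar>) \<le> 4 * nevanlinna_bound F R"
    "nevanlinna_bound F R \<ge> 1"
    using circle_mean_abs_ln_le[OF F R(1,3)] sum_abs_zorder_le[OF F R(2,3)] T R(3)
    by (auto simp: nevanlinna_bound_def)
  show "circle_mean R (\<lambda>z. \<bar>ln (norm (F z))\<bar>) \<ge> 0"
    using R by (intro circle_mean_nonneg continuous_intros regular_circle_continuous_ln) auto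
qed

lemma sqrt_sum_le:
  assumes "finite A" "\<And>i. i \<in> A \<Longrightarrow> x i \<ge> 0"
  shows "sqrt (\<Sum>i\<in>A. x i) \<le> (\<Sum>i\<in>A. sqrt (x i))"
  using assms
proof (induction A rule: finite_induct)
  case (insert a A)
  have "sqrt (\<Sum>i\<in>insert a A. x i) \<le> sqrt (x a) + sqrt (\<Sum>i\<in>A. x i)"
    using insert by (simp add: sqrt_add_le_add_sqrt sum_nonneg)
  with insert show ?case by force
qed simp

lemma sqrt_abs_int_le: "sqrt \<bar>real_of_int k\<bar> \<le> \<bar>real_of_int k\<bar>"
proof (cases "k = 0")
  case False
  hence "1 \<le> \<bar>real_of_int k\<bar>" by linarith
  hence "\<bar>real_of_int k\<bar> \<le> \<bar>real_of_int k\<bar>\<^sup>2"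
    using self_le_power[of "\<bar>real_of_int k\<bar>" 2] by simp
  hence "sqrt \<bar>real_of_int k\<bar> \<le> sqrt (\<bar>real_of_int k\<bar>\<^sup>2)" by (rule real_sqrt_le_mono)
  thus ?thesis by simp
qed simp

lemma irregular_circle_avoid:
  assumes "regular_circle F r" "a \<in> irregular_points F R"
  shows "norm a \<noteq> r"
  using assms by (auto simp: regular_circle_def irregular_points_def)

text \<open>
  The decay rate \<open>1 / sqrt R\<close> comes from \<open>log\<^sup>+ x \<le> 2 sqrt x\<close>: the square root of each pole
  \<open>1 / (z - a)\<close> is integrable on the circle uniformly in \<open>a\<close>.
\<close>

theorem logarithmic_derivative_estimate:
  assumes F: "nonzero_meromorphic F" and r: "regular_circle F r"
    and R: "regular_circle F R" "regular_circle F (2 * R)" "R \<ge> 1" "R = 2 * r"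
  shows "nevanlinna_m r (\<lambda>z. deriv F z / F z) \<le> 400 * nevanlinna_bound F R / sqrt R"
proof -
  define Z where "Z = irregular_points F R"
  define \<Lambda> where "\<Lambda> = circle_mean R (\<lambda>z. \<bar>ln (norm (F z))\<bar>)"
  define n where "n = real_of_int (\<Sum>a\<in>Z. \<bar>zorder F a\<bar>)"
  note b = mean_and_count_le[OF F R(1-3), folded \<Lambda>_def Z_def, folded n_def]
  have fin: "finite Z" unfolding Z_def by (rule finite_irregular_points[OF F])
  have R0: "R > 0" "r > 0" "r < R" using R by auto
  have Z: "norm a < R" if "a \<in> Z" for a using that by (auto simp: Z_def irregular_points_def)
  obtain g where g: "\<And>z. norm z < R \<Longrightarrow> g field_differentiable at z"
    "\<And>z. norm z < R \<Longrightarrow> z \<notin> Z \<Longrightarrow> F z = (\<Prod>a\<in>Z. blaschke R a z powi zorder F a) * exp (g z)"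
    "Re (g 0) = circle_mean R (\<lambda>z. ln (norm (F z)))"
    "\<And>z. norm z \<le> 3 / 4 * R \<Longrightarrow> norm (deriv g z) \<le> 32 / R * \<Lambda>"
    by (rule blaschke_factorization_bounds[OF F R(1), folded Z_def \<Lambda>_def]) (rule that)
  have ptw: "norm (deriv F z / F z) \<le> 32 / R * \<Lambda> + (\<Sum>a\<in>Z. \<bar>zorder F a\<bar> * (1 / norm (z - a) + 2 / R))"
    if z: "norm z = r" for z
  proof -
    have reg: "regular_at F z" using r z by (simp add: regular_circle_def)
    have zZ: "z \<notin> Z" using reg by (auto simp: Z_def irregular_points_def)
    have zR: "norm z < R" "norm z \<le> R" "norm z \<le> R / 2" using z R0 R by auto
    have bnz: "blaschke R a z \<noteq> 0" if "a \<in> Z" for a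
      using blaschke_eq_0_iff[OF Z[OF that] zR(2)] that zZ by auto
    have bd: "(blaschke R a has_field_derivative deriv (blaschke R a) z) (at z)" if "a \<in> Z" for a
    proof (rule holomorphic_derivI[of _ "ball 0 R"])
      show "blaschke R a holomorphic_on ball 0 R"
        unfolding blaschke_def using blaschke_denom(1)[OF Z[OF that]] by (intro holomorphic_intros) auto
    qed (use zR in auto)
    have gd: "(g has_field_derivative deriv g z) (at z)"
      by (rule field_differentiable_derivI[OF g(1)[OF zR(1)]])
    define E where "E = (\<lambda>w. (\<Prod>a\<in>Z. blaschke R a w powi zorder F a) * exp (g w))"
    define S where "S = (\<Sum>a\<in>Z. of_int (zorder F a) * (deriv (blaschke R a) z / blaschke R a z))"
    have "(E has_field_derivative E z * (S + deriv g z)) (at z)"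
      unfolding E_def S_def
      by (rule DERIV_cong[OF DERIV_mult[OF has_field_derivative_prod_power_int[OF fin bd bnz]
            DERIV_chain2[OF DERIV_exp gd]]])
         (auto simp: algebra_simps)
    \<comment> \<open>The factorisation fails at finitely many points only, so it holds near
      \<open>z\<close> and may be differentiated.\<close>
    moreover have "\<forall>\<^sub>F w in nhds z. F w = E w"
    proof -
      have "open (ball 0 R - Z)" using fin by (intro open_Diff finite_imp_closed) auto
      hence "\<forall>\<^sub>F w in nhds z. w \<in> ball 0 R - Z" using zR zZ by (intro eventually_nhds_in_open) auto
      thus ?thesis by eventually_elim (use g(2) in \<open>auto simp: E_def\<close>)
    qed
    ultimately have "(F has_field_derivative E z * (S + deriv g z)) (at z)"
      by (subst DERIV_cong_ev[OF refl _ refl]) auto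
    hence "deriv F z = E z * (S + deriv g z)" by (rule DERIV_imp_deriv)
    moreover have "F z = E z" using g(2)[OF zR(1) zZ] by (simp add: E_def)
    moreover have "F z \<noteq> 0" using reg by (simp add: regular_at_def)
    ultimately have "deriv F z / F z = S + deriv g z" by simp
    also have "norm \<dots> \<le> norm (deriv g z) + norm S" by (metis add.commute norm_triangle_ineq)
    also have "norm S \<le> (\<Sum>a\<in>Z. norm (of_int (zorder F a) * (deriv (blaschke R a) z / blaschke R a z)))"
      unfolding S_def by (rule norm_sum)
    also have "\<dots> \<le> (\<Sum>a\<in>Z. \<bar>zorder F a\<bar> * (1 / norm (z - a) + 2 / R))"
    proof (intro sum_mono)
      fix a assume a: "a \<in> Z"
      have "norm (deriv (blaschke R a) z / blaschke R a z) \<le> 1 / norm (z - a) + 2 / R"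
        by (rule deriv_blaschke_ratio[OF Z[OF a] zR(3)]) (use a zZ in auto)
      thus "norm (of_int (zorder F a) * (deriv (blaschke R a) z / blaschke R a z)) \<le>
          \<bar>zorder F a\<bar> * (1 / norm (z - a) + 2 / R)"
        unfolding norm_mult by (simp add: mult_left_mono)
    qed
    also have "norm (deriv g z) \<le> 32 / R * \<Lambda>" using g(4)[of z] zR R0 by simp
    finally show ?thesis by simp
  qed
  have avoid: "norm a \<noteq> r" if "a \<in> Z" for a
    using irregular_circle_avoid[OF r] that by (auto simp: Z_def)
  \<comment> \<open>Subadditivity of \<open>sqrt\<close> separates the poles;
    \<open>sqrt_abs_int_le\<close> restores the multiplicities as weights, which add up to
    \<open>n\<close>.\<close>
  have ptw2: "log_plus (norm (deriv F z / F z)) \<le>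
     2 * sqrt (32 / R * \<Lambda>) + (\<Sum>a\<in>Z. 2 * \<bar>zorder F a\<bar> * (1 / sqrt (norm (z - a)) + sqrt (2 / R)))"
    if z: "norm z = r" for z
  proof -
    have "log_plus (norm (deriv F z / F z)) \<le> 2 * sqrt (norm (deriv F z / F z))"
      by (rule log_plus_le_sqrt) auto
    also have "sqrt (norm (deriv F z / F z)) \<le>
        sqrt (32 / R * \<Lambda> + (\<Sum>a\<in>Z. \<bar>zorder F a\<bar> * (1 / norm (z - a) + 2 / R)))"
      using ptw[OF z] by (rule real_sqrt_le_mono)
    also have "\<dots> \<le> sqrt (32 / R * \<Lambda>) + sqrt (\<Sum>a\<in>Z. \<bar>zorder F a\<bar> * (1 / norm (z - a) + 2 / R))"
      using R0 b(3) by (intro sqrt_add_le_add_sqrt sum_nonneg) auto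
    also have "sqrt (\<Sum>a\<in>Z. \<bar>zorder F a\<bar> * (1 / norm (z - a) + 2 / R)) \<le>
        (\<Sum>a\<in>Z. sqrt (\<bar>zorder F a\<bar> * (1 / norm (z - a) + 2 / R)))"
      using R0 fin by (intro sqrt_sum_le) auto
    also have "\<dots> \<le> (\<Sum>a\<in>Z. \<bar>zorder F a\<bar> * (1 / sqrt (norm (z - a)) + sqrt (2 / R)))"
    proof (intro sum_mono)
      fix a assume "a \<in> Z"
      have "sqrt (1 / norm (z - a) + 2 / R) \<le> sqrt (1 / norm (z - a)) + sqrt (2 / R)"
        using R0 by (intro sqrt_add_le_add_sqrt) auto
      hence "sqrt \<bar>real_of_int (zorder F a)\<bar> * sqrt (1 / norm (z - a) + 2 / R) \<le>
          \<bar>zorder F a\<bar> * (sqrt (1 / norm (z - a)) + sqrt (2 / R))"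
        using R0 by (intro mult_mono) (auto simp: sqrt_abs_int_le)
      thus "sqrt (\<bar>zorder F a\<bar> * (1 / norm (z - a) + 2 / R)) \<le> \<bar>zorder F a\<bar> * (1 / sqrt (norm (z - a)) + sqrt (2 / R))"
        by (simp add: real_sqrt_mult real_sqrt_divide)
    qed
    finally show ?thesis by (simp add: sum_distrib_left algebra_simps)
  qed
  have reg: "F analytic_on {z}" "F z \<noteq> 0" if "z \<in> sphere 0 r" for z
    using r that by (auto simp: regular_circle_def regular_at_def)
  have cF: "continuous_on (sphere 0 r) (\<lambda>z. log_plus (norm (deriv F z / F z)))"
    using reg by (intro continuous_intros continuous_at_imp_continuous_on ballI analytic_at_imp_isCont
        analytic_intros analytic_deriv) auto
  have c1: "continuous_on (sphere 0 r) (\<lambda>z. 1 / sqrt (norm (z - a)))" if "a \<in> Z" for a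
    using avoid[OF that] R0 by (intro continuous_intros) auto
  have "nevanlinna_m r (\<lambda>z. deriv F z / F z) \<le> circle_mean r (\<lambda>z.
     2 * sqrt (32 / R * \<Lambda>) + (\<Sum>a\<in>Z. 2 * \<bar>zorder F a\<bar> * (1 / sqrt (norm (z - a)) + sqrt (2 / R))))"
    unfolding nevanlinna_m_eq using R0
    by (intro circle_mean_mono cF ptw2 continuous_on_add continuous_on_const continuous_on_sum
       continuous_on_mult_left c1) auto
  also have "\<dots> = 2 * sqrt (32 / R * \<Lambda>) + (\<Sum>a\<in>Z. 2 * \<bar>zorder F a\<bar> *
      (circle_mean r (\<lambda>z. 1 / sqrt (norm (z - a))) + sqrt (2 / R)))"
  proof -
    have "circle_mean r (\<lambda>z. 2 * \<bar>zorder F a\<bar> * (1 / sqrt (norm (z - a)) + sqrt (2 / R))) =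
      2 * \<bar>zorder F a\<bar> * (circle_mean r (\<lambda>z. 1 / sqrt (norm (z - a))) + sqrt (2 / R))" if "a \<in> Z" for a
      unfolding circle_mean_cmult using c1[OF that] R0 by (subst circle_mean_add) auto
    moreover have cs: "continuous_on (sphere 0 r)
        (\<lambda>z. real_of_int (2 * \<bar>zorder F a\<bar>) * (1 / sqrt (norm (z - a)) + sqrt (2 / R)))" if "a \<in> Z" for a
      by (intro continuous_on_mult_left continuous_on_add c1[OF that] continuous_on_const)
    ultimately show ?thesis
      using circle_mean_sum[OF fin cs less_imp_le[OF R0(2)]]
      by (subst circle_mean_add[OF continuous_on_const continuous_on_sum[OF cs] less_imp_le[OF R0(2)]]) auto
  qed
  also have "\<dots> \<le> 2 * sqrt (32 / R * \<Lambda>) + (\<Sum>a\<in>Z. 2 * \<bar>zorder F a\<bar> * (12 / sqrt r + sqrt (2 / R)))"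
    using circle_mean_inverse_sqrt_le[OF R0(2) avoid]
    by (intro add_left_mono sum_mono mult_left_mono add_right_mono) auto
  also have "(\<Sum>a\<in>Z. 2 * \<bar>zorder F a\<bar> * (12 / sqrt r + sqrt (2 / R))) = 2 * n * (12 / sqrt r + sqrt (2 / R))"
    by (simp add: n_def sum_distrib_left sum_distrib_right)
  also have "12 / sqrt r + sqrt (2 / R) = 13 * sqrt 2 / sqrt R"
    using R0 by (simp add: R(4) real_sqrt_divide real_sqrt_mult field_simps)
  also have "2 * n * (13 * sqrt 2 / sqrt R) = 26 * sqrt 2 * n / sqrt R" by simp
  also have "2 * sqrt (32 / R * \<Lambda>) = 2 * sqrt 32 * sqrt \<Lambda> / sqrt R"
    by (simp add: real_sqrt_mult real_sqrt_divide)
  also have "2 * sqrt 32 * sqrt \<Lambda> / sqrt R + 26 * sqrt 2 * n / sqrt R = (2 * sqrt 32 * sqrt \<Lambda> + 26 * sqrt 2 * n) / sqrt R"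
    by (simp add: add_divide_distrib)
  also have "\<dots> \<le> 400 * nevanlinna_bound F R / sqrt R"
  proof (intro divide_right_mono)
    \<comment> \<open>With B the bound, \<Lambda> <= 2 B - 1 <= B^2; for this reason
      \<open>mean_and_count_le\<close> records the -1.\<close>
    have "\<Lambda> \<le> (nevanlinna_bound F R)\<^sup>2"
      using b(1) sum_squares_bound[of "nevanlinna_bound F R" 1] by (simp add: power2_eq_square algebra_simps)
    hence "sqrt \<Lambda> \<le> nevanlinna_bound F R" using b(4) by (intro real_le_lsqrt) auto
    moreover have "sqrt 32 \<le> 6" by (rule real_le_lsqrt) (simp_all add: power2_eq_square)
    moreover have "sqrt 2 \<le> 1.5" by (rule real_le_lsqrt) (simp_all add: power2_eq_square)
    \<comment> \<open>The sum is at most 12 + 156 = 168 times the bound. The rounder constant 400 is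
      shared with the difference quotients, where 64 + 160 = 224 arises.\<close>
    ultimately have "2 * sqrt 32 * sqrt \<Lambda> \<le> 2 * 6 * nevanlinna_bound F R"
      "26 * sqrt 2 * n \<le> 26 * 1.5 * (4 * nevanlinna_bound F R)"
      using b by (intro mult_mono; auto simp: n_def sum_nonneg)+
    thus "2 * sqrt 32 * sqrt \<Lambda> + 26 * sqrt 2 * n \<le> 400 * nevanlinna_bound F R"
      using b(4) by linarith
  qed (use R0 in auto)
  finally show ?thesis .
qed

section \<open>Entire functions: shifts and pointwise growth\<close>

lemma entire_nonzero_meromorphic:
  assumes "f holomorphic_on UNIV" "f z0 \<noteq> 0"
  shows "nonzero_meromorphic f"
proof -
  have an: "f analytic_on UNIV" using assms by (simp add: analytic_on_open)
  have "\<not> (\<forall>\<^sub>\<approx>z. f z = 0)"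
  proof
    assume "\<forall>\<^sub>\<approx>z. f z = 0"
    hence "\<forall>\<^sub>F z in at z0. f z = 0" by (rule eventually_cosparse_imp_eventually_at) auto
    moreover have "f \<midarrow>z0\<rightarrow> f z0"
      using an analytic_at_imp_isCont analytic_on_subset isCont_def by blast
    ultimately have "f z0 = 0"
      using LIM_unique tendsto_eventually by blast
    thus False using assms(2) by simp
  qed
  thus ?thesis using an by (simp add: nonzero_meromorphic_def analytic_on_imp_meromorphic_on)
qed

lemma entire_analytic: "f holomorphic_on UNIV \<Longrightarrow> f analytic_on S"
  using analytic_on_open analytic_on_subset by blast

lemma entire_irregular_points:
  assumes "f holomorphic_on UNIV"
  shows "z \<in> irregular_points f R \<longleftrightarrow> norm z < R \<and> f z = 0"
  using entire_analytic[OF assms] by (auto simp: irregular_points_def regular_at_def)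

lemma entire_zorder_nonneg:
  assumes "f holomorphic_on UNIV" "nonzero_meromorphic f"
  shows "zorder f z \<ge> 0"
  using zorder_ge_0[OF entire_analytic[OF assms(1)]] nonzero_meromorphic_at(5)[OF assms(2)] by blast

text \<open>By the factorisation, ln |f (z + d) / f z| is Re (g (z + d) - g z) plus the sum of the
  orders times ln |b (z + d) / b z| over the Blaschke factors b. As \<open>f\<close> is entire, all
  orders are nonnegative and the one-sided bound \<open>ln_blaschke_shift_le\<close> applies; |d| <=
  R / 4 keeps z + d within 3 / 4 * R, where \<open>deriv g\<close> is controlled.\<close>

theorem difference_quotient_estimate:
  assumes f: "f holomorphic_on UNIV" and F: "nonzero_meromorphic f" and r: "regular_circle f r"
    and R: "regular_circle f R" "regular_circle f (2 * R)" "R \<ge> 1" "R = 2 * r" and d: "norm d \<le> R / 4"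
  shows "nevanlinna_m r (\<lambda>z. f (z + d) / f z) \<le> 400 * (1 + norm d) * nevanlinna_bound f R / sqrt R"
proof -
  let ?T = "\<lambda>a z. real_of_int \<bar>zorder f a\<bar> * (2 * sqrt (norm d) * (1 / sqrt (norm (z - a))) + 4 * norm d / R)"
  let ?U = "\<lambda>a. real_of_int \<bar>zorder f a\<bar> * (2 * sqrt (norm d) * (12 / sqrt r) + 4 * norm d / R)"
  define Z where "Z = irregular_points f R"
  define \<Lambda> where "\<Lambda> = circle_mean R (\<lambda>z. \<bar>ln (norm (f z))\<bar>)"
  define n where "n = real_of_int (\<Sum>a\<in>Z. \<bar>zorder f a\<bar>)"
  note b = mean_and_count_le[OF F R(1-3), folded \<Lambda>_def Z_def, folded n_def]
  have fin: "finite Z" unfolding Z_def by (rule finite_irregular_points[OF F])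
  have R0: "R > 0" "r > 0" "r < R" using R by auto
  have Z: "norm a < R" if "a \<in> Z" for a using that by (auto simp: Z_def irregular_points_def)
  obtain g where g: "\<And>z. norm z < R \<Longrightarrow> g field_differentiable at z"
    "\<And>z. norm z < R \<Longrightarrow> z \<notin> Z \<Longrightarrow> f z = (\<Prod>a\<in>Z. blaschke R a z powi zorder f a) * exp (g z)"
    "Re (g 0) = circle_mean R (\<lambda>z. ln (norm (f z)))"
    "\<And>z. norm z \<le> 3 / 4 * R \<Longrightarrow> norm (deriv g z) \<le> 32 / R * \<Lambda>"
    by (rule blaschke_factorization_bounds[OF F R(1), folded Z_def \<Lambda>_def]) (rule that)
  have avoid: "norm a \<noteq> r" if "a \<in> Z" for a
    using irregular_circle_avoid[OF r] that by (auto simp: Z_def)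
  have ptw: "log_plus (norm (f (z + d) / f z)) \<le> 32 / R * \<Lambda> * norm d +
      (\<Sum>a\<in>Z. ?T a z)"
    (is "_ \<le> ?B z") if z: "norm z = r" for z
  proof -
    have B0: "?B z \<ge> 0"
      using R0 b(3) by (intro add_nonneg_nonneg sum_nonneg mult_nonneg_nonneg) auto
    have zZ: "z \<notin> Z" using avoid z by auto
    have zR: "norm z < R" "norm z \<le> R" "norm z = R / 2" using z R0 R by auto
    have zd: "norm (z + d) \<le> 3 / 4 * R" using norm_triangle_ineq[of z d] zR d by simp
    hence zd': "norm (z + d) < R" using R0 by simp
    show ?thesis
    \<comment> \<open>At a zero \<open>log_plus\<close> is 0, whereas the expansion of ln |f (z +
      d)| would break down.\<close>
    proof (cases "f (z + d) = 0")
      case True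
      thus ?thesis using B0 by (simp add: log_plus_eq_0)
    next
      case False
      have dZ: "z + d \<notin> Z" using False entire_irregular_points[OF f] by (auto simp: Z_def)
      have lnf: "ln (norm (f w)) = (\<Sum>a\<in>Z. zorder f a * ln (norm (blaschke R a w))) + Re (g w)"
        if "norm w < R" "w \<notin> Z" for w
      proof -
        have bn: "blaschke R a w \<noteq> 0" if "a \<in> Z" for a
          using blaschke_eq_0_iff[OF Z[OF that], of w] that \<open>norm w < R\<close> \<open>w \<notin> Z\<close> by auto
        hence p: "(\<Prod>a\<in>Z. norm (blaschke R a w) powi zorder f a) \<noteq> 0"
          using fin by (auto simp: power_int_eq_0_iff)
        have "norm (f w) = (\<Prod>a\<in>Z. norm (blaschke R a w) powi zorder f a) * exp (Re (g w))"
          by (simp add: g(2)[OF that] norm_mult norm_power_int flip: prod_norm)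
        hence "ln (norm (f w)) = ln (\<Prod>a\<in>Z. norm (blaschke R a w) powi zorder f a) + Re (g w)"
          using p by (simp add: ln_mult)
        also have "ln (\<Prod>a\<in>Z. norm (blaschke R a w) powi zorder f a) =
            (\<Sum>a\<in>Z. ln (norm (blaschke R a w) powi zorder f a))"
          using fin bn by (intro ln_prod) (auto simp: power_int_eq_0_iff)
        also have "\<dots> = (\<Sum>a\<in>Z. zorder f a * ln (norm (blaschke R a w)))"
          using bn by (intro sum.cong) (auto simp: ln_power_int)
        finally show ?thesis .
      qed
      have fz: "f z \<noteq> 0" using zZ zR entire_irregular_points[OF f] by (auto simp: Z_def)
      have "norm (g (z + d) - g z) \<le> 32 / R * \<Lambda> * norm (z + d - z)"
      proof (rule field_differentiable_bound[of "cball 0 (3 / 4 * R)" g "deriv g"])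
        show "(g has_field_derivative deriv g w) (at w within cball 0 (3 / 4 * R))" if "w \<in> cball 0 (3 / 4 * R)" for w
          using that R0 by (intro has_field_derivative_at_within[OF field_differentiable_derivI[OF g(1)]]) auto
      qed (use g(4) zd zR R0 in auto)
      hence g_le: "Re (g (z + d)) - Re (g z) \<le> 32 / R * \<Lambda> * norm d"
        using complex_Re_le_cmod[of "g (z + d) - g z"] by simp
      have "ln (norm (f (z + d) / f z)) = ln (norm (f (z + d))) - ln (norm (f z))"
        using fz False by (simp add: norm_divide ln_div)
      also have "\<dots> = (Re (g (z + d)) - Re (g z)) +
          (\<Sum>a\<in>Z. zorder f a * (ln (norm (blaschke R a (z + d))) - ln (norm (blaschke R a z))))"
        using lnf[OF zd' dZ] lnf[OF zR(1) zZ] by (simp add: sum_subtractf algebra_simps)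
      also have "\<dots> \<le> ?B z"
      proof (intro add_mono g_le sum_mono)
        fix a assume a: "a \<in> Z"
        have "ln (norm (blaschke R a (z + d))) - ln (norm (blaschke R a z)) \<le>
             2 * sqrt (norm d) * (1 / sqrt (norm (z - a))) + 4 * norm d / R"
          by (rule ln_blaschke_shift_le[OF Z[OF a] zR(3) _ d]) (use a zZ dZ in auto)
        thus "zorder f a * (ln (norm (blaschke R a (z + d))) - ln (norm (blaschke R a z))) \<le>
            ?T a z"
          using entire_zorder_nonneg[OF f F, of a] by (simp add: mult_left_mono)
      qed
      finally show ?thesis using B0 by (simp add: log_plus_eq_max)
    qed
  qed
  have c0: "continuous_on (sphere 0 r) f" "continuous_on UNIV f"
    using f holomorphic_on_imp_continuous_on holomorphic_on_subset by blast+
  have cF: "continuous_on (sphere 0 r) (\<lambda>z. log_plus (norm (f (z + d) / f z)))"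
    using r by (intro continuous_intros c0 continuous_on_compose2[OF c0(2)])
      (auto simp: regular_circle_def regular_at_def)
  have c1: "continuous_on (sphere 0 r) (\<lambda>z. 1 / sqrt (norm (z - a)))" if "a \<in> Z" for a
    using avoid[OF that] R0 by (intro continuous_intros) auto
  have c2: "continuous_on (sphere 0 r) (\<lambda>z. ?T a z)"
    if "a \<in> Z" for a
    by (intro continuous_on_mult_left continuous_on_add c1[OF that] continuous_on_const)
  have "nevanlinna_m r (\<lambda>z. f (z + d) / f z) \<le> circle_mean r (\<lambda>z. 32 / R * \<Lambda> * norm d +
      (\<Sum>a\<in>Z. ?T a z))"
    unfolding nevanlinna_m_eq using R0
    by (intro circle_mean_mono cF ptw continuous_on_add continuous_on_const continuous_on_sum c2) auto
  also have "\<dots> = 32 / R * \<Lambda> * norm d + (\<Sum>a\<in>Z. circle_mean r (\<lambda>z. ?T a z))"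
    using R0 fin c2 by (subst circle_mean_add) (auto intro!: continuous_on_sum c2 circle_mean_sum simp del: circle_mean_cmult)
  also have "\<dots> \<le> 32 / R * \<Lambda> * norm d + (\<Sum>a\<in>Z. ?U a)"
  proof (intro add_left_mono sum_mono)
    fix a assume a: "a \<in> Z"
    have "circle_mean r (\<lambda>z. ?T a z) =
       \<bar>zorder f a\<bar> * (2 * sqrt (norm d) * circle_mean r (\<lambda>z. 1 / sqrt (norm (z - a))) + 4 * norm d / R)"
      unfolding circle_mean_cmult
        circle_mean_add[OF continuous_on_mult_left[OF c1[OF a]] continuous_on_const less_imp_le[OF R0(2)]]
      by (simp only: circle_mean_const)
    also have "\<dots> \<le> ?U a"
      using circle_mean_inverse_sqrt_le[OF R0(2) avoid[OF a]]
      by (intro mult_left_mono add_right_mono) auto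
    finally show "circle_mean r (\<lambda>z. ?T a z) \<le>
      ?U a" .
  qed
  also have "\<dots> = 32 / R * \<Lambda> * norm d + n * (2 * sqrt (norm d) * (12 / sqrt r) + 4 * norm d / R)"
    by (simp add: n_def sum_distrib_right)
  also have "\<dots> \<le> 32 / sqrt R * \<Lambda> * (1 + norm d) + n * (36 * (1 + norm d) / sqrt R + 4 * (1 + norm d) / sqrt R)"
  proof -
    have sR: "sqrt R \<le> R" using R(3) by (intro real_le_lsqrt) (auto simp: power2_eq_square)
    have i: "4 * norm d / R \<le> 4 * (1 + norm d) / sqrt R"
      using sR R0 by (intro frac_le) auto
    have "sqrt (norm d) \<le> 1 + norm d"
      using sum_squares_bound[of "norm d" 1] by (intro real_le_lsqrt) (auto simp: power2_eq_square algebra_simps)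
    moreover have "sqrt 2 \<le> 1.5" by (rule real_le_lsqrt) (simp_all add: power2_eq_square)
    ultimately have "24 * (sqrt 2 * sqrt (norm d)) \<le> 24 * (1.5 * (1 + norm d))"
      by (intro mult_left_mono mult_mono) auto
    moreover have "2 * sqrt (norm d) * (12 / sqrt r) = 24 * (sqrt 2 * sqrt (norm d)) / sqrt R"
      using R0 by (simp add: R(4) real_sqrt_mult field_simps)
    ultimately have ii: "2 * sqrt (norm d) * (12 / sqrt r) \<le> 36 * (1 + norm d) / sqrt R"
      using R0 by (simp add: divide_right_mono)
    have "32 / R * \<Lambda> * norm d \<le> 32 / sqrt R * \<Lambda> * (1 + norm d)"
      using sR R0 b by (intro mult_mono divide_left_mono) auto
    with i ii show ?thesis
      by (intro add_mono mult_left_mono) (auto simp: n_def sum_nonneg)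
  qed
  also have "\<dots> = (1 + norm d) * (32 * \<Lambda> + 40 * n) / sqrt R"
    by (simp add: divide_inverse algebra_simps)
  also have "\<dots> \<le> (1 + norm d) * (400 * nevanlinna_bound f R) / sqrt R"
    using b R0 by (intro divide_right_mono mult_left_mono) auto
  finally show ?thesis by (simp only: mult_ac)
qed

text \<open>Without poles the Blaschke product has modulus at most 1, so |f| <= exp (Re g), and Re g
  z <= Re g 0 + 32 / R * \<Lambda> * (3 / 4 * R) <= 25 \<Lambda>. This is the step from the
  characteristic to pointwise bounds: it controls T(r, L), and through Liouville it makes T(r, f)
  unbounded.\<close>

theorem log_plus_modulus_le:
  assumes f: "f holomorphic_on UNIV" and F: "nonzero_meromorphic f"
    and R: "regular_circle f R" "R \<ge> 1" and z: "norm z \<le> 3 / 4 * R"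
  shows "log_plus (norm (f z)) \<le> 50 * nevanlinna_T R f + 25 * \<bar>ln (norm (zor_poly f 0 0))\<bar>"
proof -
  define Z where "Z = irregular_points f R"
  define \<Lambda> where "\<Lambda> = circle_mean R (\<lambda>z. \<bar>ln (norm (f z))\<bar>)"
  have R0: "R > 0" using R by auto
  have Z: "norm a < R" if "a \<in> Z" for a using that by (auto simp: Z_def irregular_points_def)
  obtain g where g: "\<And>z. norm z < R \<Longrightarrow> g field_differentiable at z"
    "\<And>z. norm z < R \<Longrightarrow> z \<notin> Z \<Longrightarrow> f z = (\<Prod>a\<in>Z. blaschke R a z powi zorder f a) * exp (g z)"
    "Re (g 0) = circle_mean R (\<lambda>z. ln (norm (f z)))"
    "\<And>z. norm z \<le> 3 / 4 * R \<Longrightarrow> norm (deriv g z) \<le> 32 / R * \<Lambda>"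
    by (rule blaschke_factorization_bounds[OF F R(1), folded Z_def \<Lambda>_def]) (rule that)
  have \<Lambda>: "\<Lambda> \<le> 2 * nevanlinna_T R f + \<bar>ln (norm (zor_poly f 0 0))\<bar>"
    unfolding \<Lambda>_def by (rule circle_mean_abs_ln_le[OF F R])
  have g0: "Re (g 0) \<le> \<Lambda>" unfolding g(3) \<Lambda>_def
    using R0 by (intro circle_mean_mono continuous_intros regular_circle_continuous_ln R) auto
  have \<Lambda>0: "\<Lambda> \<ge> 0" unfolding \<Lambda>_def
    using R0 by (intro circle_mean_nonneg continuous_intros regular_circle_continuous_ln R) auto
  have "norm (g z - g 0) \<le> 32 / R * \<Lambda> * norm (z - 0)"
  proof (rule field_differentiable_bound[of "cball 0 (3 / 4 * R)" g "deriv g"])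
    show "(g has_field_derivative deriv g w) (at w within cball 0 (3 / 4 * R))" if "w \<in> cball 0 (3 / 4 * R)" for w
      using that R0 by (intro has_field_derivative_at_within[OF field_differentiable_derivI[OF g(1)]]) auto
  qed (use g(4) z R0 in auto)
  also have "\<dots> \<le> 32 / R * \<Lambda> * (3 / 4 * R)" using z R0 \<Lambda>0 by (intro mult_left_mono) auto
  also have "\<dots> = 24 * \<Lambda>" using R0 by simp
  finally have gz: "Re (g z) \<le> 25 * \<Lambda>"
    using complex_Re_le_cmod[of "g z - g 0"] g0 by simp
  have zR: "norm z < R" "norm z \<le> R" using z R0 by auto
  have "norm (f z) \<le> exp (25 * \<Lambda>)"
  proof (cases "z \<in> Z")
    case True
    thus ?thesis using entire_irregular_points[OF f] by (auto simp: Z_def)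
  next
    case False
    have "norm (\<Prod>a\<in>Z. blaschke R a z powi zorder f a) \<le> 1"
      unfolding prod_norm[symmetric]
    proof (rule prod_le_1)
      fix a assume a: "a \<in> Z"
      have "zorder f a \<ge> 0" by (rule entire_zorder_nonneg[OF f F])
      then obtain k where "zorder f a = int k" using nonneg_int_cases by blast
      thus "0 \<le> norm (blaschke R a z powi zorder f a) \<and> norm (blaschke R a z powi zorder f a) \<le> 1"
        using norm_blaschke_le_1[OF Z[OF a] zR(2)] by (simp add: norm_power power_le_one)
    qed
    hence "norm (f z) \<le> 1 * exp (Re (g z))"
      unfolding g(2)[OF zR(1) False] norm_mult by (intro mult_mono) auto
    also have "\<dots> \<le> exp (25 * \<Lambda>)" using gz by simp
    finally show ?thesis .
  qed
  hence "log_plus (norm (f z)) \<le> log_plus (exp (25 * \<Lambda>))" by (rule log_plus_mono)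
  also have "\<dots> = 25 * \<Lambda>" using \<Lambda>0 by (simp add: log_plus_eq_max)
  finally show ?thesis using \<Lambda> by simp
qed

section \<open>Choice of radii\<close>

lemma nn_integral_lebesgue_scale:
  fixes h :: "real \<Rightarrow> ennreal"
  assumes h: "h \<in> borel_measurable lebesgue" and c: "c > 0"
  shows "(\<integral>\<^sup>+x. h x \<partial>lebesgue) = (\<integral>\<^sup>+x. ennreal c * h (c * x) \<partial>lebesgue)"
proof -
  have m: "(\<lambda>x::real. c * x) \<in> lebesgue \<rightarrow>\<^sub>M lebesgue"
    using lebesgue_measurable_scaling[of c, where 'a = real] by (simp add: real_scaleR_def[abs_def])
  have "(\<integral>\<^sup>+x. h x \<partial>lebesgue) =
      (\<integral>\<^sup>+x. h x \<partial>density (distr lebesgue lebesgue (\<lambda>x. c * x)) (\<lambda>x. ennreal \<bar>c\<bar>))"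
    using lebesgue_real_scale[of c] c by simp
  also have "\<dots> = (\<integral>\<^sup>+x. ennreal c * h x \<partial>distr lebesgue lebesgue (\<lambda>x. c * x))"
    using h c by (subst nn_integral_density) auto
  also have "\<dots> = (\<integral>\<^sup>+x. ennreal c * h (c * x) \<partial>lebesgue)"
    using h m by (subst nn_integral_distr) auto
  finally show ?thesis .
qed

text \<open>A Borel-Cantelli argument. The measure dr / r is invariant under scaling, so the
  integrals of 1 / s over those s in [1, 2) with s * 2 ^ k in \<open>E\<close> add up to the
  logarithmic measure of \<open>E\<close> on [1, \<infinity>). Hence for almost every s the series
  of \<open>v k s\<close> converges and its terms tend to 0; but a term with s * 2 ^ k in
  \<open>E\<close> equals 1 / s > 1 / 2.\<close>

lemma AE_eventually_avoid:
  assumes E: "finite_log_measure E"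
  shows "AE s in lebesgue. s \<in> {1..<2} \<longrightarrow> (\<forall>\<^sub>F k in sequentially. s * 2 ^ k \<notin> E)"
proof -
  have Es: "E \<in> sets lebesgue" using E by (simp add: finite_log_measure_def)
  define h where "h = (\<lambda>r::real. ennreal (1 / r) * indicator (E \<inter> {1..}) r)"
  have hm: "h \<in> borel_measurable lebesgue"
  proof -
    have "(\<lambda>r::real. ennreal (1 / r)) \<in> borel_measurable lebesgue"
      by (rule measurable_completion) measurable
    thus ?thesis
      unfolding h_def using Es by (intro borel_measurable_times_ennreal borel_measurable_indicator) auto
  qed
  define D where "D = (\<lambda>k::nat. {2 ^ k..<2 ^ Suc k :: real})"
  define v where "v = (\<lambda>k s. 1 / s * indicator E (s * 2 ^ k) * indicator {1..<2} s :: real)"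
  have vE: "ennreal (v k s) = ennreal (2 ^ k) * (h (2 ^ k * s) * indicator (D k) (2 ^ k * s))" for k s
  proof (cases "s \<in> {1..<2}")
    case True
    have "1 \<le> (2::real) ^ k" by simp
    hence "1 * 1 \<le> 2 ^ k * s" using True by (intro mult_mono) auto
    moreover have "2 ^ k * s \<in> D k" using True by (simp add: D_def)
    moreover have "ennreal (2 ^ k) * ennreal (1 / (2 ^ k * s)) = ennreal (1 / s)"
      using True by (subst ennreal_mult[symmetric]) auto
    ultimately show ?thesis using True
      by (cases "s * 2 ^ k \<in> E") (auto simp: v_def h_def mult.commute)
  next
    case False
    hence "2 ^ k * s \<notin> D k" by (auto simp: D_def mult.commute)
    thus ?thesis using False by (auto simp: v_def)
  qed
  have hDm: "(\<lambda>x. h x * indicator (D k) x) \<in> borel_measurable lebesgue" for k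
    using hm by (intro borel_measurable_times_ennreal borel_measurable_indicator) (auto simp: D_def)
  have vm: "(\<lambda>s. ennreal (v k s)) \<in> borel_measurable lebesgue" for k
  proof -
    have m: "(\<lambda>x::real. 2 ^ k * x) \<in> lebesgue \<rightarrow>\<^sub>M lebesgue"
      using lebesgue_measurable_scaling[of "2 ^ k", where 'a = real] by (simp add: real_scaleR_def[abs_def])
    show ?thesis unfolding vE using measurable_compose[OF m hDm[of k]]
      by (rule borel_measurable_times_ennreal[OF borel_measurable_const])
  qed
  have "(\<integral>\<^sup>+s. (\<Sum>k. ennreal (v k s)) \<partial>lebesgue) = (\<Sum>k. \<integral>\<^sup>+s. ennreal (v k s) \<partial>lebesgue)"
    by (rule nn_integral_suminf) (rule vm)
  also have "\<dots> = (\<Sum>k. \<integral>\<^sup>+x. h x * indicator (D k) x \<partial>lebesgue)"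
    unfolding vE by (subst nn_integral_lebesgue_scale[OF hDm, symmetric]) auto
  also have "\<dots> = (\<integral>\<^sup>+x. (\<Sum>k. h x * indicator (D k) x) \<partial>lebesgue)"
    by (rule nn_integral_suminf[symmetric]) (rule hDm)
  also have "\<dots> \<le> (\<integral>\<^sup>+x. h x \<partial>lebesgue)"
  proof (rule nn_integral_mono)
    fix x :: real
    have "disjoint_family D"
    proof (unfold disjoint_family_on_def, intro ballI impI)
      fix m n :: nat assume "m \<noteq> n"
      moreover have "D i \<inter> D j = {}" if "i < j" for i j
      proof -
        have "(2::real) ^ Suc i \<le> 2 ^ j" using that by (intro power_increasing) auto
        thus ?thesis by (auto simp: D_def)
      qed
      ultimately show "D m \<inter> D n = {}" by (metis inf_commute nat_neq_iff)
    qed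
    hence "(\<Sum>k. indicator (D k) x :: ennreal) = indicator (\<Union>k. D k) x"
      by (rule suminf_indicator)
    hence "(\<Sum>k. h x * indicator (D k) x) = h x * indicator (\<Union>k. D k) x"
      by simp
    also have "\<dots> \<le> h x" by (auto simp: indicator_def)
    finally show "(\<Sum>k. h x * indicator (D k) x) \<le> h x" .
  qed
  also have "\<dots> < \<infinity>" using E by (simp add: finite_log_measure_def h_def)
  finally have "AE s in lebesgue. (\<Sum>k. ennreal (v k s)) \<noteq> \<infinity>"
    using vm by (intro nn_integral_PInf_AE borel_measurable_suminf) auto
  thus ?thesis
  proof eventually_elim
    case (elim s)
    show ?case
    proof
      assume s: "s \<in> {1..<2}"
      have "summable (\<lambda>k. v k s)"
        using elim s by (intro summable_suminf_not_top) (auto simp: v_def)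
      hence "(\<lambda>k. v k s) \<longlonglongrightarrow> 0" by (rule summable_LIMSEQ_zero)
      hence "\<forall>\<^sub>F k in sequentially. v k s < 1 / 2" by (rule order_tendstoD) auto
      thus "\<forall>\<^sub>F k in sequentially. s * 2 ^ k \<notin> E"
      proof eventually_elim
        case (elim k)
        thus ?case using s by (auto simp: v_def field_simps split: split_indicator_asm)
      qed
    qed
  qed
qed

text \<open>The scales whose radii meet \<open>B\<close> form a countable set, so all exceptional
  scales together are a null set, whereas [1, 2) has positive measure.\<close>

lemma exists_good_scale:
  assumes "finite_log_measure E1" "finite_log_measure E2" and B: "countable (B :: real set)"
  obtains s where "s \<in> {1..<2}" "\<And>k. s * 2 ^ k \<notin> B"
    "\<forall>\<^sub>F k in sequentially. s * 2 ^ k \<notin> E1" "\<forall>\<^sub>F k in sequentially. s * 2 ^ k \<notin> E2"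
proof -
  define C where "C = (\<Union>k::nat. (\<lambda>x. x / 2 ^ k) ` B)"
  have "countable C" unfolding C_def using B by (intro countable_UN countable_image) auto
  hence "AE s in lebesgue. s \<notin> C"
    using countable_imp_null_set_lborel[of C] by (intro AE_not_in) (auto intro: null_sets_completionI)
  with AE_eventually_avoid[OF assms(1)] AE_eventually_avoid[OF assms(2)]
  have ae: "AE s in lebesgue. s \<in> {1..<2} \<longrightarrow> s \<notin> C \<and> (\<forall>\<^sub>F k in sequentially. s * 2 ^ k \<notin> E1) \<and>
      (\<forall>\<^sub>F k in sequentially. s * 2 ^ k \<notin> E2)"
    by eventually_elim auto
  have "\<exists>s\<in>{1..<2::real}. s \<notin> C \<and> (\<forall>\<^sub>F k in sequentially. s * 2 ^ k \<notin> E1) \<and>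
      (\<forall>\<^sub>F k in sequentially. s * 2 ^ k \<notin> E2)"
  proof (rule ccontr)
    assume neg: "\<not> ?thesis"
    from ae have "AE s in lebesgue. s \<notin> {1..<2::real}" by eventually_elim (use neg in blast)
    hence "emeasure lebesgue {1..<2::real} = 0"
      by (subst (asm) AE_iff_measurable[of "{1..<2::real}"]) auto
    thus False by simp
  qed
  then obtain s where s: "s \<in> {1..<2}" "s \<notin> C" "\<forall>\<^sub>F k in sequentially. s * 2 ^ k \<notin> E1"
      "\<forall>\<^sub>F k in sequentially. s * 2 ^ k \<notin> E2" by blast
  moreover have "s * 2 ^ k \<notin> B" for k
  proof
    assume "s * 2 ^ k \<in> B"
    hence "s * 2 ^ k / 2 ^ k \<in> C" unfolding C_def by blast
    thus False using s by simp
  qed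
  ultimately show ?thesis using that by blast
qed

lemma filterlim_scale: "s > 0 \<Longrightarrow> filterlim (\<lambda>k. s * 2 ^ k :: real) at_top sequentially"
  by (intro filterlim_tendsto_pos_mult_at_top[OF tendsto_const]
       filterlim_at_infinity_imp_filterlim_at_top filterlim_realpow_sequentially_gt1) auto

lemma small_wrt_along:
  assumes "g \<in> o[inf at_top (principal (- E))](\<lambda>r. nevanlinna_T r f)"
    and "\<forall>\<^sub>F k in sequentially. s * 2 ^ k \<notin> E" "s > 0" "\<epsilon> > 0"
  shows "\<forall>\<^sub>F k in sequentially. \<bar>g (s * 2 ^ k)\<bar> \<le> \<epsilon> * \<bar>nevanlinna_T (s * 2 ^ k) f\<bar>"
proof -
  have "\<forall>\<^sub>F r in at_top. r \<in> - E \<longrightarrow> norm (g r) \<le> \<epsilon> * norm (nevanlinna_T r f)"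
    using landau_o.smallD[OF assms(1,4)] by (simp add: eventually_inf_principal)
  hence "\<forall>\<^sub>F k in sequentially. s * 2 ^ k \<in> - E \<longrightarrow>
      norm (g (s * 2 ^ k)) \<le> \<epsilon> * norm (nevanlinna_T (s * 2 ^ k) f)"
    by (rule eventually_compose_filterlim[OF _ filterlim_scale[OF assms(3)]])
  with assms(2) show ?thesis by eventually_elim auto
qed

lemma finite_order_growth:
  assumes "nevanlinna_order f < \<infinity>"
  obtains K :: nat where "\<forall>\<^sub>F r in at_top. nevanlinna_T r f \<le> r ^ K"
proof -
  obtain K :: nat where K: "nevanlinna_order f < ereal (real K)"
    using assms less_PInf_Ex_of_nat by auto
  have "\<forall>\<^sub>F r in at_top. ereal (ln (nevanlinna_T r f) / ln r) < ereal (real K)"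
    using K unfolding nevanlinna_order_def by (rule Limsup_lessD)
  with eventually_gt_at_top[of "1::real"]
  have "\<forall>\<^sub>F r in at_top. nevanlinna_T r f \<le> r ^ K"
  proof eventually_elim
    case (elim r)
    show ?case
    \<comment> \<open>For a nonpositive characteristic the quotient of logarithms carries no
      information, but the bound is trivial.\<close>
    proof (cases "nevanlinna_T r f > 0")
      case True
      have "ln (nevanlinna_T r f) < K * ln r" using elim by (simp add: divide_less_eq)
      also have "\<dots> = ln (r ^ K)" using elim by (simp add: ln_realpow)
      finally show ?thesis using True elim by (simp add: ln_less_cancel_iff)
    next
      case False
      have "0 \<le> r ^ K" using elim by simp
      thus ?thesis using False by linarith
    qed
  qed
  thus ?thesis using that by blast
qed

text \<open>Otherwise \<open>u\<close> would repeatedly gain a factor \<open>2 B\<^sup>J\<close> within \<open>J\<close> steps, outgrowing \<open>B\<^sup>k\<close>.\<close>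

lemma frequently_regular_growth:
  fixes u :: "nat \<Rightarrow> real"
  assumes pos: "\<forall>\<^sub>F k in sequentially. u k \<ge> 1" and le: "\<forall>\<^sub>F k in sequentially. u k \<le> C * B ^ k" and B: "B \<ge> 1"
  shows "\<exists>\<^sub>F k in sequentially. \<forall>j\<le>J. u (k + j) \<le> 2 * B ^ J * u k"
proof (rule ccontr)
  let ?A = "2 * B ^ J"
  assume "\<not> ?thesis"
  hence "\<forall>\<^sub>F k in sequentially. \<not> (\<forall>j\<le>J. u (k + j) \<le> ?A * u k)"
    by (simp add: not_frequently)
  with pos le have "\<forall>\<^sub>F k in sequentially. u k \<ge> 1 \<and> u k \<le> C * B ^ k \<and> (\<exists>j\<le>J. u (k + j) > ?A * u k)"
    by eventually_elim (auto simp: not_le)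
  then obtain k0 where k0: "\<And>k. k \<ge> k0 \<Longrightarrow> u k \<ge> 1 \<and> u k \<le> C * B ^ k \<and> (\<exists>j\<le>J. u (k + j) > ?A * u k)"
    unfolding eventually_sequentially by blast
  have ex: "\<exists>k\<ge>k0. k \<le> k0 + i * J \<and> ?A ^ i \<le> u k" for i
  proof (induction i)
    case 0
    thus ?case using k0[of k0] by auto
  next
    case (Suc i)
    then obtain k where k: "k \<ge> k0" "k \<le> k0 + i * J" "?A ^ i \<le> u k" by blast
    obtain j where j: "j \<le> J" "u (k + j) > ?A * u k" using k0[OF k(1)] by blast
    have "?A ^ Suc i \<le> ?A * u k" using k(3) B by (simp add: mult_left_mono)
    thus ?case using k j by (intro exI[of _ "k + j"]) auto
  qed
  \<comment> \<open>After i jumps the value is at least (2 B^J)^i, while the index has advanced by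
    at most i * J; the powers of B cancel against the growth bound.\<close>
  have bd: "2 ^ i \<le> C * B ^ k0" for i :: nat
  proof -
    obtain k where k: "k \<ge> k0" "k \<le> k0 + i * J" "?A ^ i \<le> u k" using ex by blast
    have uk: "u k \<ge> 1" "u k \<le> C * B ^ k" using k0[OF k(1)] by auto
    have Bk: "B ^ k > 0" using B by simp
    have "C > 0" using uk Bk by (smt (verit) mult_nonpos_nonneg)
    have "(2 * B ^ J) ^ i \<le> C * B ^ k" using k uk by linarith
    also have "\<dots> \<le> C * B ^ (k0 + i * J)" using k B \<open>C > 0\<close> by (intro mult_left_mono power_increasing) auto
    also have "\<dots> = C * B ^ k0 * B ^ (J * i)" by (simp add: power_add mult.commute)
    finally have "2 ^ i * B ^ (J * i) \<le> C * B ^ k0 * B ^ (J * i)"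
      by (simp add: power_mult_distrib power_mult)
    thus ?thesis using B by (simp add: mult_le_cancel_right)
  qed
  obtain i where "C * B ^ k0 < 2 ^ i" using real_arch_pow[of 2 "C * B ^ k0"] by auto
  thus False using bd[of i] by simp
qed

section \<open>Orders and counting functions\<close>

lemma not_is_pole_of_tendsto: "(F \<longlongrightarrow> l) (at a) \<Longrightarrow> \<not> is_pole F (a :: complex)"
  unfolding is_pole_def using not_tendsto_and_filterlim_at_infinity trivial_limit_at by blast

text \<open>Orders do not behave additively under sums such as \<open>P\<close>, but limits do. This
  lemma and its converse below translate between order bounds and limits.\<close>

lemma zorder_ge_of_tendsto:
  assumes F: "nonzero_meromorphic F" and lim: "((\<lambda>w. F w * (w - a) ^ N) \<longlongrightarrow> l) (at a)"
  shows "zorder F a \<ge> - int N"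
proof (rule ccontr)
  assume neg: "\<not> ?thesis"
  define G where "G = (\<lambda>w. F w * (w - a) ^ N)"
  note Fa = nonzero_meromorphic_at[OF F, of a]
  have ev: "\<forall>\<^sub>F w in at a. (w - a) ^ N \<noteq> 0"
    by (intro eventually_at_filter[THEN iffD2] always_eventually) simp
  have m: "(\<lambda>w. (w - a) ^ N) meromorphic_on {a}" by (intro meromorphic_intros)
  have "zorder (\<lambda>w. (w - a) ^ N) a = int N"
    by (rule zorder_eqI[of UNIV a "\<lambda>_. 1"]) auto
  hence "zorder G a = zorder F a + int N"
    unfolding G_def using Fa m ev by (subst zorder_mult) (auto intro: eventually_frequently)
  hence "zorder G a < 0" using neg by simp
  moreover have "G meromorphic_on {a}" unfolding G_def by (intro meromorphic_intros Fa)
  moreover have "\<forall>\<^sub>F w in at a. G w \<noteq> 0" using Fa(4) ev by eventually_elim (simp add: G_def)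
  ultimately have "is_pole G a" by (intro zorder_neg_imp_is_pole)
  thus False using not_is_pole_of_tendsto lim by (auto simp: G_def)
qed

lemma tendsto_of_zorder_ge:
  assumes F: "nonzero_meromorphic F" and N: "zorder F a \<ge> - int N"
  obtains l where "((\<lambda>w. F w * (w - a) ^ N) \<longlongrightarrow> l) (at a)"
proof -
  obtain r where r: "r > 0" "zor_poly F a holomorphic_on cball a r"
     "\<And>w. w \<in> cball a r - {a} \<Longrightarrow> F w = zor_poly F a w * (w - a) powi zorder F a"
    using zorder_exist[OF nonzero_meromorphic_at(2,3,5)[OF F], of a] by blast
  define j where "j = nat (zorder F a + int N)"
  have j: "zorder F a + int N = int j" using N by (simp add: j_def)
  have "continuous_on (ball a r) (zor_poly F a)"
    using r(2) by (intro holomorphic_on_imp_continuous_on) (rule holomorphic_on_subset, auto)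
  hence "isCont (zor_poly F a) a" using r(1) by (simp add: continuous_on_eq_continuous_at)
  hence "isCont (\<lambda>w. zor_poly F a w * (w - a) ^ j) a" by (intro continuous_intros)
  hence lim: "(\<lambda>w. zor_poly F a w * (w - a) ^ j) \<midarrow>a\<rightarrow> zor_poly F a a * (a - a) ^ j"
    by (simp add: isCont_def)
  have "\<forall>\<^sub>F w in at a. w \<in> ball a r - {a}" using r(1) by (intro eventually_at_in_open) auto
  hence "\<forall>\<^sub>F w in at a. zor_poly F a w * (w - a) ^ j = F w * (w - a) ^ N"
  proof eventually_elim
    case (elim w)
    hence "w \<noteq> a" by auto
    hence "(w - a) powi zorder F a * (w - a) powi int N = (w - a) powi int j"
      using power_int_add[of "w - a" "zorder F a" "int N"] j by simp
    moreover have "F w = zor_poly F a w * (w - a) powi zorder F a" using elim r(3) by auto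
    ultimately show ?case by (simp add: mult.assoc)
  qed
  from Lim_transform_eventually[OF lim this] that show ?thesis by blast
qed

lemma zorder_nonzero_imp_irregular:
  assumes F: "nonzero_meromorphic F" and R: "regular_circle F R" and a: "norm a \<le> R" "zorder F a \<noteq> 0"
  shows "a \<in> irregular_points F R"
  using a R regular_at_imp_zorder_eq_0[of F a]
  by (cases "norm a = R") (auto simp: irregular_points_def regular_circle_def)

text \<open>Each point of \<open>A\<close> may carry one pole multiplicity beyond those of
  \<open>G\<close>. With \<open>A\<close> empty it compares \<open>P\<close> with \<open>q\<close>;
  with \<open>A\<close> the distinct zeros of \<open>p\<close> it yields the bound for
  \<open>\<phi>\<close>.\<close>

lemma pole_sum_mono:
  assumes F: "nonzero_meromorphic F" and G: "nonzero_meromorphic G"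
    and RF: "regular_circle F R" and RG: "regular_circle G R" and R: "R \<ge> 1"
    and A: "finite A" "A \<subseteq> cball 0 R"
    and le: "\<And>a. zorder F a < 0 \<Longrightarrow> norm a < R \<Longrightarrow>
       - of_int (zorder F a) \<le> (if a \<in> A then 1 else 0) + max 0 (- of_int (zorder G a) :: real)"
  shows "nevanlinna_N R F \<le> (\<Sum>a\<in>A. log_weight R a) + nevanlinna_N R G"
proof -
  let ?w = "log_weight R"
  let ?S = "irregular_points F R \<union> irregular_points G R \<union> A"
  have fin: "finite ?S" using A finite_irregular_points F G by blast
  have w: "?w a \<ge> 0" if "a \<in> ?S" for a
    using that R A by (intro log_weight_nonneg) (auto dest: irregular_points_norm)
  have "nevanlinna_N R F = (\<Sum>a\<in>irregular_points F R. max 0 (- of_int (zorder F a)) * ?w a)"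
    by (rule nevanlinna_N_eq[OF F RF])
  also have "\<dots> \<le> (\<Sum>a\<in>irregular_points F R. ((if a \<in> A then 1 else 0) + max 0 (- of_int (zorder G a))) * ?w a)"
  proof (intro sum_mono mult_right_mono)
    fix a assume "a \<in> irregular_points F R"
    hence "norm a < R" by (rule irregular_points_norm)
    show "max 0 (- of_int (zorder F a)) \<le> (if a \<in> A then 1 else 0) + max 0 (- of_int (zorder G a) :: real)"
    proof (cases "zorder F a < 0")
      case True
      hence "max 0 (- of_int (zorder F a)) = (- of_int (zorder F a) :: real)" by simp
      thus ?thesis using le[OF True \<open>norm a < R\<close>] by simp
    qed simp
  qed (use w in auto)
  also have "\<dots> \<le> (\<Sum>a\<in>?S. ((if a \<in> A then 1 else 0) + max 0 (- of_int (zorder G a))) * ?w a)"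
    by (intro sum_mono2 fin mult_nonneg_nonneg w) auto
  also have "\<dots> = (\<Sum>a\<in>?S. if a \<in> A then ?w a else 0) + (\<Sum>a\<in>?S. max 0 (- of_int (zorder G a)) * ?w a)"
    by (simp add: sum.distrib[symmetric]) (intro sum.cong, auto simp: algebra_simps)
  also have "(\<Sum>a\<in>?S. if a \<in> A then ?w a else 0) = (\<Sum>a\<in>A. ?w a)"
    using fin by (intro sum.mono_neutral_cong_right) auto
  also have "(\<Sum>a\<in>?S. max 0 (- of_int (zorder G a)) * ?w a) = nevanlinna_N R G"
    unfolding nevanlinna_N_eq[OF G RG]
  proof (intro sum.mono_neutral_right fin ballI)
    fix a assume a: "a \<in> ?S - irregular_points G R"
    hence "norm a \<le> R" using A by (auto dest: irregular_points_norm)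
    hence "zorder G a = 0" using zorder_nonzero_imp_irregular[OF G RG] a by blast
    thus "max 0 (- of_int (zorder G a)) * ?w a = 0" by simp
  qed auto
  finally show ?thesis .
qed

lemma nevanlinna_N_bar_inverse_eq:
  assumes "p meromorphic_on UNIV" and "R > 0"
  shows "nevanlinna_N_bar R (\<lambda>z. 1 / p z) = (\<Sum>a | a \<in> cball 0 R \<and> is_pole (\<lambda>z. 1 / p z) a. log_weight R a)"
proof -
  have fin: "finite {z \<in> cball 0 R. is_pole (\<lambda>z. 1 / p z) z}"
    by (intro finite_poles meromorphic_intros assms)
  have "distinct_pole_count (\<lambda>z. 1 / p z) t =
     (\<Sum>a | a \<in> {a \<in> cball 0 R. is_pole (\<lambda>z. 1 / p z) a} \<and> norm a \<le> t. 1)" if "t \<le> R" for t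
  proof -
    have "{z \<in> cball 0 t. is_pole (\<lambda>z. 1 / p z) z} =
        {a. a \<in> {a \<in> cball 0 R. is_pole (\<lambda>z. 1 / p z) a} \<and> norm a \<le> t}" using that by auto
    thus ?thesis unfolding distinct_pole_count_def by (simp only: card_eq_sum of_nat_sum of_nat_1)
  qed
  hence "nevanlinna_N_bar R (\<lambda>z. 1 / p z) = (\<Sum>a\<in>{a \<in> cball 0 R. is_pole (\<lambda>z. 1 / p z) a}. 1 * log_weight R a)"
    unfolding nevanlinna_N_bar_def using fin assms(2) by (intro integrated_counting_eq) auto
  thus ?thesis by simp
qed

text \<open>A pole is a property of a punctured neighbourhood, on which \<open>p\<close> may be
  replaced by \<open>P\<close>.\<close>

lemma is_pole_inverse_iff_zorder:
  assumes P: "nonzero_meromorphic P" and eq: "\<forall>\<^sub>\<approx>z. P z = p z"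
  shows "is_pole (\<lambda>z. 1 / p z) a \<longleftrightarrow> zorder P a > 0"
proof -
  have "\<forall>\<^sub>F z in at a. P z = p z" using eq by (rule eventually_cosparse_imp_eventually_at) auto
  hence "\<forall>\<^sub>F z in at a. 1 / p z = inverse (P z)" by eventually_elim (simp add: inverse_eq_divide)
  hence "is_pole (\<lambda>z. 1 / p z) a \<longleftrightarrow> is_pole (\<lambda>z. inverse (P z)) a" by (intro is_pole_cong) auto
  also have "\<dots> \<longleftrightarrow> isolated_zero P a" by (rule is_pole_inverse_iff)
  also have "\<dots> \<longleftrightarrow> zorder P a > 0"
    using zorder_pos_imp_isolated_zero zorder_isolated_zero_pos' nonzero_meromorphic_at[OF P, of a] by blast
  finally show ?thesis .
qed

lemma log_plus_norm_sum_mult: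
  fixes x y :: "'i \<Rightarrow> complex"
  assumes "finite A"
  shows "log_plus (norm (\<Sum>i\<in>A. x i * y i)) \<le>
    (\<Sum>i\<in>A. log_plus (norm (x i)) + log_plus (norm (y i))) + real (card A) * ln 2"
proof -
  have "log_plus (norm (\<Sum>i\<in>A. x i * y i)) \<le> log_plus (\<Sum>i\<in>A. norm (x i) * norm (y i))"
    by (intro log_plus_mono order_trans[OF norm_sum]) (simp add: norm_mult)
  also have "\<dots> \<le> (\<Sum>i\<in>A. log_plus (norm (x i) * norm (y i))) + real (card A) * ln 2"
    using assms by (intro log_plus_sum) auto
  also have "\<dots> \<le> (\<Sum>i\<in>A. log_plus (norm (x i)) + log_plus (norm (y i))) + real (card A) * ln 2"
    by (intro add_right_mono sum_mono log_plus_mult) auto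
  finally show ?thesis .
qed

lemma entire_nevanlinna_T:
  assumes "f holomorphic_on UNIV"
  shows "nevanlinna_T r f = nevanlinna_m r f"
proof -
  have "\<not> is_pole f z" for z by (rule analytic_at_imp_no_pole[OF entire_analytic[OF assms]])
  hence "pole_count f = (\<lambda>_. 0)" unfolding pole_count_def by auto
  thus ?thesis by (simp add: nevanlinna_T_def nevanlinna_N_def integrated_counting_def)
qed

section \<open>Asymptotics along a sequence of radii\<close>

text \<open>Upper bounds only: these are one-sided versions of \<open>O(u)\<close> and \<open>o(u)\<close>.\<close>

definition bounded_along :: "nat filter \<Rightarrow> (nat \<Rightarrow> real) \<Rightarrow> (nat \<Rightarrow> real) \<Rightarrow> bool" where
  "bounded_along \<F> u h \<longleftrightarrow> (\<exists>C. \<forall>\<^sub>F k in \<F>. h k \<le> C * u k)"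

definition negligible_along :: "nat filter \<Rightarrow> (nat \<Rightarrow> real) \<Rightarrow> (nat \<Rightarrow> real) \<Rightarrow> bool" where
  "negligible_along \<F> u h \<longleftrightarrow> (\<forall>\<epsilon>>0. \<forall>\<^sub>F k in \<F>. h k \<le> \<epsilon> * u k)"

locale unbounded_scale =
  fixes \<F> :: "nat filter" and u :: "nat \<Rightarrow> real"
  assumes scale_at_top: "filterlim u at_top \<F>"
begin

abbreviation "bnd \<equiv> bounded_along \<F> u"
abbreviation "negl \<equiv> negligible_along \<F> u"

lemma scale_ge: "\<forall>\<^sub>F k in \<F>. u k \<ge> M"
  using scale_at_top by (auto simp: filterlim_at_top)

lemma bnd_mono: "bnd h \<Longrightarrow> \<forall>\<^sub>F k in \<F>. h' k \<le> h k \<Longrightarrow> bnd h'"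
  unfolding bounded_along_def by (elim exE, rule exI) (rule eventually_elim2, assumption+, rule order_trans)

lemma negl_mono:
  assumes "negl h" "\<forall>\<^sub>F k in \<F>. h' k \<le> h k"
  shows "negl h'"
  unfolding negligible_along_def
proof (intro allI impI)
  fix \<epsilon> :: real assume "\<epsilon> > 0"
  with assms(1) have "\<forall>\<^sub>F k in \<F>. h k \<le> \<epsilon> * u k" by (simp add: negligible_along_def)
  with assms(2) show "\<forall>\<^sub>F k in \<F>. h' k \<le> \<epsilon> * u k" by eventually_elim simp
qed

lemma negl_const: "negl (\<lambda>_. C)"
  unfolding negligible_along_def
proof (intro allI impI)
  fix \<epsilon> :: real assume \<epsilon>: "\<epsilon> > 0"
  show "\<forall>\<^sub>F k in \<F>. C \<le> \<epsilon> * u k"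
    using scale_ge[of "C / \<epsilon>"] by eventually_elim (use \<epsilon> in \<open>simp add: field_simps\<close>)
qed

lemma negl_imp_bnd: "negl h \<Longrightarrow> bnd h"
  unfolding negligible_along_def bounded_along_def by (metis zero_less_one)

lemma bnd_const: "bnd (\<lambda>_. C)" by (rule negl_imp_bnd[OF negl_const])

lemma bnd_add:
  assumes "bnd h" "bnd h'" shows "bnd (\<lambda>k. h k + h' k)"
proof -
  obtain C C' where "\<forall>\<^sub>F k in \<F>. h k \<le> C * u k" "\<forall>\<^sub>F k in \<F>. h' k \<le> C' * u k"
    using assms by (auto simp: bounded_along_def)
  hence "\<forall>\<^sub>F k in \<F>. h k + h' k \<le> (C + C') * u k" by eventually_elim (simp add: distrib_right)
  thus ?thesis unfolding bounded_along_def by blast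
qed

lemma negl_add:
  assumes "negl h" "negl h'" shows "negl (\<lambda>k. h k + h' k)"
  unfolding negligible_along_def
proof (intro allI impI)
  fix \<epsilon> :: real assume "\<epsilon> > 0"
  hence "\<epsilon> / 2 > 0" by simp
  hence "\<forall>\<^sub>F k in \<F>. h k \<le> \<epsilon> / 2 * u k" "\<forall>\<^sub>F k in \<F>. h' k \<le> \<epsilon> / 2 * u k"
    using assms unfolding negligible_along_def by blast+
  thus "\<forall>\<^sub>F k in \<F>. h k + h' k \<le> \<epsilon> * u k" by eventually_elim simp
qed

lemma bnd_cmult:
  assumes "bnd h" "c \<ge> 0" shows "bnd (\<lambda>k. c * h k)"
proof -
  obtain C where "\<forall>\<^sub>F k in \<F>. h k \<le> C * u k" using assms by (auto simp: bounded_along_def)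
  hence "\<forall>\<^sub>F k in \<F>. c * h k \<le> (c * C) * u k"
    by eventually_elim (use assms(2) in \<open>simp add: mult.assoc mult_left_mono\<close>)
  thus ?thesis unfolding bounded_along_def by blast
qed

lemma negl_cmult:
  assumes "negl h" "c \<ge> 0" shows "negl (\<lambda>k. c * h k)"
proof (cases "c = 0")
  case True
  thus ?thesis using negl_const[of 0] by simp
next
  case False
  show ?thesis unfolding negligible_along_def
  proof (intro allI impI)
    fix \<epsilon> :: real assume "\<epsilon> > 0"
    hence "\<epsilon> / c > 0" using assms(2) False by simp
    hence "\<forall>\<^sub>F k in \<F>. h k \<le> \<epsilon> / c * u k" using assms unfolding negligible_along_def by blast
    thus "\<forall>\<^sub>F k in \<F>. c * h k \<le> \<epsilon> * u k"
      by eventually_elim (use assms(2) False in \<open>simp add: field_simps\<close>)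
  qed
qed

lemma bnd_sum:
  assumes "finite A" "\<And>i. i \<in> A \<Longrightarrow> bnd (h i)" shows "bnd (\<lambda>k. \<Sum>i\<in>A. h i k)"
  using assms by (induction A rule: finite_induct) (auto intro: bnd_add bnd_const)

lemma negl_sum:
  assumes "finite A" "\<And>i. i \<in> A \<Longrightarrow> negl (h i)" shows "negl (\<lambda>k. \<Sum>i\<in>A. h i k)"
  using assms by (induction A rule: finite_induct) (auto intro: negl_add negl_const)

text \<open>This is how the bounds of the form const * \<open>nevanlinna_bound\<close> / sqrt R
  become o(u): linear dependence on the characteristic is compensated by the diverging square
  root.\<close>

lemma negl_divide:
  assumes h: "bnd h" and c: "c \<ge> 0" and t: "filterlim t at_top \<F>"
  shows "negl (\<lambda>k. c * h k / sqrt (t k))"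
  unfolding negligible_along_def
proof (intro allI impI)
  fix \<epsilon> :: real assume \<epsilon>: "\<epsilon> > 0"
  obtain C where C: "\<forall>\<^sub>F k in \<F>. h k \<le> C * u k" using h by (auto simp: bounded_along_def)
  have "filterlim (\<lambda>k. sqrt (t k)) at_top \<F>"
    by (rule filterlim_compose[OF sqrt_at_top t])
  hence "\<forall>\<^sub>F k in \<F>. sqrt (t k) \<ge> max 1 (c * C / \<epsilon>)" unfolding filterlim_at_top by blast
  with C scale_ge[of 0] show "\<forall>\<^sub>F k in \<F>. c * h k / sqrt (t k) \<le> \<epsilon> * u k"
  proof eventually_elim
    case (elim k)
    have "c * h k \<le> c * (C * u k)" using elim c by (intro mult_left_mono) auto
    also have "\<dots> = (c * C / \<epsilon>) * (\<epsilon> * u k)" using \<epsilon> by simp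
    also have "\<dots> \<le> sqrt (t k) * (\<epsilon> * u k)" using elim \<epsilon> by (intro mult_right_mono) auto
    finally show ?case using elim by (simp add: divide_le_eq mult.commute)
  qed
qed

text \<open>Eventually u <= u / 2 and u >= 1. The conclusion concerns the filter, because on a
  trivial filter this is no contradiction.\<close>

lemma negl_self_contradiction: "negl u \<Longrightarrow> \<F> = bot"
proof -
  assume "negl u"
  hence "\<forall>\<^sub>F k in \<F>. u k \<le> 1 / 2 * u k" unfolding negligible_along_def by (auto dest: spec[of _ "1/2"])
  with scale_ge[of 1] have "\<forall>\<^sub>F k in \<F>. False" by eventually_elim auto
  thus ?thesis by (simp add: trivial_limit_def)
qed

end

text \<open>Doubling turns the radii 2 r and 4 r of the estimates into the indices k + 1 and k + 2.
  The filter may be finer than \<open>sequentially\<close>, since regular growth is available only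
  on a subset of the indices.\<close>

locale meromorphic_along = unbounded_scale +
  fixes rad :: "nat \<Rightarrow> real"
  assumes rad_Suc: "rad (Suc k) = 2 * rad k" and rad_ge_1: "rad k \<ge> 1"
    and along: "\<F> \<le> sequentially"
begin

lemma rad_pos: "rad k > 0" using rad_ge_1[of k] by simp

lemma rad_at_top: "filterlim (\<lambda>k. rad (k + j)) at_top \<F>"
proof -
  have "rad 0 * 2 ^ k = rad k" for k by (induction k) (auto simp: rad_Suc)
  hence "filterlim rad at_top sequentially"
    using filterlim_scale[OF rad_pos[of 0]] by (simp only:)
  hence "filterlim (\<lambda>k. rad (k + j)) at_top sequentially"
    by (rule filterlim_compose) (rule filterlim_add_const_nat_at_top)
  thus ?thesis by (rule filterlim_mono) (use along in auto)
qed

definition circ :: "(complex \<Rightarrow> complex) \<Rightarrow> bool" where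
  "circ F \<longleftrightarrow> (\<forall>k. regular_circle F (rad k))"

lemma circD: "circ F \<Longrightarrow> regular_circle F (rad k)" by (simp add: circ_def)

lemma bnd_nevanlinna_bound:
  assumes "\<And>j. j \<in> {1, 2} \<Longrightarrow> bnd (\<lambda>k. nevanlinna_T (rad (k + j)) F)"
  shows "bnd (\<lambda>k. nevanlinna_bound F (rad (Suc k)))"
  unfolding nevanlinna_bound_def
  using assms[of 1] assms[of 2] by (intro bnd_add bnd_const) (simp_all add: rad_Suc)

lemma negl_logarithmic_derivative:
  assumes F: "nonzero_meromorphic F" "circ F"
    and bd: "\<And>j. j \<in> {1, 2} \<Longrightarrow> bnd (\<lambda>k. nevanlinna_T (rad (k + j)) F)"
  shows "negl (\<lambda>k. nevanlinna_m (rad k) (\<lambda>z. deriv F z / F z))"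
proof (rule negl_mono)
  show "negl (\<lambda>k. 400 * nevanlinna_bound F (rad (Suc k)) / sqrt (rad (k + 1)))"
    by (intro negl_divide bnd_nevanlinna_bound bd rad_at_top) auto
  have "nevanlinna_m (rad k) (\<lambda>z. deriv F z / F z) \<le> 400 * nevanlinna_bound F (rad (Suc k)) / sqrt (rad (Suc k))" for k
    using circD[OF F(2)] rad_ge_1[of "Suc k"] rad_Suc[of k] rad_Suc[of "Suc k"]
    by (intro logarithmic_derivative_estimate F) metis+
  thus "\<forall>\<^sub>F k in \<F>. nevanlinna_m (rad k) (\<lambda>z. deriv F z / F z) \<le>
      400 * nevanlinna_bound F (rad (Suc k)) / sqrt (rad (k + 1))" by simp
qed

lemma negl_difference_quotient:
  assumes f: "f holomorphic_on UNIV" "nonzero_meromorphic f" "circ f"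
    and bd: "\<And>j. j \<in> {1, 2} \<Longrightarrow> bnd (\<lambda>k. nevanlinna_T (rad (k + j)) f)"
  shows "negl (\<lambda>k. nevanlinna_m (rad k) (\<lambda>z. f (z + d) / f z))"
proof (rule negl_mono)
  show "negl (\<lambda>k. (400 * (1 + norm d)) * nevanlinna_bound f (rad (Suc k)) / sqrt (rad (k + 1)))"
    by (intro negl_divide bnd_nevanlinna_bound bd rad_at_top) auto
  have "\<forall>\<^sub>F k in \<F>. rad (k + 1) \<ge> 4 * norm d"
    using rad_at_top[of 1] unfolding filterlim_at_top by blast
  thus "\<forall>\<^sub>F k in \<F>. nevanlinna_m (rad k) (\<lambda>z. f (z + d) / f z) \<le>
      (400 * (1 + norm d)) * nevanlinna_bound f (rad (Suc k)) / sqrt (rad (k + 1))"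
  proof eventually_elim
    case (elim k)
    have "nevanlinna_m (rad k) (\<lambda>z. f (z + d) / f z) \<le>
        400 * (1 + norm d) * nevanlinna_bound f (rad (Suc k)) / sqrt (rad (Suc k))"
    proof (rule difference_quotient_estimate[OF f(1,2) circD[OF f(3)] circD[OF f(3)]])
      show "regular_circle f (2 * rad (Suc k))" using circD[OF f(3), of "Suc (Suc k)"] by (simp add: rad_Suc)
    qed (use elim rad_ge_1[of "Suc k"] rad_Suc[of k] in auto)
    thus ?case by simp
  qed
qed

end

section \<open>The auxiliary function\<close>

text \<open>\<open>L_nonzero\<close> excludes a case where a solution exists: for
  \<open>f = exp\<close> and a difference operator annihilating it, the equation reads f ^ m = p,
  which holds for the zero-free p = exp (m z).\<close>

locale difference_equation =
  fixes f q :: "complex \<Rightarrow> complex" and a :: "nat \<Rightarrow> complex" and c :: complex and \<tau> m n :: nat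
  assumes f: "f holomorphic_on UNIV" "nonzero_meromorphic f"
    and q: "nonzero_meromorphic q"
    and L_nonzero: "\<exists>z. linear_difference a \<tau> c f z \<noteq> 0"
    and n: "n > 0" and mn: "m \<ge> n + 2"
begin

definition L :: "complex \<Rightarrow> complex" where "L = linear_difference a \<tau> c f"

definition P :: "complex \<Rightarrow> complex" where "P z = f z ^ m + q z * L z ^ n"

definition \<phi> :: "complex \<Rightarrow> complex" where
  "\<phi> z = of_nat m * deriv f z - deriv P z / P z * f z"

lemma L_eq: "L z = (\<Sum>j\<le>\<tau>. a j * f (z + of_nat j * c))"
  by (simp add: L_def linear_difference_def)

lemma L_holomorphic: "L holomorphic_on UNIV"
proof -
  have "(\<lambda>z. f (z + d)) holomorphic_on UNIV" for d
  proof -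
    have "(\<lambda>z. z + d) holomorphic_on UNIV" by (intro holomorphic_intros)
    from holomorphic_on_compose_gen[OF this f(1)] show ?thesis by (simp add: o_def)
  qed
  thus ?thesis unfolding L_eq[abs_def] by (intro holomorphic_intros)
qed

lemma L_nonzero_meromorphic: "nonzero_meromorphic L"
  using L_nonzero entire_nonzero_meromorphic[OF L_holomorphic] by (auto simp: L_def)

lemma P_meromorphic: "P meromorphic_on UNIV"
  using f(2) q L_nonzero_meromorphic unfolding P_def[abs_def] nonzero_meromorphic_def
  by (intro meromorphic_intros) auto

lemma \<phi>_meromorphic: "\<phi> meromorphic_on UNIV"
  using f(2) P_meromorphic unfolding \<phi>_def[abs_def] nonzero_meromorphic_def
  by (intro meromorphic_intros) auto

lemma f_analytic: "f analytic_on S" by (rule entire_analytic[OF f(1)])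
lemma L_analytic: "L analytic_on S" by (rule entire_analytic[OF L_holomorphic])

text \<open>The right-hand side of the first identity is, up to sign, the numerator of the
  derivative of P / f ^ m. This makes P / f ^ m constant in the degenerate case
  \<open>\<phi> = 0\<close>; the second identity serves \<open>\<phi>_identity\<close>.\<close>

lemma deriv_P:
  assumes "q analytic_on {z}" "f z \<noteq> 0"
  shows "P z \<noteq> 0 \<Longrightarrow> f z ^ (m - 1) * \<phi> z * P z = 
     P z * (of_nat m * f z ^ (m - 1) * deriv f z) - deriv P z * f z ^ m"
    and "deriv P z = of_nat m * f z ^ (m - 1) * deriv f z + deriv q z * L z ^ n + of_nat n * q z * L z ^ (n - 1) * deriv L z"
proof -
  have m: "m = Suc (m - 1)" using mn by simp
  have fd: "(f has_field_derivative deriv f z) (at z)" "(L has_field_derivative deriv L z) (at z)"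
     "(q has_field_derivative deriv q z) (at z)"
    using assms f_analytic L_analytic analytic_derivI by blast+
  have "(P has_field_derivative of_nat m * f z ^ (m - 1) * deriv f z + deriv q z * L z ^ n + of_nat n * q z * L z ^ (n - 1) * deriv L z) (at z)"
    unfolding P_def[abs_def] using fd
    by (auto intro!: derivative_eq_intros simp: algebra_simps)
  thus "deriv P z = of_nat m * f z ^ (m - 1) * deriv f z + deriv q z * L z ^ n + of_nat n * q z * L z ^ (n - 1) * deriv L z"
    by (rule DERIV_imp_deriv)
  have "f z ^ m = f z * f z ^ (m - 1)" by (subst m) simp
  thus "f z ^ (m - 1) * \<phi> z * P z = 
     P z * (of_nat m * f z ^ (m - 1) * deriv f z) - deriv P z * f z ^ m" if "P z \<noteq> 0"
    using that by (simp add: \<phi>_def field_simps)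
qed

lemma \<phi>_identity:
  assumes "regular_at f z" "regular_at q z" "regular_at L z" "P z \<noteq> 0"
  shows "f z ^ (m - 1) * \<phi> z = q z * L z ^ n *
     (deriv P z / P z - deriv q z / q z - of_nat n * (deriv L z / L z))"
proof -
  have nz: "f z \<noteq> 0" "q z \<noteq> 0" "L z \<noteq> 0" and an: "q analytic_on {z}"
    using assms by (auto simp: regular_at_def)
  have m: "f z ^ m = f z * f z ^ (m - 1)" using mn by (cases m) auto
  have l: "L z ^ n = L z * L z ^ (n - 1)" using n by (cases n) auto
  have "f z ^ (m - 1) * \<phi> z = of_nat m * f z ^ (m - 1) * deriv f z - deriv P z / P z * f z ^ m"
    by (simp add: \<phi>_def m algebra_simps)
  also have "of_nat m * f z ^ (m - 1) * deriv f z = deriv P z - deriv q z * L z ^ n - of_nat n * q z * L z ^ (n - 1) * deriv L z"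
    using deriv_P(2)[OF an nz(1)] by simp
  also have "f z ^ m = P z - q z * L z ^ n" by (simp add: P_def)
  also have "deriv P z - deriv q z * L z ^ n - of_nat n * q z * L z ^ (n - 1) * deriv L z - deriv P z / P z * (P z - q z * L z ^ n)
      = deriv P z / P z * (q z * L z ^ n) - deriv q z * L z ^ n - of_nat n * q z * L z ^ (n - 1) * deriv L z"
    using assms(4) by (simp add: field_simps)
  also have "\<dots> = q z * L z ^ n * (deriv P z / P z - deriv q z / q z - of_nat n * (deriv L z / L z))"
    using nz by (simp add: l field_simps)
  finally show ?thesis .
qed

lemma log_plus_L_over_f:
  "log_plus (norm (L z / f z)) \<le>
    (\<Sum>j\<le>\<tau>. log_plus (norm (a j)) + log_plus (norm (f (z + of_nat j * c) / f z))) + real (Suc \<tau>) * ln 2"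
  using log_plus_norm_sum_mult[of "{..\<tau>}" a "\<lambda>j. f (z + of_nat j * c) / f z"]
  by (simp add: L_eq sum_divide_distrib)

abbreviation shift_sum :: "complex \<Rightarrow> real" where
  "shift_sum z \<equiv> \<Sum>j\<le>\<tau>. log_plus (norm (f (z + of_nat j * c) / f z))"

text \<open>Every summand is constant or has circle mean o(T), and a single function serves both
  \<open>\<phi>\<close> and \<open>f * \<phi>\<close>, for large and for small values of
  \<open>f\<close>.\<close>

definition majorant :: "complex \<Rightarrow> real" where
  "majorant z = log_plus (norm (q z)) + 2 * log_plus (norm (deriv P z / P z)) + log_plus (norm (deriv f z / f z)) +
     log_plus (norm (deriv q z / q z)) + log_plus (norm (deriv L z / L z)) +
     real n * shift_sum z +
     (log_plus (real m) + log_plus (real n) + real n * ((\<Sum>j\<le>\<tau>. log_plus (norm (a j))) + real (Suc \<tau>) * ln 2) + 2 * ln 2)"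

text \<open>
  Where \<open>\<bar>f z\<bar> \<ge> 1\<close>, divide the identity for \<open>f\<^sup>m\<^sup>-\<^sup>1 \<phi>\<close> by \<open>f\<^sup>m\<^sup>-\<^sup>2\<close> and use \<open>m - 2 \<ge> n\<close>; where
  \<open>\<bar>f z\<bar> < 1\<close>, use \<open>\<phi> = f (m f'/f - P'/P)\<close> directly.
\<close>

lemma majorant:
  assumes reg: "regular_at f z" "regular_at q z" "regular_at L z" "P z \<noteq> 0"
  shows "log_plus (norm (\<phi> z)) \<le> majorant z" "log_plus (norm (f z * \<phi> z)) \<le> majorant z"
proof -
  have fz: "f z \<noteq> 0" using reg by (simp add: regular_at_def)
  let ?H = "deriv P z / P z" and ?Q = "deriv q z / q z" and ?Y = "deriv L z / L z"
  have S0: "0 \<le> (\<Sum>j\<le>\<tau>. log_plus (norm (a j)))" "0 \<le> shift_sum z"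
    by (auto intro!: sum_nonneg)
  have ln2: "ln 2 \<ge> (0::real)" by simp
  have "log_plus (norm (\<phi> z)) \<le> majorant z \<and> log_plus (norm (f z * \<phi> z)) \<le> majorant z"
  proof (cases "norm (f z) \<ge> 1")
    case True
    \<comment> \<open>Here m >= n + 2 enters: n powers of \<open>f\<close> are divided into
      \<open>L ^ n\<close>, and the exponent m - n - 1 >= 1 leaves the factor for
      \<open>f * \<phi>\<close>; as |f| >= 1, further powers may be dropped.\<close>
    have m1: "m - 1 = n + (m - n - 1)" "m - n - 1 = Suc (m - n - 2)" using mn by auto
    have "norm (f z) * norm (\<phi> z) * norm (f z) ^ n \<le> norm (f z) ^ (m - n - 1) * norm (\<phi> z) * norm (f z) ^ n"
    proof -
      have "norm (f z) ^ 1 \<le> norm (f z) ^ (m - n - 1)" using True mn by (intro power_increasing) auto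
      thus ?thesis by (intro mult_right_mono) auto
    qed
    also have "\<dots> = norm (f z ^ (m - 1) * \<phi> z)"
      by (subst m1(1)) (simp add: norm_mult norm_power power_add)
    also have "\<dots> = norm (q z) * norm (L z) ^ n * norm (?H - ?Q - of_nat n * ?Y)"
      unfolding \<phi>_identity[OF reg] by (simp add: norm_mult norm_power)
    finally have "norm (f z * \<phi> z) \<le> norm (q z) * norm (L z) ^ n * norm (?H - ?Q - of_nat n * ?Y) / norm (f z) ^ n"
      using fz by (subst pos_le_divide_eq) (auto simp: norm_mult)
    also have "\<dots> = norm (q z) * (norm (L z / f z) ^ n * norm (?H - ?Q - of_nat n * ?Y))"
      by (simp add: norm_divide power_divide)
    finally have le: "log_plus (norm (f z * \<phi> z)) \<le> log_plus \<dots>" by (rule log_plus_mono)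
    also have "\<dots> \<le> log_plus (norm (q z)) + log_plus (norm (L z / f z) ^ n * norm (?H - ?Q - of_nat n * ?Y))"
      by (intro log_plus_mult) auto
    also have "log_plus (norm (L z / f z) ^ n * norm (?H - ?Q - of_nat n * ?Y)) \<le>
        log_plus (norm (L z / f z) ^ n) + log_plus (norm (?H - ?Q - of_nat n * ?Y))"
      by (intro log_plus_mult) auto
    also have "log_plus (norm (L z / f z) ^ n) = real n * log_plus (norm (L z / f z))"
      by (intro log_plus_power) auto
    also have "real n * log_plus (norm (L z / f z)) \<le> real n * ((\<Sum>j\<le>\<tau>. log_plus (norm (a j))) +
        shift_sum z + real (Suc \<tau>) * ln 2)"
      using log_plus_L_over_f[of z] by (intro mult_left_mono) (auto simp: sum.distrib)
    also have "log_plus (norm (?H - ?Q - of_nat n * ?Y)) \<le> log_plus (norm ?H + (norm ?Q + real n * norm ?Y))"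
    proof (rule log_plus_mono)
      have "norm (?H - ?Q - of_nat n * ?Y) \<le> norm (?H - ?Q) + norm (of_nat n * ?Y)" by (rule norm_triangle_ineq4)
      moreover have "norm (?H - ?Q) \<le> norm ?H + norm ?Q" by (rule norm_triangle_ineq4)
      moreover have "norm (of_nat n * ?Y) = real n * norm ?Y" by (simp only: norm_mult norm_of_nat)
      ultimately show "norm (?H - ?Q - of_nat n * ?Y) \<le> norm ?H + (norm ?Q + real n * norm ?Y)" by linarith
    qed
    also have "\<dots> \<le> log_plus (norm ?H) + (log_plus (norm ?Q) + (log_plus (real n) + log_plus (norm ?Y)) + ln 2) + ln 2"
    proof -
      have "log_plus (norm ?H + (norm ?Q + real n * norm ?Y)) \<le> log_plus (norm ?H) + log_plus (norm ?Q + real n * norm ?Y) + ln 2"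
        by (intro log_plus_add add_nonneg_nonneg) auto
      moreover have "log_plus (norm ?Q + real n * norm ?Y) \<le> log_plus (norm ?Q) + log_plus (real n * norm ?Y) + ln 2"
        by (intro log_plus_add) auto
      moreover have "log_plus (real n * norm ?Y) \<le> log_plus (real n) + log_plus (norm ?Y)"
        by (intro log_plus_mult) auto
      ultimately show ?thesis by linarith
    qed
    finally have 1: "log_plus (norm (f z * \<phi> z)) \<le> majorant z"
      using log_plus_nonneg[of "norm ?H"] log_plus_nonneg[of "norm (deriv f z / f z)"] log_plus_nonneg[of "real m"]
      unfolding majorant_def distrib_left by linarith
    have "1 * norm (\<phi> z) \<le> norm (f z) * norm (\<phi> z)" using True by (intro mult_right_mono) auto
    hence "log_plus (norm (\<phi> z)) \<le> log_plus (norm (f z * \<phi> z))" by (intro log_plus_mono) (simp add: norm_mult)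
    with 1 show ?thesis by simp
  next
    case False
    have eq: "\<phi> z = f z * (of_nat m * (deriv f z / f z) - ?H)" using fz by (simp add: \<phi>_def field_simps)
    have "norm (\<phi> z) \<le> 1 * norm (of_nat m * (deriv f z / f z) - ?H)"
      unfolding eq norm_mult using False by (intro mult_right_mono) auto
    also have "\<dots> \<le> real m * norm (deriv f z / f z) + norm ?H"
      using norm_triangle_ineq4[of "of_nat m * (deriv f z / f z)" ?H]
      by (simp only: norm_mult norm_of_nat mult_1)
    finally have A: "norm (\<phi> z) \<le> real m * norm (deriv f z / f z) + norm ?H" .
    have "norm (f z * \<phi> z) \<le> 1 * norm (\<phi> z)" unfolding norm_mult using False by (intro mult_right_mono) auto
    with A have B: "norm (f z * \<phi> z) \<le> real m * norm (deriv f z / f z) + norm ?H" by simp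
    have "log_plus (real m * norm (deriv f z / f z) + norm ?H) \<le> log_plus (real m * norm (deriv f z / f z)) + log_plus (norm ?H) + ln 2"
      by (intro log_plus_add) auto
    also have "log_plus (real m * norm (deriv f z / f z)) \<le> log_plus (real m) + log_plus (norm (deriv f z / f z))"
      by (intro log_plus_mult) auto
    finally have le: "log_plus (real m * norm (deriv f z / f z) + norm ?H) \<le>
        log_plus (real m) + log_plus (norm (deriv f z / f z)) + log_plus (norm ?H) + ln 2" by simp
    have "0 \<le> real n * shift_sum z"
      by (intro mult_nonneg_nonneg S0(2)) auto
    moreover have "0 \<le> real n * ((\<Sum>j\<le>\<tau>. log_plus (norm (a j))) + real (Suc \<tau>) * ln 2)"
      by (intro mult_nonneg_nonneg add_nonneg_nonneg S0(1) ln2) auto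
    ultimately have "log_plus (real m * norm (deriv f z / f z) + norm ?H) \<le> majorant z"
      using le ln2 log_plus_nonneg[of "norm ?H"] log_plus_nonneg[of "norm (q z)"] log_plus_nonneg[of "norm ?Q"]
        log_plus_nonneg[of "norm ?Y"] log_plus_nonneg[of "real n"]
      unfolding majorant_def by linarith
    thus ?thesis using log_plus_mono[OF A] log_plus_mono[OF B] by linarith
  qed
  thus "log_plus (norm (\<phi> z)) \<le> majorant z" "log_plus (norm (f z * \<phi> z)) \<le> majorant z" by auto
qed

text \<open>\<open>f\<close> and \<open>L\<close> are entire, so a power of w - b that compensates
  the pole of \<open>q\<close> gives \<open>P\<close> a finite limit as well.\<close>

lemma zorder_P_ge:
  assumes P: "nonzero_meromorphic P" and "zorder P b < 0"
  shows "zorder P b \<ge> zorder q b"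
proof -
  define N where "N = nat (- zorder q b)"
  have "zorder q b \<ge> - int N" by (simp add: N_def)
  then obtain l where l: "((\<lambda>w. q w * (w - b) ^ N) \<longlongrightarrow> l) (at b)"
    using tendsto_of_zorder_ge[OF q] by blast
  have "isCont f b" "isCont L b"
    using f_analytic L_analytic analytic_at_imp_isCont by blast+
  hence fL: "f \<midarrow>b\<rightarrow> f b" "L \<midarrow>b\<rightarrow> L b" by (auto simp: isCont_def)
  have "((\<lambda>w. f w ^ m * (w - b) ^ N + q w * (w - b) ^ N * L w ^ n) \<longlongrightarrow> f b ^ m * (b - b) ^ N + l * L b ^ n) (at b)"
    by (intro tendsto_intros fL l)
  hence "((\<lambda>w. P w * (w - b) ^ N) \<longlongrightarrow> f b ^ m * (b - b) ^ N + l * L b ^ n) (at b)"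
    by (simp add: P_def algebra_simps)
  \<comment> \<open>If \<open>q\<close> has no pole at b, then N = 0 and the bound contradicts the
    assumption that \<open>P\<close> has one.\<close>
  from zorder_ge_of_tendsto[OF P this] show ?thesis using assms(2) by (auto simp: N_def split: if_splits)
qed

text \<open>Writing P = h * (w - b)^k with h b nonzero gives P' / P = h' / h + k / (w - b). The
  singular part is at most a simple pole and disappears for k = 0, and \<open>f\<close> is
  entire.\<close>

lemma zorder_\<phi>_ge:
  assumes P: "nonzero_meromorphic P" and \<phi>: "nonzero_meromorphic \<phi>"
  shows "zorder \<phi> b \<ge> - 1" "zorder P b = 0 \<Longrightarrow> zorder \<phi> b \<ge> 0"
proof -
  define h where "h = zor_poly P b"
  define k where "k = zorder P b"
  obtain r where r: "h b \<noteq> 0" "r > 0" "h holomorphic_on cball b r"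
     "\<And>w. w \<in> cball b r - {b} \<Longrightarrow> P w = h w * (w - b) powi k \<and> h w \<noteq> 0"
    using zorder_exist[OF nonzero_meromorphic_at(2,3,5)[OF P], of b] unfolding h_def k_def by blast
  have hol: "h holomorphic_on ball b r" using r(3) by (rule holomorphic_on_subset) auto
  have ev: "\<forall>\<^sub>F w in at b. w \<in> ball b r - {b}" using r(2) by (intro eventually_at_in_open) auto
  have eq: "\<phi> w = of_nat m * deriv f w - deriv h w / h w * f w - of_int k / (w - b) * f w" if w: "w \<in> ball b r - {b}" for w
  proof -
    have wb: "w - b \<noteq> 0" and hw: "h w \<noteq> 0" using w r(4)[of w] by auto
    have hd: "(h has_field_derivative deriv h w) (at w)" using hol w by (intro holomorphic_derivI) auto
    have "((\<lambda>x. x - b) has_derivative (\<lambda>x. x)) (at w)" by (auto intro!: derivative_eq_intros)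
    from has_derivative_power_int[of "\<lambda>x. x - b", OF wb this, of k]
    have "((\<lambda>x. (x - b) powi k) has_field_derivative of_int k * (w - b) powi (k - 1)) (at w)"
      unfolding has_field_derivative_def by (rule has_derivative_eq_rhs) (auto simp: fun_eq_iff mult.commute)
    from DERIV_mult[OF hd this]
    have d: "((\<lambda>x. h x * (x - b) powi k) has_field_derivative
        deriv h w * (w - b) powi k + of_int k * (w - b) powi (k - 1) * h w) (at w)" .
    have "\<forall>\<^sub>F x in nhds w. x \<in> ball b r - {b}" using w by (intro eventually_nhds_in_open) auto
    hence "\<forall>\<^sub>F x in nhds w. P x = h x * (x - b) powi k" by eventually_elim (use r(4) in auto)
    hence "deriv P w = deriv (\<lambda>x. h x * (x - b) powi k) w" by (intro deriv_cong_ev) auto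
    also have "\<dots> = deriv h w * (w - b) powi k + of_int k * (w - b) powi (k - 1) * h w"
      using d by (rule DERIV_imp_deriv)
    finally have "deriv P w / P w = deriv h w / h w + of_int k / (w - b)"
    proof -
      assume dP: "deriv P w = deriv h w * (w - b) powi k + of_int k * (w - b) powi (k - 1) * h w"
      have "(d * E + K * (E / v) * H) / (H * E) = d / H + K / v" if "E \<noteq> 0" "v \<noteq> 0" "H \<noteq> 0"
        for d E K v H :: complex using that by (simp add: field_simps)
      moreover have "P w = h w * (w - b) powi k" using r(4)[of w] w by auto
      ultimately show ?thesis
        unfolding dP using wb hw by (simp add: power_int_diff power_int_eq_0_iff)
    qed
    thus ?thesis by (simp add: \<phi>_def algebra_simps)
  qed
  have cont: "isCont (deriv f) b" "isCont f b" "isCont h b" "isCont (deriv h) b"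
  proof -
    show "isCont (deriv f) b" "isCont f b"
      using f_analytic[of "{b}"] by (auto intro: analytic_at_imp_isCont analytic_deriv)
    have "h analytic_on {b}" using hol r(2) by (meson analytic_at centre_in_ball open_ball)
    thus "isCont h b" "isCont (deriv h) b" by (auto intro: analytic_at_imp_isCont analytic_deriv)
  qed
  define G where "G = (\<lambda>w. of_nat m * deriv f w - deriv h w / h w * f w)"
  have G: "G \<midarrow>b\<rightarrow> G b" using cont r(1) unfolding G_def isCont_def by (intro tendsto_intros) auto
  have "((\<lambda>w. G w * (w - b) - of_int k * f w) \<longlongrightarrow> G b * (b - b) - of_int k * f b) (at b)"
    using G cont(2) unfolding isCont_def by (intro tendsto_intros)
  moreover have "\<forall>\<^sub>F w in at b. G w * (w - b) - of_int k * f w = \<phi> w * (w - b) ^ 1"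
    using ev by eventually_elim (auto simp: eq G_def field_simps)
  ultimately have "((\<lambda>w. \<phi> w * (w - b) ^ 1) \<longlongrightarrow> G b * (b - b) - of_int k * f b) (at b)"
    by (rule Lim_transform_eventually)
  from zorder_ge_of_tendsto[OF \<phi> this] show "zorder \<phi> b \<ge> - 1" by simp
  assume "zorder P b = 0"
  hence "k = 0" by (simp add: k_def)
  have "\<forall>\<^sub>F w in at b. G w = \<phi> w * (w - b) ^ 0"
    using ev by eventually_elim (auto simp: eq G_def \<open>k = 0\<close>)
  with G have "((\<lambda>w. \<phi> w * (w - b) ^ 0) \<longlongrightarrow> G b) (at b)" by (rule Lim_transform_eventually)
  from zorder_ge_of_tendsto[OF \<phi> this] show "zorder \<phi> b \<ge> 0" by simp
qed

lemma nevanlinna_N_P_le: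
  assumes P: "nonzero_meromorphic P" and "regular_circle P R" "regular_circle q R" "R \<ge> 1"
  shows "nevanlinna_N R P \<le> nevanlinna_N R q"
  using pole_sum_mono[OF P q assms(2-4), of "{}"] zorder_P_ge[OF P] by fastforce

text \<open>A simple pole of \<open>\<phi>\<close> costs one unit: at a zero of \<open>P\<close> it
  is paid by the distinct zeros of \<open>p\<close>, and at a pole of \<open>P\<close> by the pole
  that \<open>q\<close> then has.\<close>

lemma nevanlinna_N_\<phi>_le:
  assumes P: "nonzero_meromorphic P" and \<phi>: "nonzero_meromorphic \<phi>"
    and p: "p meromorphic_on UNIV" "\<forall>\<^sub>\<approx>z. P z = p z"
    and R: "regular_circle \<phi> R" "regular_circle q R" "R \<ge> 1"
  shows "nevanlinna_N R \<phi> \<le> nevanlinna_N_bar R (\<lambda>z. 1 / p z) + nevanlinna_N R q"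
proof -
  define A where "A = {b \<in> cball 0 R. is_pole (\<lambda>z. 1 / p z) b}"
  have fin: "finite A" unfolding A_def by (intro finite_poles meromorphic_intros p)
  have "nevanlinna_N R \<phi> \<le> (\<Sum>b\<in>A. log_weight R b) + nevanlinna_N R q"
  proof (rule pole_sum_mono[OF \<phi> q R fin])
    fix b assume b: "zorder \<phi> b < 0" "norm b < R"
    hence m1: "zorder \<phi> b = - 1" using zorder_\<phi>_ge(1)[OF P \<phi>, of b] by simp
    have "zorder P b \<noteq> 0" using zorder_\<phi>_ge(2)[OF P \<phi>, of b] b by auto
    moreover have "zorder q b < 0" if "zorder P b < 0" using zorder_P_ge[OF P that] that by simp
    moreover have "b \<in> A" if "zorder P b > 0"
      using that b is_pole_inverse_iff_zorder[OF P p(2)] by (auto simp: A_def)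
    ultimately show "- of_int (zorder \<phi> b) \<le> (if b \<in> A then 1 else 0) + max 0 (- of_int (zorder q b) :: real)"
      unfolding m1 by (cases "zorder P b > 0") (auto simp: max_def)
  qed (auto simp: A_def)
  also have "(\<Sum>b\<in>A. log_weight R b) = nevanlinna_N_bar R (\<lambda>z. 1 / p z)"
    using nevanlinna_N_bar_inverse_eq[OF p(1), of R] R by (simp add: A_def)
  finally show ?thesis .
qed

lemma proportional_case:
  assumes "\<not> nonzero_meromorphic P \<or> \<not> nonzero_meromorphic \<phi>"
  obtains \<kappa> where "\<forall>\<^sub>\<approx>z. f z ^ m = \<kappa> * q z * L z ^ n"
proof (cases "nonzero_meromorphic P")
  case False
  hence "\<forall>\<^sub>\<approx>z. P z = 0" using P_meromorphic by (simp add: nonzero_meromorphic_def)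
  hence "\<forall>\<^sub>\<approx>z. f z ^ m = (- 1) * q z * L z ^ n" by eventually_elim (simp add: P_def eq_neg_iff_add_eq_0)
  thus ?thesis by (rule that)
next
  case True
  hence "\<forall>\<^sub>\<approx>z. \<phi> z = 0" using assms \<phi>_meromorphic by (simp add: nonzero_meromorphic_def)
  with nonzero_meromorphic_regular_cosparse[OF True] nonzero_meromorphic_regular_cosparse[OF f(2)]
    nonzero_meromorphic_regular_cosparse[OF q] nonzero_meromorphic_regular_cosparse[OF L_nonzero_meromorphic]
  have ev: "\<forall>\<^sub>\<approx>z. regular_at P z \<and> regular_at f z \<and> regular_at q z \<and> regular_at L z \<and> \<phi> z = 0"
    by eventually_elim auto
  \<comment> \<open>The complement of a sparse set is open and connected, so a vanishing derivative
    makes P / f ^ m constant on all of \<Omega>.\<close>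
  define \<Omega> where "\<Omega> = {z. regular_at P z \<and> regular_at f z \<and> regular_at q z \<and> regular_at L z \<and> \<phi> z = 0}"
  have sp: "(- \<Omega>) sparse_in UNIV"
    using ev unfolding eventually_cosparse \<Omega>_def by (simp add: Collect_neg_eq[symmetric])
  have op: "open \<Omega>" using sparse_in_UNIV_imp_closed[OF sp] by (simp add: closed_def)
  have con: "connected \<Omega>" using sparse_imp_connected[OF _ connected_UNIV open_UNIV sp] by (simp add: Compl_eq_Diff_UNIV[symmetric])
  have inf: "\<Omega> \<noteq> {}"
  proof
    assume "\<Omega> = {}"
    from ev have "\<forall>\<^sub>\<approx>z::complex. False" by eventually_elim (use \<open>\<Omega> = {}\<close> in \<open>auto simp: \<Omega>_def\<close>)
    thus False by (simp add: eventually_False cosparse_eq_bot_iff')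
  qed
  have D: "((\<lambda>z. P z / f z ^ m) has_field_derivative 0) (at z)" if "z \<in> \<Omega>" for z
  proof -
    have z: "P analytic_on {z}" "P z \<noteq> 0" "f z \<noteq> 0" "q analytic_on {z}" "\<phi> z = 0"
      using that by (auto simp: \<Omega>_def regular_at_def)
    have dP: "(P has_field_derivative deriv P z) (at z)" and df: "(f has_field_derivative deriv f z) (at z)"
      using z f_analytic analytic_derivI by blast+
    have "P z * (of_nat m * f z ^ (m - 1) * deriv f z) - deriv P z * f z ^ m = 0"
      using deriv_P(1)[OF z(4,3,2)] z(5) by simp
    moreover have "((\<lambda>z. P z / f z ^ m) has_field_derivative
        (deriv P z * f z ^ m - P z * (of_nat m * f z ^ (m - 1) * deriv f z)) / (f z ^ m * f z ^ m)) (at z)"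
      using z(3) dP df by (auto intro!: derivative_eq_intros simp: algebra_simps)
    ultimately show ?thesis by (simp add: algebra_simps)
  qed
  obtain \<kappa>0 where \<kappa>0: "\<And>z. z \<in> \<Omega> \<Longrightarrow> P z / f z ^ m = \<kappa>0"
  proof (rule DERIV_zero_connected_constant[OF con op, of "{}" "\<lambda>z. P z / f z ^ m"])
    show "continuous_on \<Omega> (\<lambda>z. P z / f z ^ m)"
      using D by (meson DERIV_continuous_on has_field_derivative_at_within)
  qed (use D in auto)
  have eq: "q z * L z ^ n = (\<kappa>0 - 1) * f z ^ m" if "z \<in> \<Omega>" for z
  proof -
    have "f z \<noteq> 0" using that by (auto simp: \<Omega>_def regular_at_def)
    hence "P z = \<kappa>0 * f z ^ m" using \<kappa>0[OF that] by (simp add: field_simps)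
    thus ?thesis by (simp add: P_def algebra_simps)
  qed
  \<comment> \<open>For the value 1 the product q * L ^ n would vanish on \<Omega>, where both
    factors are nonzero.\<close>
  have "\<kappa>0 \<noteq> 1"
  proof
    assume "\<kappa>0 = 1"
    obtain z where "z \<in> \<Omega>" using inf by blast
    with eq[OF this] \<open>\<kappa>0 = 1\<close> show False by (auto simp: \<Omega>_def regular_at_def)
  qed
  have "\<forall>\<^sub>\<approx>z. f z ^ m = 1 / (\<kappa>0 - 1) * q z * L z ^ n"
    using ev
  proof eventually_elim
    case (elim z)
    hence "z \<in> \<Omega>" by (simp add: \<Omega>_def)
    thus ?case using eq \<open>\<kappa>0 \<noteq> 1\<close> by (simp add: field_simps)
  qed
  thus ?thesis by (rule that)
qed

end

section \<open>The contradiction\<close>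

text \<open>The range j <= 3 results from two steps: the logarithmic derivative of \<open>L\<close>
  at index k needs T(L) up to index k + 2, and \<open>bnd_T_L\<close> bounds this by T(f) one index
  further.\<close>

locale equation_along = difference_equation + meromorphic_along +
  assumes scale_eq: "\<And>k. u k = nevanlinna_T (rad k) f"
    and circ_f: "circ f" and circ_q: "circ q" and circ_L: "circ L"
    and bnd_T_f: "\<And>j. j \<le> 3 \<Longrightarrow> bnd (\<lambda>k. nevanlinna_T (rad (k + j)) f)"
    and bnd_T_q: "\<And>j. j \<le> 3 \<Longrightarrow> bnd (\<lambda>k. nevanlinna_T (rad (k + j)) q)"
    and negl_T_q: "negl (\<lambda>k. nevanlinna_T (rad k) q)"
begin

lemma rad_nonneg: "rad k \<ge> 0" using rad_pos[of k] by simp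

lemma negl_m_q: "negl (\<lambda>k. nevanlinna_m (rad k) q)"
  by (rule negl_mono[OF negl_T_q])
    (simp add: nevanlinna_T_def nevanlinna_N_nonneg[OF q circD[OF circ_q] rad_ge_1])

lemma bnd_T_L:
  assumes "j \<le> 2"
  shows "bnd (\<lambda>k. nevanlinna_T (rad (k + j)) L)"
proof -
  define K where "K = \<bar>ln (norm (zor_poly f 0 0))\<bar>"
  define B where "B = (\<lambda>k. (\<Sum>i\<le>\<tau>. log_plus (norm (a i)) + (50 * nevanlinna_T (rad (k + Suc j)) f + 25 * K)) + real (Suc \<tau>) * ln 2)"
  have "bnd B" unfolding B_def
    using assms by (intro bnd_add bnd_sum bnd_cmult bnd_const bnd_T_f) auto
  moreover have "\<forall>\<^sub>F k in \<F>. nevanlinna_T (rad (k + j)) L \<le> B k"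
  proof -
    have "\<forall>\<^sub>F k in \<F>. 2 * (real \<tau> * norm c) \<le> rad (k + j)"
      using rad_at_top[of j] unfolding filterlim_at_top by blast
    thus ?thesis
    proof eventually_elim
      case (elim k)
      have "log_plus (norm (L z)) \<le> B k" if z: "norm z = rad (k + j)" for z
      proof -
        have "log_plus (norm (L z)) \<le>
            (\<Sum>i\<le>\<tau>. log_plus (norm (a i)) + log_plus (norm (f (z + of_nat i * c)))) + real (Suc \<tau>) * ln 2"
          using log_plus_norm_sum_mult[of "{..\<tau>}" a "\<lambda>i. f (z + of_nat i * c)"] by (simp add: L_eq)
        also have "\<dots> \<le> B k" unfolding B_def
        proof (intro add_right_mono sum_mono add_left_mono)
          fix i assume "i \<in> {..\<tau>}"
          hence "real i * norm c \<le> real \<tau> * norm c" by (intro mult_right_mono) auto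
          \<comment> \<open>The shift has modulus at most half the radius, and 3 / 2 of one radius
            is 3 / 4 of the next, as \<open>log_plus_modulus_le\<close> requires.\<close>
          hence "norm (z + of_nat i * c) \<le> 3 / 4 * rad (k + Suc j)"
            using norm_triangle_ineq[of z "of_nat i * c"] z elim by (simp add: norm_mult rad_Suc)
          thus "log_plus (norm (f (z + of_nat i * c))) \<le> 50 * nevanlinna_T (rad (k + Suc j)) f + 25 * K"
            unfolding K_def by (intro log_plus_modulus_le f circD[OF circ_f] rad_ge_1)
        qed
        finally show ?thesis .
      qed
      hence "circle_mean (rad (k + j)) (\<lambda>z. log_plus (norm (L z))) \<le> circle_mean (rad (k + j)) (\<lambda>_. B k)"
        by (intro circle_mean_mono continuous_intros regular_circle_continuous circD[OF circ_L] rad_nonneg) auto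
      thus ?case by (simp add: entire_nevanlinna_T[OF L_holomorphic] nevanlinna_m_eq)
    qed
  qed
  ultimately show ?thesis by (rule bnd_mono)
qed

lemma m_le_T:
  assumes "nonzero_meromorphic F" "circ F"
  shows "nevanlinna_m (rad k) F \<le> nevanlinna_T (rad k) F"
  using nevanlinna_N_nonneg[OF assms(1) circD[OF assms(2)] rad_ge_1] by (simp add: nevanlinna_T_def)

text \<open>Read off from the left-hand side of the equation: the proximity function is subadditive
  up to a constant, and all poles of \<open>P\<close> come from \<open>q\<close>.\<close>

lemma bnd_T_P:
  assumes P: "nonzero_meromorphic P" "circ P" and j: "j \<le> 2"
  shows "bnd (\<lambda>k. nevanlinna_T (rad (k + j)) P)"
proof (rule bnd_mono)
  let ?B = "\<lambda>k. (real m * nevanlinna_T (rad (k + j)) f + nevanlinna_T (rad (k + j)) q +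
     real n * nevanlinna_T (rad (k + j)) L + ln 2) + nevanlinna_T (rad (k + j)) q"
  show "bnd ?B" using j by (intro bnd_add bnd_cmult bnd_const bnd_T_f bnd_T_q bnd_T_L) auto
  have "nevanlinna_T (rad i) P \<le> (real m * nevanlinna_T (rad i) f + nevanlinna_T (rad i) q +
     real n * nevanlinna_T (rad i) L + ln 2) + nevanlinna_T (rad i) q" for i
  proof -
    have cont: "continuous_on (sphere 0 (rad i)) F" if "circ F" for F
      by (rule regular_circle_continuous[OF circD[OF that]])
    note cs = cont[OF circ_f] cont[OF circ_q] cont[OF circ_L] cont[OF P(2)]
    have "log_plus (norm (P z)) \<le> real m * log_plus (norm (f z)) + (log_plus (norm (q z)) + real n * log_plus (norm (L z))) + ln 2" for z
    proof -
      have "log_plus (norm (P z)) \<le> log_plus (norm (f z) ^ m + norm (q z) * norm (L z) ^ n)"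
        unfolding P_def by (intro log_plus_mono order_trans[OF norm_triangle_ineq]) (simp add: norm_mult norm_power)
      also have "\<dots> \<le> log_plus (norm (f z) ^ m) + log_plus (norm (q z) * norm (L z) ^ n) + ln 2"
        by (intro log_plus_add) auto
      also have "log_plus (norm (q z) * norm (L z) ^ n) \<le> log_plus (norm (q z)) + log_plus (norm (L z) ^ n)"
        by (intro log_plus_mult) auto
      finally show ?thesis by (simp add: log_plus_power)
    qed
    hence "nevanlinna_m (rad i) P \<le> circle_mean (rad i) (\<lambda>z. real m * log_plus (norm (f z)) +
        (log_plus (norm (q z)) + real n * log_plus (norm (L z))) + ln 2)"
      unfolding nevanlinna_m_eq by (intro circle_mean_mono continuous_intros cs rad_nonneg)
    also have "\<dots> = real m * nevanlinna_m (rad i) f + (nevanlinna_m (rad i) q + real n * nevanlinna_m (rad i) L) + ln 2"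
    proof -
      have c1: "continuous_on (sphere 0 (rad i)) (\<lambda>z. real m * log_plus (norm (f z)))"
        and c2: "continuous_on (sphere 0 (rad i)) (\<lambda>z. log_plus (norm (q z)))"
        and c3: "continuous_on (sphere 0 (rad i)) (\<lambda>z. real n * log_plus (norm (L z)))"
        by (intro continuous_intros cs)+
      show ?thesis unfolding nevanlinna_m_eq
        by (simp only: circle_mean_add[OF continuous_on_add[OF c1 continuous_on_add[OF c2 c3]] continuous_on_const rad_nonneg]
          circle_mean_add[OF c1 continuous_on_add[OF c2 c3] rad_nonneg] circle_mean_add[OF c2 c3 rad_nonneg]
          circle_mean_cmult circle_mean_const)
    qed
    also have "\<dots> \<le> real m * nevanlinna_T (rad i) f + (nevanlinna_T (rad i) q + real n * nevanlinna_T (rad i) L) + ln 2"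
      by (intro add_mono mult_left_mono m_le_T f(2) q L_nonzero_meromorphic circ_f circ_q circ_L) auto
    finally have "nevanlinna_m (rad i) P \<le> real m * nevanlinna_T (rad i) f + (nevanlinna_T (rad i) q + real n * nevanlinna_T (rad i) L) + ln 2" .
    moreover have "nevanlinna_N (rad i) P \<le> nevanlinna_T (rad i) q"
      using nevanlinna_N_P_le[OF P(1) circD[OF P(2)] circD[OF circ_q] rad_ge_1, of i]
        nevanlinna_m_nonneg[OF circD[OF circ_q], of i] by (simp add: nevanlinna_T_def)
    ultimately show ?thesis by (simp add: nevanlinna_T_def)
  qed
  thus "\<forall>\<^sub>F k in \<F>. nevanlinna_T (rad (k + j)) P \<le> ?B k" by simp
qed

lemma negl_m_difference: "negl (\<lambda>k. nevanlinna_m (rad k) (\<lambda>z. f (z + d) / f z))"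
  by (intro negl_difference_quotient f circ_f bnd_T_f) auto

lemma continuous_circ:
  assumes "circ F"
  shows "continuous_on (sphere 0 (rad k)) F"
    "continuous_on (sphere 0 (rad k)) (\<lambda>z. log_plus (norm (deriv F z / F z)))"
proof -
  show "continuous_on (sphere 0 (rad k)) F" by (rule regular_circle_continuous[OF circD[OF assms]])
  have "F analytic_on {z}" "F z \<noteq> 0" if "z \<in> sphere 0 (rad k)" for z
    using circD[OF assms, of k] that by (auto simp: regular_circle_def regular_at_def)
  thus "continuous_on (sphere 0 (rad k)) (\<lambda>z. log_plus (norm (deriv F z / F z)))"
    by (intro continuous_intros continuous_at_imp_continuous_on ballI analytic_at_imp_isCont
        analytic_intros analytic_deriv) auto
qed

lemma continuous_difference: "continuous_on (sphere 0 (rad k)) (\<lambda>z. log_plus (norm (f (z + d) / f z)))"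
proof -
  have "continuous_on (sphere 0 (rad k)) (\<lambda>z. f (z + d))"
    by (rule continuous_on_compose2[OF holomorphic_on_imp_continuous_on[OF f(1)]])
      (auto intro!: continuous_intros)
  moreover have "f z \<noteq> 0" if "z \<in> sphere 0 (rad k)" for z
    using circD[OF circ_f, of k] that by (auto simp: regular_circle_def regular_at_def)
  ultimately show ?thesis
    by (intro continuous_intros continuous_circ(1)[OF circ_f]) auto
qed

lemma negl_majorant:
  assumes P: "nonzero_meromorphic P" "circ P"
  shows "negl (\<lambda>k. circle_mean (rad k) majorant)"
proof -
  have LD: "negl (\<lambda>k. nevanlinna_m (rad k) (\<lambda>z. deriv F z / F z))"
    if "nonzero_meromorphic F" "circ F" "\<And>j. j \<le> 2 \<Longrightarrow> bnd (\<lambda>k. nevanlinna_T (rad (k + j)) F)" for F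
    by (rule negl_logarithmic_derivative[OF that(1,2) that(3)]) auto
  have ld1: "negl (\<lambda>k. nevanlinna_m (rad k) (\<lambda>z. deriv P z / P z))"
    by (rule LD[OF P]) (rule bnd_T_P[OF P])
  have ld2: "negl (\<lambda>k. nevanlinna_m (rad k) (\<lambda>z. deriv f z / f z))"
    by (rule LD[OF f(2) circ_f]) (rule bnd_T_f, simp)
  have ld3: "negl (\<lambda>k. nevanlinna_m (rad k) (\<lambda>z. deriv q z / q z))"
    by (rule LD[OF q circ_q]) (rule bnd_T_q, simp)
  have ld4: "negl (\<lambda>k. nevanlinna_m (rad k) (\<lambda>z. deriv L z / L z))"
    by (rule LD[OF L_nonzero_meromorphic circ_L]) (rule bnd_T_L)
  define K where "K = log_plus (real m) + log_plus (real n) + real n * ((\<Sum>j\<le>\<tau>. log_plus (norm (a j))) + real (Suc \<tau>) * ln 2) + 2 * ln 2"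
  have eq: "circle_mean (rad k) majorant = nevanlinna_m (rad k) q + 2 * nevanlinna_m (rad k) (\<lambda>z. deriv P z / P z) +
      nevanlinna_m (rad k) (\<lambda>z. deriv f z / f z) + nevanlinna_m (rad k) (\<lambda>z. deriv q z / q z) +
      nevanlinna_m (rad k) (\<lambda>z. deriv L z / L z) +
      real n * (\<Sum>j\<le>\<tau>. nevanlinna_m (rad k) (\<lambda>z. f (z + of_nat j * c) / f z)) + K" for k
  proof -
    have c1: "continuous_on (sphere 0 (rad k)) (\<lambda>z. log_plus (norm (q z)))"
      by (intro continuous_intros continuous_circ circ_q)
    have c2: "continuous_on (sphere 0 (rad k)) (\<lambda>z. 2 * log_plus (norm (deriv P z / P z)))"
      by (intro continuous_on_mult_left continuous_circ P)
    note c3 = continuous_circ(2)[OF circ_f, of k] and c4 = continuous_circ(2)[OF circ_q, of k]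
      and c5 = continuous_circ(2)[OF circ_L, of k]
    have c6: "continuous_on (sphere 0 (rad k)) (\<lambda>z. real n * shift_sum z)"
      by (intro continuous_on_mult_left continuous_on_sum continuous_difference)
    note s2 = continuous_on_add[OF c1 c2] note s3 = continuous_on_add[OF s2 c3]
    note s4 = continuous_on_add[OF s3 c4] note s5 = continuous_on_add[OF s4 c5]
    note s6 = continuous_on_add[OF s5 c6]
    have m6: "circle_mean (rad k) (\<lambda>z. \<Sum>j\<le>\<tau>. log_plus (norm (f (z + of_nat j * c) / f z))) =
        (\<Sum>j\<le>\<tau>. circle_mean (rad k) (\<lambda>z. log_plus (norm (f (z + of_nat j * c) / f z))))"
      by (intro circle_mean_sum continuous_difference rad_nonneg) auto
    show ?thesis
      unfolding majorant_def[abs_def] nevanlinna_m_eq K_def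
      by (simp only: circle_mean_add[OF s6 continuous_on_const rad_nonneg] circle_mean_add[OF s5 c6 rad_nonneg]
        circle_mean_add[OF s4 c5 rad_nonneg] circle_mean_add[OF s3 c4 rad_nonneg] circle_mean_add[OF s2 c3 rad_nonneg]
        circle_mean_add[OF c1 c2 rad_nonneg] circle_mean_cmult circle_mean_const m6)
  qed
  show ?thesis unfolding eq
    by (intro negl_add negl_cmult negl_sum negl_const negl_m_q ld1 ld2 ld3 ld4 negl_m_difference) auto
qed

lemma continuous_majorant:
  assumes "circ P"
  shows "continuous_on (sphere 0 (rad k)) majorant"
  unfolding majorant_def[abs_def]
  by (intro continuous_on_add continuous_on_mult_left continuous_on_const continuous_on_sum continuous_circ(2)
     continuous_difference circ_f circ_q circ_L assms continuous_on_log_plus continuous_on_norm continuous_circ(1))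

lemma impossible_nonproportional:
  assumes P: "nonzero_meromorphic P" "circ P" and \<phi>: "nonzero_meromorphic \<phi>" "circ \<phi>"
    and p: "p meromorphic_on UNIV" "\<forall>\<^sub>\<approx>z. P z = p z"
    and negl_p: "negl (\<lambda>k. nevanlinna_N_bar (rad k) (\<lambda>z. 1 / p z))"
  shows "\<F> = bot"
proof (rule negl_self_contradiction)
  let ?K = "\<bar>ln (norm (zor_poly \<phi> 0 0))\<bar>"
  \<comment> \<open>The majorant counts twice: once for \<open>f * \<phi>\<close> and once for the
    proximity part of T(r, \<phi>), which bounds m(r, 1 / \<phi>) up to a constant.\<close>
  let ?B = "\<lambda>k. 2 * circle_mean (rad k) majorant + (nevanlinna_N_bar (rad k) (\<lambda>z. 1 / p z) + nevanlinna_T (rad k) q) + ?K"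
  have nB: "negl ?B" by (intro negl_add negl_cmult negl_majorant P negl_p negl_T_q negl_const) auto
  have le: "u k \<le> ?B k" for k
  proof -
    note cs = continuous_circ(1)[OF circ_f, of k] continuous_circ(1)[OF \<phi>(2), of k]
    have nz: "\<phi> z \<noteq> 0" if "z \<in> sphere 0 (rad k)" for z
      using circD[OF \<phi>(2), of k] that by (auto simp: regular_circle_def regular_at_def)
    have maj: "log_plus (norm (\<phi> z)) \<le> majorant z" "log_plus (norm (f z * \<phi> z)) \<le> majorant z" if "norm z = rad k" for z
      using that circD[OF circ_f, of k] circD[OF circ_q, of k] circD[OF circ_L, of k] circD[OF P(2), of k]
      by (auto intro!: majorant simp: regular_circle_def regular_at_def)
    have c1: "continuous_on (sphere 0 (rad k)) (\<lambda>z. log_plus (norm (1 / \<phi> z)))"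
      using nz by (intro continuous_intros cs) auto
    have "u k = circle_mean (rad k) (\<lambda>z. log_plus (norm (f z)))"
      by (simp add: scale_eq entire_nevanlinna_T[OF f(1)] nevanlinna_m_eq)
    also have "\<dots> \<le> circle_mean (rad k) (\<lambda>z. majorant z + log_plus (norm (1 / \<phi> z)))"
    proof (intro circle_mean_mono continuous_on_add continuous_majorant P c1 rad_nonneg)
      show "continuous_on (sphere 0 (rad k)) (\<lambda>z. log_plus (norm (f z)))" by (intro continuous_intros cs)
      fix z :: complex assume z: "norm z = rad k"
      have "log_plus (norm (f z)) = log_plus (norm (f z * \<phi> z) * norm (1 / \<phi> z))"
        using nz[of z] z by (simp add: norm_mult norm_divide)
      also have "\<dots> \<le> log_plus (norm (f z * \<phi> z)) + log_plus (norm (1 / \<phi> z))"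
        by (intro log_plus_mult) auto
      finally show "log_plus (norm (f z)) \<le> majorant z + log_plus (norm (1 / \<phi> z))"
        using maj(2)[OF z] by simp
    qed
    also have "\<dots> = circle_mean (rad k) majorant + nevanlinna_m (rad k) (\<lambda>z. 1 / \<phi> z)"
      unfolding nevanlinna_m_eq by (intro circle_mean_add continuous_majorant P c1 rad_nonneg)
    also have "nevanlinna_m (rad k) (\<lambda>z. 1 / \<phi> z) \<le> nevanlinna_T (rad k) \<phi> - ln (norm (zor_poly \<phi> 0 0))"
      by (rule nevanlinna_m_inverse_le[OF \<phi>(1) circD[OF \<phi>(2)] rad_ge_1])
    also have "nevanlinna_T (rad k) \<phi> \<le> circle_mean (rad k) majorant + (nevanlinna_N_bar (rad k) (\<lambda>z. 1 / p z) + nevanlinna_N (rad k) q)"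
      unfolding nevanlinna_T_def
    proof (intro add_mono nevanlinna_N_\<phi>_le P(1) \<phi>(1) p circD[OF \<phi>(2)] circD[OF circ_q] rad_ge_1)
      show "nevanlinna_m (rad k) \<phi> \<le> circle_mean (rad k) majorant"
        unfolding nevanlinna_m_eq
        by (intro circle_mean_mono continuous_majorant P maj rad_nonneg continuous_on_log_plus continuous_on_norm cs)
    qed
    also have "nevanlinna_N (rad k) q \<le> nevanlinna_T (rad k) q"
      using nevanlinna_m_nonneg[OF circD[OF circ_q], of k] by (simp add: nevanlinna_T_def)
    finally show ?thesis by simp
  qed
  show "negl u" by (rule negl_mono[OF nB]) (intro always_eventually allI le)
qed

lemma impossible_proportional:
  assumes eq: "\<And>k z. norm z = rad k \<Longrightarrow> f z ^ m = \<kappa> * q z * L z ^ n"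
  shows "\<F> = bot"
proof (rule negl_self_contradiction)
  define K where "K = real n * ((\<Sum>j\<le>\<tau>. log_plus (norm (a j))) + real (Suc \<tau>) * ln 2)"
  let ?B = "\<lambda>k. log_plus (norm \<kappa>) + nevanlinna_m (rad k) q + real n * (\<Sum>j\<le>\<tau>. nevanlinna_m (rad k) (\<lambda>z. f (z + of_nat j * c) / f z)) + K"
  have nB: "negl ?B" by (intro negl_add negl_cmult negl_sum negl_const negl_m_q negl_m_difference) auto
  have le: "u k \<le> ?B k" for k
  proof -
    have c0: "continuous_on (sphere 0 (rad k)) (\<lambda>z. log_plus (norm (f z)))"
      by (intro continuous_intros continuous_circ circ_f)
    have c1: "continuous_on (sphere 0 (rad k)) (\<lambda>z. log_plus (norm (q z)))"
      by (intro continuous_intros continuous_circ circ_q)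
    have c2: "continuous_on (sphere 0 (rad k)) (\<lambda>z. real n * shift_sum z)"
      by (intro continuous_on_mult_left continuous_on_sum continuous_difference)
    note s1 = continuous_on_add[OF continuous_on_const[of _ "log_plus (norm \<kappa>)"] c1]
    note s2 = continuous_on_add[OF s1 c2]
    have "u k = circle_mean (rad k) (\<lambda>z. log_plus (norm (f z)))"
      by (simp add: scale_eq entire_nevanlinna_T[OF f(1)] nevanlinna_m_eq)
    also have "\<dots> \<le> circle_mean (rad k) (\<lambda>z. log_plus (norm \<kappa>) + log_plus (norm (q z)) +
        real n * shift_sum z + K)"
    proof (intro circle_mean_mono c0 continuous_on_add[OF s2 continuous_on_const] rad_nonneg)
      fix z :: complex assume z: "norm z = rad k"
      hence fz: "f z \<noteq> 0" using circD[OF circ_f, of k] by (auto simp: regular_circle_def regular_at_def)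
      have "real m * log_plus (norm (f z)) = log_plus (norm (f z ^ m))"
        by (simp add: log_plus_power norm_power)
      also have "norm (f z ^ m) = norm \<kappa> * (norm (q z) * (norm (f z) ^ n * norm (L z / f z) ^ n))"
        unfolding eq[OF z] using fz by (simp add: norm_mult norm_power norm_divide power_divide)
      also have "log_plus \<dots> \<le> log_plus (norm \<kappa>) + log_plus (norm (q z) * (norm (f z) ^ n * norm (L z / f z) ^ n))"
        by (intro log_plus_mult) auto
      also have "log_plus (norm (q z) * (norm (f z) ^ n * norm (L z / f z) ^ n)) \<le>
          log_plus (norm (q z)) + log_plus (norm (f z) ^ n * norm (L z / f z) ^ n)"
        by (intro log_plus_mult) auto
      also have "log_plus (norm (f z) ^ n * norm (L z / f z) ^ n) \<le> log_plus (norm (f z) ^ n) + log_plus (norm (L z / f z) ^ n)"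
        by (intro log_plus_mult) auto
      also have "log_plus (norm (f z) ^ n) = real n * log_plus (norm (f z))" by (intro log_plus_power) auto
      also have "log_plus (norm (L z / f z) ^ n) = real n * log_plus (norm (L z / f z))" by (intro log_plus_power) auto
      also have "real n * log_plus (norm (L z / f z)) \<le> real n * shift_sum z + K"
      proof -
        have "real n * log_plus (norm (L z / f z)) \<le> real n * ((\<Sum>j\<le>\<tau>. log_plus (norm (a j))) +
            shift_sum z + real (Suc \<tau>) * ln 2)"
          using log_plus_L_over_f[of z] by (intro mult_left_mono) (auto simp: sum.distrib)
        thus ?thesis by (simp only: K_def distrib_left)
      qed
      finally have "real m * log_plus (norm (f z)) \<le> log_plus (norm \<kappa>) + (log_plus (norm (q z)) +
          (real n * log_plus (norm (f z)) + (real n * shift_sum z + K)))"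
        by simp
      \<comment> \<open>Subtracting n * log_plus |f| leaves at least one copy, since m >= n +
        1.\<close>
      moreover have "(real n + 1) * log_plus (norm (f z)) \<le> real m * log_plus (norm (f z))"
        using mn by (intro mult_right_mono) auto
      ultimately show "log_plus (norm (f z)) \<le> log_plus (norm \<kappa>) + log_plus (norm (q z)) +
        real n * shift_sum z + K"
        unfolding distrib_right by linarith
    qed
    also have "\<dots> = ?B k"
    proof -
      have m: "circle_mean (rad k) (\<lambda>z. \<Sum>j\<le>\<tau>. log_plus (norm (f (z + of_nat j * c) / f z))) =
          (\<Sum>j\<le>\<tau>. circle_mean (rad k) (\<lambda>z. log_plus (norm (f (z + of_nat j * c) / f z))))"
        by (intro circle_mean_sum continuous_difference rad_nonneg) auto
      show ?thesis unfolding nevanlinna_m_eq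
        by (simp only: circle_mean_add[OF s2 continuous_on_const rad_nonneg] circle_mean_add[OF s1 c2 rad_nonneg]
           circle_mean_add[OF continuous_on_const c1 rad_nonneg] circle_mean_cmult circle_mean_const m)
    qed
    finally show ?thesis .
  qed
  show "negl u" by (rule negl_mono[OF nB]) (intro always_eventually allI le)
qed

end

text \<open>If T stayed below M for infinitely many radii, then each z would lie well inside one of
  these circles, \<open>log_plus_modulus_le\<close> would bound |f z| uniformly, and Liouville's
  theorem would make \<open>f\<close> constant.\<close>

lemma entire_characteristic_at_top:
  assumes f: "f holomorphic_on UNIV" "nonzero_meromorphic f" and nc: "\<not> f constant_on UNIV"
    and r: "filterlim r at_top sequentially" "\<And>k. regular_circle f (r k)"
  shows "filterlim (\<lambda>k. nevanlinna_T (r k) f) at_top sequentially"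
  unfolding filterlim_at_top
proof (rule ccontr)
  assume "\<not> (\<forall>M. \<forall>\<^sub>F k in sequentially. M \<le> nevanlinna_T (r k) f)"
  then obtain M where M: "\<exists>\<^sub>F k in sequentially. nevanlinna_T (r k) f < M"
    by (auto simp: not_eventually not_le)
  define K where "K = 50 * M + 25 * \<bar>ln (norm (zor_poly f 0 0))\<bar>"
  have "norm (f z) \<le> exp K" for z
  proof -
    have "\<forall>\<^sub>F k in sequentially. r k \<ge> max 1 (4 / 3 * norm z)"
      using r(1) unfolding filterlim_at_top by blast
    from frequently_eventually_frequently[OF M this]
    obtain k where k: "nevanlinna_T (r k) f < M" "r k \<ge> max 1 (4 / 3 * norm z)"
      by (auto dest!: frequently_ex)
    have "log_plus (norm (f z)) \<le> 50 * nevanlinna_T (r k) f + 25 * \<bar>ln (norm (zor_poly f 0 0))\<bar>"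
      using k by (intro log_plus_modulus_le f r) auto
    also have "\<dots> \<le> K" using k by (simp add: K_def)
    finally have le: "log_plus (norm (f z)) \<le> K" .
    show ?thesis
    proof (cases "f z = 0")
      case False
      have "norm (f z) = exp (ln (norm (f z)))" using False by simp
      also have "\<dots> \<le> exp K" using le ln_le_log_plus[of "norm (f z)"] by simp
      finally show ?thesis .
    qed simp
  qed
  hence "bounded (range f)" unfolding bounded_iff by blast
  hence "f constant_on UNIV" by (rule Liouville_theorem[OF f(1)])
  thus False using nc by simp
qed

theorem corollary3p1:
  fixes f p q :: "complex \<Rightarrow> complex" and a :: "nat \<Rightarrow> complex" and c :: complex
    and \<tau> m n :: nat
  assumes "\<tau> \<ge> 1" and "c \<noteq> 0" and "a \<tau> \<noteq> 0"
    and "transcendental_entire f" and "nevanlinna_order f < \<infinity>"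
    and "\<exists>z. linear_difference a \<tau> c f z \<noteq> 0"
    and "m > 0" and "n > 0" and "m \<ge> n + 2"
    and "p meromorphic_on UNIV"
    and "small_wrt (\<lambda>r. nevanlinna_N_bar r (\<lambda>z. 1 / p z)) f"
    and "q meromorphic_on UNIV" and "\<not> (\<forall>\<^sub>\<approx>z. q z = 0)"
    and "small_wrt (\<lambda>r. nevanlinna_T r q) f"
  shows "\<not> (\<forall>\<^sub>\<approx>z. f z ^ m + q z * linear_difference a \<tau> c f z ^ n = p z)"
proof
  assume eq: "\<forall>\<^sub>\<approx>z. f z ^ m + q z * linear_difference a \<tau> c f z ^ n = p z"
  have f_hol: "f holomorphic_on UNIV" and np: "\<not> (\<exists>p. \<forall>z. f z = poly p z)"
    using assms(4) by (auto simp: transcendental_entire_def)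
  have nc: "\<not> f constant_on UNIV"
  proof
    assume "f constant_on UNIV"
    then obtain d where "\<And>z. f z = d" by (auto simp: constant_on_def)
    hence "\<forall>z. f z = poly [:d:] z" by simp
    thus False using np by blast
  qed
  obtain z0 where "f z0 \<noteq> 0" using nc by (auto simp: constant_on_def)
  hence f_nz: "nonzero_meromorphic f" by (rule entire_nonzero_meromorphic[OF f_hol])
  have q: "nonzero_meromorphic q" using assms by (simp add: nonzero_meromorphic_def)
  interpret difference_equation f q a c \<tau> m n
    by unfold_locales (use f_hol f_nz q assms in auto)
  have Pp: "\<forall>\<^sub>\<approx>z. P z = p z" using eq by (simp add: P_def L_def)
  obtain E1 where E1: "finite_log_measure E1"
    "(\<lambda>r. nevanlinna_N_bar r (\<lambda>z. 1 / p z)) \<in> o[inf at_top (principal (- E1))](\<lambda>r. nevanlinna_T r f)"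
    using assms(11) by (auto simp: small_wrt_def)
  obtain E2 where E2: "finite_log_measure E2"
    "(\<lambda>r. nevanlinna_T r q) \<in> o[inf at_top (principal (- E2))](\<lambda>r. nevanlinna_T r f)"
    using assms(14) by (auto simp: small_wrt_def)
  \<comment> \<open>The radii must be fixed with the case distinction already in view:
    \<open>good\<close> demands regularity of \<open>P\<close> and \<open>\<phi>\<close> in one
    case, and validity of the proportionality on whole circles in the other.\<close>
  define nondeg where "nondeg \<longleftrightarrow> nonzero_meromorphic P \<and> nonzero_meromorphic \<phi>"
  obtain \<kappa> where \<kappa>: "\<not> nondeg \<Longrightarrow> \<forall>\<^sub>\<approx>z. f z ^ m = \<kappa> * q z * L z ^ n"
    using proportional_case unfolding nondeg_def by metis
  define good where "good z \<longleftrightarrow> regular_at f z \<and> regular_at q z \<and> regular_at L z \<and>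
     (if nondeg then regular_at P z \<and> regular_at \<phi> z else f z ^ m = \<kappa> * q z * L z ^ n)" for z
  have "\<forall>\<^sub>\<approx>z. (if nondeg then regular_at P z \<and> regular_at \<phi> z else f z ^ m = \<kappa> * q z * L z ^ n)"
    using \<kappa> nonzero_meromorphic_regular_cosparse
    by (cases nondeg) (auto simp: nondeg_def intro!: eventually_conj)
  with nonzero_meromorphic_regular_cosparse[OF f_nz] nonzero_meromorphic_regular_cosparse[OF q]
    nonzero_meromorphic_regular_cosparse[OF L_nonzero_meromorphic]
  have "\<forall>\<^sub>\<approx>z. good z" by eventually_elim (simp add: good_def)
  hence B: "countable (norm ` {z. \<not> good z})" by (intro countable_image countable_cosparse_exceptions)
  obtain s where s: "s \<in> {1..<2}" "\<And>k. s * 2 ^ k \<notin> norm ` {z. \<not> good z}"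
    "\<forall>\<^sub>F k in sequentially. s * 2 ^ k \<notin> E1" "\<forall>\<^sub>F k in sequentially. s * 2 ^ k \<notin> E2"
    using exists_good_scale[OF E1(1) E2(1) B] by metis
  have s1: "s \<ge> 1" "s > 0" using s(1) by auto
  define r where "r k = s * 2 ^ k" for k :: nat
  have r1: "r k \<ge> 1" for k
    using mult_mono[of 1 s 1 "2 ^ k"] s1 by (simp add: r_def)
  have r_lim: "filterlim r at_top sequentially"
    using filterlim_scale[OF s1(2)] unfolding r_def[abs_def] .
  have good: "good z" if "norm z = r k" for z k
    using s(2)[of k] that imageI[of z "{z. \<not> good z}" norm] by (auto simp: r_def)
  have circs: "regular_circle f (r k)" "regular_circle q (r k)" "regular_circle L (r k)"
    "nondeg \<Longrightarrow> regular_circle P (r k)" "nondeg \<Longrightarrow> regular_circle \<phi> (r k)" for k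
    using good[of _ k] r1[of k] by (auto simp: regular_circle_def good_def)
  define u where "u k = nevanlinna_T (r k) f" for k
  have u0: "u k \<ge> 0" for k unfolding u_def by (intro nevanlinna_T_nonneg f_nz circs r1)
  have u_lim: "filterlim u at_top sequentially"
    unfolding u_def[abs_def] by (rule entire_characteristic_at_top[OF f_hol f_nz nc r_lim circs(1)])
  obtain K :: nat where K: "\<forall>\<^sub>F x in at_top. nevanlinna_T x f \<le> x ^ K"
    using finite_order_growth[OF assms(5)] by blast
  have "\<forall>\<^sub>F k in sequentially. u k \<le> s ^ K * (2 ^ K) ^ k"
    using eventually_compose_filterlim[OF K r_lim]
    by eventually_elim (simp add: u_def r_def power_mult_distrib mult.commute flip: power_mult)
  moreover have "\<forall>\<^sub>F k in sequentially. u k \<ge> 1" using u_lim by (auto simp: filterlim_at_top)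
  ultimately have "\<exists>\<^sub>F k in sequentially. \<forall>j\<le>3. u (k + j) \<le> 2 * (2 ^ K) ^ 3 * u k"
    by (intro frequently_regular_growth) auto
  \<comment> \<open>Under doubling of the radius the bound r ^ K grows by the factor 2 ^ K; the
    lemma is applied with this base and J = 3.\<close>
  moreover define A where "A = (2 * (2 ^ K) ^ 3 :: real)"
  ultimately have freq: "\<exists>\<^sub>F k in sequentially. \<forall>j\<le>3. u (k + j) \<le> A * u k" by simp
  \<comment> \<open>The indices of regular growth need not be cofinal in any shift-invariant way, so
    asymptotics are taken along the trace of \<open>sequentially\<close> on them; it is nontrivial
    because such indices occur infinitely often.\<close>
  define \<F> where "\<F> = inf sequentially (principal {k. \<forall>j\<le>3. u (k + j) \<le> A * u k})"
  have \<F>: "\<F> \<noteq> bot"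
  proof
    assume "\<F> = bot"
    hence "\<forall>\<^sub>F k in \<F>. False" by simp
    thus False using freq by (simp add: \<F>_def eventually_inf_principal frequently_def)
  qed
  have \<F>_le: "\<F> \<le> sequentially" by (simp add: \<F>_def)
  have growth: "\<forall>\<^sub>F k in \<F>. \<forall>j\<le>3. u (k + j) \<le> A * u k"
    by (simp add: \<F>_def eventually_inf_principal)
  interpret unbounded_scale \<F> u
    by unfold_locales (rule filterlim_mono[OF u_lim order_refl \<F>_le])
  interpret meromorphic_along \<F> u r
    by unfold_locales (use r1 \<F>_le in \<open>auto simp: r_def\<close>)
  have q_small: "\<forall>\<^sub>F k in sequentially. nevanlinna_T (r k) q \<le> \<epsilon> * u k" if "\<epsilon> > 0" for \<epsilon>
    using small_wrt_along[OF E2(2) s(4) s1(2) that]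
  proof eventually_elim
    case (elim k)
    thus ?case using u0[of k] by (simp add: r_def u_def)
  qed
  interpret equation_along f q a c \<tau> m n \<F> u r
  proof unfold_locales
    show "u k = nevanlinna_T (r k) f" for k by (simp add: u_def)
    show "circ f" "circ q" "circ L" using circs by (auto simp: circ_def)
    \<comment> \<open>The index k + j need not show regular growth itself, so the bound on
      \<open>q\<close> at later radii is taken along \<open>sequentially\<close> and only then
      combined with the growth of \<open>f\<close>.\<close>
    fix j :: nat assume j: "j \<le> 3"
    from growth have "\<forall>\<^sub>F k in \<F>. u (k + j) \<le> A * u k" by eventually_elim (use j in auto)
    thus bf: "bnd (\<lambda>k. nevanlinna_T (r (k + j)) f)" unfolding bounded_along_def u_def by blast
    have "\<forall>\<^sub>F k in sequentially. nevanlinna_T (r (k + j)) q \<le> 1 * u (k + j)"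
      using q_small[of 1] by (subst eventually_sequentially_seg) simp
    hence "\<forall>\<^sub>F k in \<F>. nevanlinna_T (r (k + j)) q \<le> nevanlinna_T (r (k + j)) f"
      by (intro filter_leD[OF \<F>_le]) (simp add: u_def)
    with bf show "bnd (\<lambda>k. nevanlinna_T (r (k + j)) q)" by (rule bnd_mono)
  next
    show "negl (\<lambda>k. nevanlinna_T (r k) q)"
      unfolding negligible_along_def using q_small filter_leD[OF \<F>_le] by blast
  qed
  show False
  proof (cases nondeg)
    case True
    have "negl (\<lambda>k. nevanlinna_N_bar (r k) (\<lambda>z. 1 / p z))"
      unfolding negligible_along_def
    proof (intro allI impI filter_leD[OF \<F>_le])
      fix \<epsilon> :: real assume "\<epsilon> > 0"
      from small_wrt_along[OF E1(2) s(3) s1(2) this]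
      show "\<forall>\<^sub>F k in sequentially. nevanlinna_N_bar (r k) (\<lambda>z. 1 / p z) \<le> \<epsilon> * u k"
      proof eventually_elim
        case (elim k)
        thus ?case using u0[of k] by (simp add: r_def u_def)
      qed
    qed
    thus False
      using impossible_nonproportional[of p] True circs \<F> assms(10) Pp by (auto simp: nondeg_def circ_def)
  next
    case False
    thus False using impossible_proportional[of \<kappa>] good \<F> by (auto simp: good_def)
  qed
qed

end
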